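(* For every integer $n\ge 1$, the polyanalytic Bergman transform of order $n$ is a unitary operator $\mathbf{Ber}^{n}:L^{2}(\mathbb{R}^{+},\mathbb{C}^{n})\to\mathbf{A}^{n}(\mathbf{U})$.
   Context: $\mathbf{U}=\{z=x+is\in\mathbb{C}: s>0\}$ is the upper half plane, $\frac{d}{dz}=\frac12\left(\frac{\partial}{\partial x}-i\frac{\partial}{\partial s}\right)$, $\frac{d}{d\overline z}=\frac12\left(\frac{\partial}{\partial x}+i\frac{\partial}{\partial s}\right)$. The polyanalytic Bergman space $\mathbf{A}^{n}(\mathbf{U})$ consists of the functions $F:\mathbf{U}\to\mathbb{C}$ with $\left(\frac{d}{d\overline z}\right)^{n}F=0$ and $\|F\|^2=\int_{\mathbf U}|F(z)|^{2}\,dx\,ds<\infty$. The space $L^{2}(\mathbb{R}^{+},\mathbb{C}^{n})$ consists of vector-valued functions $\mathbf f=(f_0,\dots,f_{n-1})$ with inner product $\langle\mathbf f,\mathbf g\rangle=\sum_{k=0}^{n-1}\langle f_k,g_k\rangle_{L^2(\mathbb R^+)}$. For $f\in L^{2}(\mathbb{R}^{+})$ and $k\ge 0$, $\mathrm{Ber}f(z)=\int_{0}^{\infty}t^{1/2}f(t)e^{izt}\,dt$ and $\mathrm{Ber}^{k}f(z)=\frac{1}{(2i)^{k}k!}\left(\frac{d}{dz}\right)^{k}\left[s^{k}\,\mathrm{Ber}f(z)\right]$, $z=x+is$. The polyanalytic Bergman transform of order $n$ is $\mathbf{Ber}^{n}\mathbf f=\sum_{k=0}^{n-1}\mathrm{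Ber}^{k}f_k$.
   Formalization: With the printed constants Ber^n is not isometric (‖Ber^k f‖² = π·16^{-k}‖f‖²); the formal theorem multiplies the k-th component by (2i)^{2k}/√π, i.e. uses (2i)^k/k! instead of 1/((2i)^k k!) and 1/√π in Ber. *)

theory Defs
  imports "HOL-Analysis.Analysis"
begin

definition upper_half_plane :: "complex set"  (\<open>\<bbbU>\<close>) where
  "\<bbbU> = {z. Im z > 0}"

text \<open>Below, \<open>z = x + \<i> s\<close>. Every derivative is only ever used at points of the open set \<open>\<bbbU>\<close>,
  so values of functions outside \<open>\<bbbU>\<close> are irrelevant.\<close>

definition partial_x :: "(complex \<Rightarrow> complex) \<Rightarrow> complex \<Rightarrow> complex" where
  "partial_x F z = vector_derivative (\<lambda>h::real. F (z + of_real h)) (at 0)"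

definition partial_s :: "(complex \<Rightarrow> complex) \<Rightarrow> complex \<Rightarrow> complex" where
  "partial_s F z = vector_derivative (\<lambda>h::real. F (z + \<i> * of_real h)) (at 0)"

definition d_dz :: "(complex \<Rightarrow> complex) \<Rightarrow> complex \<Rightarrow> complex" where
  "d_dz F z = (partial_x F z - \<i> * partial_s F z) / 2"

definition d_dzbar :: "(complex \<Rightarrow> complex) \<Rightarrow> complex \<Rightarrow> complex" where
  "d_dzbar F z = (partial_x F z + \<i> * partial_s F z) / 2"

text \<open>Functions of class \<open>C\<^sup>m\<close> in the real sense on an open set; \<open>differentiable\<close> is real
  (Frechet) differentiability, not complex differentiability.\<close>

fun C_class_on :: "nat \<Rightarrow> complex set \<Rightarrow> (complex \<Rightarrow> complex) \<Rightarrow> bool" where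
  "C_class_on 0 S F \<longleftrightarrow> continuous_on S F"
| "C_class_on (Suc m) S F \<longleftrightarrow>
     (\<forall>z\<in>S. F differentiable (at z)) \<and> C_class_on m S (partial_x F) \<and> C_class_on m S (partial_s F)"

text \<open>Lebesgue measure on the Euclidean space \<open>complex\<close> (with orthonormal basis \<open>1, \<i>\<close>) is
  \<open>dx ds\<close>. The classical meaning of the equation \<open>(d/dz\<^sup>\<star>)\<^sup>n F = 0\<close> requires \<open>F\<close> to be of
  class \<open>C\<^sup>n\<close>; without this clause the iterated derivative could be a junk value.\<close>

definition polyanalytic_Bergman :: "nat \<Rightarrow> (complex \<Rightarrow> complex) set" where
  "polyanalytic_Bergman n =
     {F. C_class_on n \<bbbU> F \<and> (\<forall>z\<in>\<bbbU>. (d_dzbar ^^ n) F z = 0) \<and>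
         integrable (lebesgue_on \<bbbU>) (\<lambda>z. (cmod (F z))\<^sup>2)}"

definition Bergman_inner :: "(complex \<Rightarrow> complex) \<Rightarrow> (complex \<Rightarrow> complex) \<Rightarrow> complex" where
  "Bergman_inner F G = (\<integral>z. F z * cnj (G z) \<partial>lebesgue_on \<bbbU>)"

definition L2_pos :: "(real \<Rightarrow> complex) set" where
  "L2_pos = {f. f \<in> borel_measurable (lebesgue_on {0<..}) \<and>
                integrable (lebesgue_on {0<..}) (\<lambda>t. (cmod (f t))\<^sup>2)}"

definition L2_pos_inner :: "(real \<Rightarrow> complex) \<Rightarrow> (real \<Rightarrow> complex) \<Rightarrow> complex" where
  "L2_pos_inner f g = (\<integral>t. f t * cnj (g t) \<partial>lebesgue_on {0<..})"

text \<open>An element of \<open>L\<^sup>2(\<real>\<^sup>+, \<complex>\<^sup>n)\<close> is represented by a family \<open>f :: nat \<Rightarrow> real \<Rightarrow> complex\<close> of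
  which only the components \<open>f 0, \<dots>, f (n - 1)\<close> on the positive half-line matter;
  \<open>L2_vec_eq\<close> is equality of the represented elements.\<close>

definition L2_vec :: "nat \<Rightarrow> (nat \<Rightarrow> real \<Rightarrow> complex) set" where
  "L2_vec n = {f. \<forall>k<n. f k \<in> L2_pos}"

definition L2_vec_eq :: "nat \<Rightarrow> (nat \<Rightarrow> real \<Rightarrow> complex) \<Rightarrow> (nat \<Rightarrow> real \<Rightarrow> complex) \<Rightarrow> bool" where
  "L2_vec_eq n f g \<longleftrightarrow> (\<forall>k<n. AE t in lebesgue_on {0<..}. f k t = g k t)"

definition L2_vec_inner :: "nat \<Rightarrow> (nat \<Rightarrow> real \<Rightarrow> complex) \<Rightarrow> (nat \<Rightarrow> real \<Rightarrow> complex) \<Rightarrow> complex" where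
  "L2_vec_inner n f g = (\<Sum>k<n. L2_pos_inner (f k) (g k))"

definition Ber :: "(real \<Rightarrow> complex) \<Rightarrow> complex \<Rightarrow> complex" where
  "Ber f z = (\<integral>t. of_real (sqrt t) * f t * exp (\<i> * z * of_real t) \<partial>lebesgue_on {0<..})"

definition Ber_k :: "nat \<Rightarrow> (real \<Rightarrow> complex) \<Rightarrow> complex \<Rightarrow> complex" where
  "Ber_k k f z =
     1 / ((2 * \<i>) ^ k * fact k) * (d_dz ^^ k) (\<lambda>w. of_real (Im w) ^ k * Ber f w) z"

definition poly_Ber :: "nat \<Rightarrow> (nat \<Rightarrow> real \<Rightarrow> complex) \<Rightarrow> complex \<Rightarrow> complex" where
  "poly_Ber n f z = (\<Sum>k<n. Ber_k k (f k) z)"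

text \<open>Leibniz' rule gives \<open>Ber_k k f z = (-4)\<^sup>-\<^sup>k \<integral> \<surd>t f(t) L\<^sub>k(2st) exp (\<i>zt) dt\<close> with the Laguerre
  polynomial \<open>L\<^sub>k\<close>, whence \<open>\<parallel>Ber_k k f\<parallel>\<^sup>2 = \<pi> 16\<^sup>-\<^sup>k \<parallel>f\<parallel>\<^sup>2\<close> for the measure \<open>dx ds\<close>. Thus \<open>poly_Ber\<close>
  itself is not isometric; multiplying the
  \<open>k\<close>-th component by the following constant restores the isometry.
  The power \<open>(2\<i>)\<^sup>2\<^sup>k\<close> turns the factor \<open>1 / (2\<i>)\<^sup>k\<close> of \<open>Ber_k\<close> into \<open>(2\<i>)\<^sup>k\<close>, and \<open>1 / \<surd>\<pi>\<close>
  compensates for the un-normalised Fourier--Laplace integral in \<open>Ber\<close>.\<close>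

definition Ber_normalization :: "nat \<Rightarrow> complex" where
  "Ber_normalization k = (2 * \<i>) ^ (2 * k) / of_real (sqrt pi)"

text \<open>Unitarity: \<open>T\<close> respects equality in \<open>L\<^sup>2\<close>, is linear, preserves inner products (hence is
  injective) and is onto. Functions on \<open>\<bbbU>\<close> are compared on \<open>\<bbbU>\<close> only.\<close>

definition unitary_L2_Bergman ::
  "nat \<Rightarrow> ((nat \<Rightarrow> real \<Rightarrow> complex) \<Rightarrow> complex \<Rightarrow> complex) \<Rightarrow> bool" where
  "unitary_L2_Bergman n T \<longleftrightarrow>
     (\<forall>f\<in>L2_vec n. T f \<in> polyanalytic_Bergman n) \<and>
     (\<forall>f\<in>L2_vec n. \<forall>g\<in>L2_vec n. L2_vec_eq n f g \<longrightarrow> (\<forall>z\<in>\<bbbU>. T f z = T g z)) \<and>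
     (\<forall>f\<in>L2_vec n. \<forall>g\<in>L2_vec n. \<forall>a b. \<forall>z\<in>\<bbbU>.
        T (\<lambda>k t. a * f k t + b * g k t) z = a * T f z + b * T g z) \<and>
     (\<forall>f\<in>L2_vec n. \<forall>g\<in>L2_vec n. Bergman_inner (T f) (T g) = L2_vec_inner n f g) \<and>
     (\<forall>F\<in>polyanalytic_Bergman n. \<exists>f\<in>L2_vec n. \<forall>z\<in>\<bbbU>. T f z = F z)"

end

theory Submission
  imports Defs "HOL-Complex_Analysis.Complex_Analysis" "HOL-Probability.Probability"
    "HOL-Real_Asymp.Real_Asymp"
begin

text \<open>
  By Leibniz' rule the normalised \<open>k\<close>-th component is
  \<open>\<pi>\<^sup>-\<^sup>1\<^sup>/\<^sup>2 \<integral> \<surd>t f(t) L\<^sub>k(2st) exp(\<i>zt) dt\<close>. On each horizontal line this is a Fourier integral, so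
  Plancherel's theorem in \<open>x\<close> followed by the orthonormality of the Laguerre polynomials in \<open>2st\<close>
  gives the isometry.

  For surjectivity, the range is complete, hence every \<open>F\<close> in the polyanalytic Bergman space differs
  from its projection onto the range by a polyanalytic \<open>G\<close> orthogonal to the range. The
  range contains \<open>s\<^sup>j (z - cnj w)\<^sup>-\<^sup>m\<close> for \<open>j < n\<close> and \<open>m \<ge> j + 2\<close>. Transported to the unit disc by the
  Cayley map centred at \<open>w\<close>, and after the usual unimodular twist, \<open>G\<close> becomes polyanalytic of
  order \<open>n\<close> on the disc and orthogonal to all polynomials of degree less than \<open>n\<close> in \<open>|\<zeta>|\<^sup>2\<close>. Its
  rotational average is such a polynomial; testing against that polynomial shows that the average
  vanishes, and its value at the centre is a multiple of \<open>G w\<close>.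
\<close>

subsection \<open>Polyanalytic functions on the upper half plane\<close>

text \<open>The obstacle is surjectivity: square integrability of F = \<Sum> s^k h_k gives no
  immediate control of the single components h_k, so F cannot be inverted component by component.
  Passing to the orthogonal complement avoids such estimates: integrability is used for G alone,
  while the components enter only through holomorphy, by Cauchy's formula on circles. The averaging
  works because two counts agree. With X = 1 - |\<zeta>|^2, the twisted G is a sum of terms X^k (1 -
  cnj \<zeta>)^(n-1-k) g_k with holomorphic g_k and k < n, and averaging turns each power cnj
  \<zeta>^l into a multiple of |\<zeta>|^(2l); hence the mean has degree less than n in X. The range
  supplies exactly the test functions X^j with j < n. Letting w vary over the half plane replaces a
  reproducing kernel formula. The constant in the isometry: Plancherel contributes 2 pi, the square
  of sqrt t / sqrt pi contributes t / pi, and the substitution x = 2st in the Laguerre integral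
  contributes 1/(2t); the product is 1.\<close>

lemma open_upper_half_plane [simp, intro]: "open \<bbbU>"
  unfolding upper_half_plane_def by (rule open_halfspace_Im_gt)

lemma partial_x_eq:
  assumes "(F has_derivative F') (at z)"
  shows "partial_x F z = F' 1"
proof -
  have "((\<lambda>h::real. F (z + of_real h)) has_derivative (\<lambda>h. F' (of_real h))) (at 0)"
    by (rule has_derivative_compose[where f = "\<lambda>h. z + of_real h" and g = F and g' = F'])
       (use assms in \<open>auto intro!: derivative_eq_intros\<close>)
  moreover have "F' (of_real h) = h *\<^sub>R F' 1" for h :: real
    using linear_scale[OF has_derivative_linear[OF assms], of h 1] by (simp add: scaleR_conv_of_real)
  ultimately have "((\<lambda>h::real. F (z + of_real h)) has_vector_derivative F' 1) (at 0)"
    by (simp add: has_vector_derivative_def)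
  then show ?thesis
    unfolding partial_x_def by (rule vector_derivative_at)
qed

lemma partial_s_eq:
  assumes "(F has_derivative F') (at z)"
  shows "partial_s F z = F' \<i>"
proof -
  have "((\<lambda>h::real. F (z + \<i> * of_real h)) has_derivative (\<lambda>h. F' (\<i> * of_real h))) (at 0)"
    by (rule has_derivative_compose[where f = "\<lambda>h. z + \<i> * of_real h" and g = F and g' = F'])
       (use assms in \<open>auto intro!: derivative_eq_intros\<close>)
  moreover have "F' (\<i> * of_real h) = h *\<^sub>R F' \<i>" for h :: real
    using linear_scale[OF has_derivative_linear[OF assms], of h \<i>]
    by (simp add: scaleR_conv_of_real mult.commute)
  ultimately have "((\<lambda>h::real. F (z + \<i> * of_real h)) has_vector_derivative F' \<i>) (at 0)"
    by (simp add: has_vector_derivative_def)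
  then show ?thesis
    unfolding partial_s_def by (rule vector_derivative_at)
qed

text \<open>The shape \<open>F w + c * G w\<close> covers sums, differences and multiples at once;
  all linearity lemmas below share it.\<close>

lemma partial_add:
  assumes "F differentiable (at z)" "G differentiable (at z)"
  shows "partial_x (\<lambda>w. F w + c * G w) z = partial_x F z + c * partial_x G z"
    and "partial_s (\<lambda>w. F w + c * G w) z = partial_s F z + c * partial_s G z"
proof -
  obtain F' G' where F: "(F has_derivative F') (at z)" and G: "(G has_derivative G') (at z)"
    using assms unfolding differentiable_def by blast
  then have FG: "((\<lambda>w. F w + c * G w) has_derivative (\<lambda>v. F' v + c * G' v)) (at z)"
    by (auto intro!: derivative_eq_intros)
  show "partial_x (\<lambda>w. F w + c * G w) z = partial_x F z + c * partial_x G z"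
    using partial_x_eq[OF FG] partial_x_eq[OF F] partial_x_eq[OF G] by simp
  show "partial_s (\<lambda>w. F w + c * G w) z = partial_s F z + c * partial_s G z"
    using partial_s_eq[OF FG] partial_s_eq[OF F] partial_s_eq[OF G] by simp
qed

text \<open>Differentiation is local. Identities between functions hold only on \<bbbU>, whereas the
  operators act on total functions, so every rewriting under a derivative passes through this lemma
  and its iterates.\<close>

lemma partial_cong:
  assumes "open S" "z \<in> S" "\<And>w. w \<in> S \<Longrightarrow> F w = G w"
  shows "partial_x F z = partial_x G z" "partial_s F z = partial_s G z"
proof -
  \<comment> \<open>One statement for both directions: \<open>c = 1\<close> serves
    \<open>partial_x\<close>, \<open>c = \<i>\<close> serves \<open>partial_s\<close>. The filter is
    \<open>nhds 0\<close>, since the two curves must agree at 0 itself too.\<close>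
  have ev: "eventually (\<lambda>h::real. z + c * of_real h \<in> S) (nhds 0)" for c
  proof -
    have "isCont (\<lambda>h::real. z + c * of_real h) 0"
      by (intro continuous_intros)
    then have "((\<lambda>h::real. z + c * of_real h) \<longlongrightarrow> z) (nhds 0)"
      by (metis (no_types, lifting) add.right_neutral continuous_within mult_zero_right of_real_0
          tendsto_at_iff_tendsto_nhds)
    from topological_tendstoD[OF this \<open>open S\<close>] \<open>z \<in> S\<close> show ?thesis
      by simp
  qed
  show "partial_x F z = partial_x G z"
    unfolding partial_x_def
    by (rule vector_derivative_cong_eq) (use ev[of 1] in \<open>auto elim!: eventually_mono intro: assms\<close>)
  show "partial_s F z = partial_s G z"
    unfolding partial_s_def
    by (rule vector_derivative_cong_eq) (use ev[of \<i>] in \<open>auto elim!: eventually_mono intro: assms\<close>)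
qed

lemma d_dz_cong:
  assumes "open S" "z \<in> S" "\<And>w. w \<in> S \<Longrightarrow> F w = G w"
  shows "(d_dz ^^ m) F z = (d_dz ^^ m) G z"
  using \<open>z \<in> S\<close>
proof (induction m arbitrary: z)
  case (Suc m)
  then show ?case
    using partial_cong[OF \<open>open S\<close> Suc.prems, of "(d_dz ^^ m) F" "(d_dz ^^ m) G"]
    by (simp add: d_dz_def[of "(d_dz ^^ m) _"])
qed (use assms in auto)

lemma d_dzbar_cong:
  assumes "open S" "z \<in> S" "\<And>w. w \<in> S \<Longrightarrow> F w = G w"
  shows "(d_dzbar ^^ m) F z = (d_dzbar ^^ m) G z"
  using \<open>z \<in> S\<close>
proof (induction m arbitrary: z)
  case (Suc m)
  then show ?case
    using partial_cong[OF \<open>open S\<close> Suc.prems, of "(d_dzbar ^^ m) F" "(d_dzbar ^^ m) G"]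
    by (simp add: d_dzbar_def[of "(d_dzbar ^^ m) _"])
qed (use assms in auto)

lemma C_class_on_cong:
  assumes "open S" "\<And>w. w \<in> S \<Longrightarrow> F w = G w" "C_class_on m S F"
  shows "C_class_on m S G"
  using assms(2,3)
proof (induction m arbitrary: F G)
  case 0
  then show ?case
    using continuous_on_cong[of S S F G] by simp
next
  case (Suc m)
  have "G differentiable (at z)" if "z \<in> S" for z
  proof -
    obtain F' where "(F has_derivative F') (at z)"
      using Suc.prems(2) \<open>z \<in> S\<close> unfolding C_class_on.simps differentiable_def by blast
    then have "(G has_derivative F') (at z)"
      by (rule has_derivative_transform_within_open[OF _ \<open>open S\<close> that]) (use Suc.prems(1) in auto)
    then show ?thesis
      unfolding differentiable_def by blast
  qed
  moreover have "C_class_on m S (partial_x G)"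
    by (rule Suc.IH[of "partial_x F"]) (use Suc.prems partial_cong(1)[OF \<open>open S\<close>, of _ F G] in auto)
  moreover have "C_class_on m S (partial_s G)"
    by (rule Suc.IH[of "partial_s F"]) (use Suc.prems partial_cong(2)[OF \<open>open S\<close>, of _ F G] in auto)
  ultimately show ?case
    by simp
qed

lemma C_class_on_add:
  assumes "open S" "C_class_on m S F" "C_class_on m S G"
  shows "C_class_on m S (\<lambda>w. F w + c * G w)"
  using assms(2,3)
proof (induction m arbitrary: F G)
  case 0
  then show ?case
    by (auto intro!: continuous_intros)
next
  case (Suc m)
  have "(\<lambda>w. F w + c * G w) differentiable (at z)" if "z \<in> S" for z
    using Suc.prems that by (auto intro!: differentiable_add differentiable_mult)
  moreover have "C_class_on m S (partial_x (\<lambda>w. F w + c * G w))"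
    by (rule C_class_on_cong[OF \<open>open S\<close> _ Suc.IH[of "partial_x F" "partial_x G"]])
       (use Suc.prems partial_add(1)[of F _ G c] in auto)
  moreover have "C_class_on m S (partial_s (\<lambda>w. F w + c * G w))"
    by (rule C_class_on_cong[OF \<open>open S\<close> _ Suc.IH[of "partial_s F" "partial_s G"]])
       (use Suc.prems partial_add(2)[of F _ G c] in auto)
  ultimately show ?case
    by simp
qed

lemma C_class_on_zero: "C_class_on m S (\<lambda>_. 0)"
proof (induction m)
  case (Suc m)
  have "partial_x (\<lambda>_. 0) = (\<lambda>_. 0)" "partial_s (\<lambda>_. 0) = (\<lambda>_. 0)"
    using partial_x_eq[of "\<lambda>_. 0" "\<lambda>_. 0"] partial_s_eq[of "\<lambda>_. 0" "\<lambda>_. 0"] by auto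
  with Suc show ?case
    by simp
qed auto

lemma C_class_on_sum:
  assumes "open S" "\<And>i. i \<in> I \<Longrightarrow> C_class_on m S (F i)"
  shows "C_class_on m S (\<lambda>w. \<Sum>i\<in>I. F i w)"
  using assms(2)
proof (induction I rule: infinite_finite_induct)
  case (insert i I)
  then show ?case
    using C_class_on_add[OF \<open>open S\<close>, of m "F i" "\<lambda>w. \<Sum>i\<in>I. F i w" 1] by simp
qed (auto simp: C_class_on_zero)

lemma C_class_on_Suc: "C_class_on (Suc m) S F \<Longrightarrow> C_class_on m S F"
proof (induction m arbitrary: F)
  case 0
  then show ?case
    by (auto intro!: continuous_at_imp_continuous_on differentiable_imp_continuous_within)
next
  case (Suc m)
  have "C_class_on m S (partial_x F)" "C_class_on m S (partial_s F)"
    using Suc.prems by (auto intro!: Suc.IH simp del: C_class_on.simps simp: C_class_on.simps(2)[of "Suc m"])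
  then show ?case
    using Suc.prems by simp
qed

lemma C_class_on_imp_continuous_on: "C_class_on m S F \<Longrightarrow> continuous_on S F"
proof (induction m)
  case (Suc m)
  then show ?case
    using C_class_on_Suc by blast
qed simp

lemma C_class_on_d_dzbar:
  assumes "open S" "C_class_on (Suc m) S F"
  shows "C_class_on m S (d_dzbar F)"
proof -
  have *: "C_class_on m S (\<lambda>w. 0 + (1/2) * (partial_x F w + \<i> * partial_s F w))"
    using assms by (intro C_class_on_add C_class_on_zero) auto
  show ?thesis
    by (rule C_class_on_cong[OF \<open>open S\<close> _ *]) (auto simp: d_dzbar_def)
qed

lemma C_class_on_d_dzbar_funpow:
  assumes "open S" "C_class_on (n + m) S F"
  shows "C_class_on m S ((d_dzbar ^^ n) F)"
  using assms(2)
proof (induction n arbitrary: m)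
  case (Suc n)
  have "C_class_on (Suc m) S ((d_dzbar ^^ n) F)"
    by (rule Suc.IH) (use Suc.prems in \<open>simp del: C_class_on.simps\<close>)
  then show ?case
    using C_class_on_d_dzbar[OF \<open>open S\<close>] by simp
qed simp

lemma d_dzbar_funpow_add:
  assumes "open S" "C_class_on m S F" "C_class_on m S G" "z \<in> S"
  shows "(d_dzbar ^^ m) (\<lambda>w. F w + c * G w) z = (d_dzbar ^^ m) F z + c * (d_dzbar ^^ m) G z"
  using assms(2,3)
proof (induction m arbitrary: F G)
  case (Suc m)
  \<comment> \<open>The innermost derivative is split off: the induction hypothesis is then applied
    to \<open>d_dzbar F\<close> and \<open>d_dzbar G\<close>, which are of class
    \<open>m\<close>.\<close>
  have "(d_dzbar ^^ Suc m) (\<lambda>w. F w + c * G w) z = (d_dzbar ^^ m) (d_dzbar (\<lambda>w. F w + c * G w)) z"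
    by (simp only: funpow_Suc_right o_apply)
  also have "\<dots> = (d_dzbar ^^ m) (\<lambda>w. d_dzbar F w + c * d_dzbar G w) z"
  proof (rule d_dzbar_cong[OF assms(1,4)])
    fix w assume "w \<in> S"
    then have "F differentiable (at w)" "G differentiable (at w)"
      using Suc.prems by auto
    from partial_add[OF this, of c] show "d_dzbar (\<lambda>w. F w + c * G w) w = d_dzbar F w + c * d_dzbar G w"
      by (simp add: d_dzbar_def field_simps)
  qed
  also have "\<dots> = (d_dzbar ^^ m) (d_dzbar F) z + c * (d_dzbar ^^ m) (d_dzbar G) z"
    by (rule Suc.IH) (use Suc.prems C_class_on_d_dzbar[OF \<open>open S\<close>] in blast)+
  finally show ?case
    by (simp only: funpow_Suc_right o_apply)
qed auto

section \<open>Powers of the imaginary part times holomorphic functions\<close>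

lemma Im_power_mult_has_derivative:
  assumes "h holomorphic_on \<bbbU>" "z \<in> \<bbbU>"
  shows "((\<lambda>w. of_real (Im w) ^ k * h w) has_derivative
           (\<lambda>v. of_nat k * of_real (Im z) ^ (k - 1) * of_real (Im v) * h z
              + of_real (Im z) ^ k * (deriv h z * v))) (at z)"
proof -
  have "(h has_field_derivative deriv h z) (at z)"
    using assms by (intro holomorphic_derivI[of h \<bbbU>]) auto
  then have "(h has_derivative (\<lambda>v. deriv h z * v)) (at z)"
    by (simp add: has_field_derivative_def)
  moreover have "((\<lambda>w. complex_of_real (Im w)) has_derivative (\<lambda>v. of_real (Im v))) (at z)"
    by (auto intro!: derivative_eq_intros)
  ultimately show ?thesis
    by (auto intro!: derivative_eq_intros simp: algebra_simps)
qed

text \<open>For \<open>k = 0\<close> the truncated exponent \<open>k - 1\<close> is harmless,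
  because the factor \<open>of_nat k\<close> vanishes.\<close>

lemma partial_Im_power_mult:
  assumes "h holomorphic_on \<bbbU>" "z \<in> \<bbbU>"
  shows "partial_x (\<lambda>w. of_real (Im w) ^ k * h w) z = of_real (Im z) ^ k * deriv h z"
    and "partial_s (\<lambda>w. of_real (Im w) ^ k * h w) z =
           of_real (Im z) ^ (k - 1) * (of_nat k * h z) + \<i> * (of_real (Im z) ^ k * deriv h z)"
  using partial_x_eq[OF Im_power_mult_has_derivative[OF assms, of k]]
        partial_s_eq[OF Im_power_mult_has_derivative[OF assms, of k]] by (auto simp: algebra_simps)

lemma d_dz_Im_power_mult:
  assumes "h holomorphic_on \<bbbU>" "z \<in> \<bbbU>"
  shows "d_dz (\<lambda>w. of_real (Im w) ^ k * h w) z =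
           of_nat k / (2 * \<i>) * (of_real (Im z) ^ (k - 1) * h z) + of_real (Im z) ^ k * deriv h z"
  unfolding d_dz_def partial_Im_power_mult[OF assms] by (simp add: field_simps)

text \<open>The operator annihilates \<open>h\<close> and sends s to \<i>/2, so it acts as a
  lowering operator on the power of s.\<close>

lemma d_dzbar_Im_power_mult:
  assumes "h holomorphic_on \<bbbU>" "z \<in> \<bbbU>"
  shows "d_dzbar (\<lambda>w. of_real (Im w) ^ k * h w) z =
           of_real (Im z) ^ (k - 1) * (of_nat k * (\<i> / 2) * h z)"
  unfolding d_dzbar_def partial_Im_power_mult[OF assms] by (simp add: field_simps)

lemma C_class_on_Im_power_mult:
  assumes "h holomorphic_on \<bbbU>"
  shows "C_class_on m \<bbbU> (\<lambda>w. of_real (Im w) ^ k * h w)"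
  using assms
proof (induction m arbitrary: k h)
  case 0
  then show ?case
    using holomorphic_on_imp_continuous_on[of h \<bbbU>] by (auto intro!: continuous_intros)
next
  case (Suc m)
  have h': "deriv h holomorphic_on \<bbbU>"
    using Suc.prems by (intro holomorphic_deriv) auto
  have "(\<lambda>w. of_real (Im w) ^ k * h w) differentiable (at z)" if "z \<in> \<bbbU>" for z
    using Im_power_mult_has_derivative[OF Suc.prems that] unfolding differentiable_def by blast
  moreover have "C_class_on m \<bbbU> (partial_x (\<lambda>w. of_real (Im w) ^ k * h w))"
    by (rule C_class_on_cong[OF _ _ Suc.IH[OF h', of k]])
       (use partial_Im_power_mult[OF Suc.prems] in auto)
  moreover have "C_class_on m \<bbbU> (partial_s (\<lambda>w. of_real (Im w) ^ k * h w))"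
    by (rule C_class_on_cong[OF _ _ C_class_on_add[OF _ Suc.IH[of "\<lambda>z. of_nat k * h z" "k - 1"] Suc.IH[OF h', of k], of \<i>]])
       (use partial_Im_power_mult[OF Suc.prems] Suc.prems in \<open>auto intro!: holomorphic_intros\<close>)
  ultimately show ?case
    by simp
qed

lemma d_dzbar_funpow_Im_power_mult:
  assumes "h holomorphic_on \<bbbU>" "z \<in> \<bbbU>"
  shows "k < m \<Longrightarrow> (d_dzbar ^^ m) (\<lambda>w. of_real (Im w) ^ k * h w) z = 0"
    and "(d_dzbar ^^ k) (\<lambda>w. of_real (Im w) ^ k * h w) z = fact k * (\<i> / 2) ^ k * h z"
proof -
  \<comment> \<open>A closed form for every \<open>m\<close>, with the falling factorial
    \<open>fact k / fact (k - m)\<close>, is what the induction carries; both claims are special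
    cases.\<close>
  have main: "(d_dzbar ^^ m) (\<lambda>w. of_real (Im w) ^ k * h w) z =
      (if m \<le> k then of_real (Im z) ^ (k - m) * (fact k / fact (k - m) * (\<i> / 2) ^ m * h z) else 0)" for m
    using assms(2)
  proof (induction m arbitrary: z)
    case (Suc m)
    show ?case
    proof (cases "m \<le> k")
      case True
      have hol: "(\<lambda>z. fact k / fact (k - m) * (\<i> / 2) ^ m * h z) holomorphic_on \<bbbU>"
        using assms(1) by (intro holomorphic_intros)
      have "(d_dzbar ^^ Suc m) (\<lambda>w. of_real (Im w) ^ k * h w) z =
          (d_dzbar ^^ 1) ((d_dzbar ^^ m) (\<lambda>w. of_real (Im w) ^ k * h w)) z"
        by simp
      also have "\<dots> = (d_dzbar ^^ 1) (\<lambda>w. of_real (Im w) ^ (k - m) * (fact k / fact (k - m) * (\<i> / 2) ^ m * h w)) z"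
        by (rule d_dzbar_cong[OF open_upper_half_plane Suc.prems]) (use Suc.IH True in auto)
      also have "\<dots> = of_real (Im z) ^ (k - m - 1) *
          (of_nat (k - m) * (\<i> / 2) * (fact k / fact (k - m) * (\<i> / 2) ^ m * h z))"
        using d_dzbar_Im_power_mult[OF hol Suc.prems, of "k - m"] by simp
      finally have *: "(d_dzbar ^^ Suc m) (\<lambda>w. of_real (Im w) ^ k * h w) z = \<dots>" .
      show ?thesis
      proof (cases "m = k")
        case False
        with True have "Suc m \<le> k" "k - m = Suc (k - Suc m)"
          by auto
        then show ?thesis
          unfolding * by (simp add: field_simps del: of_nat_Suc)
      qed (unfold *, simp)
    next
      case False
      \<comment> \<open>The zero function is written as \<open>of_real (Im w) ^ 0 * 0\<close> so
        that the rule for powers of s applies to it.\<close>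
      then have "(d_dzbar ^^ 1) ((d_dzbar ^^ m) (\<lambda>w. of_real (Im w) ^ k * h w)) z =
          (d_dzbar ^^ 1) (\<lambda>w. of_real (Im w) ^ 0 * 0) z"
        by (intro d_dzbar_cong[OF open_upper_half_plane Suc.prems]) (use Suc.IH in auto)
      also have "\<dots> = 0"
        using d_dzbar_Im_power_mult[of "\<lambda>_. 0" z 0] Suc.prems by simp
      finally show ?thesis
        using False by simp
    qed
  qed auto
  show "k < m \<Longrightarrow> (d_dzbar ^^ m) (\<lambda>w. of_real (Im w) ^ k * h w) z = 0"
    "(d_dzbar ^^ k) (\<lambda>w. of_real (Im w) ^ k * h w) z = fact k * (\<i> / 2) ^ k * h z"
    using main[of m] main[of k] by auto
qed

lemma polyanalytic_sum:
  assumes "\<And>k. k < n \<Longrightarrow> h k holomorphic_on \<bbbU>"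
  shows "C_class_on m \<bbbU> (\<lambda>z. \<Sum>k<n. of_real (Im z) ^ k * h k z)"
    and "z \<in> \<bbbU> \<Longrightarrow> (d_dzbar ^^ n) (\<lambda>z. \<Sum>k<n. of_real (Im z) ^ k * h k z) z = 0"
proof -
  have C: "C_class_on m \<bbbU> (\<lambda>z. \<Sum>k<l. of_real (Im z) ^ k * h k z)" if "l \<le> n" for m l
    using assms that by (intro C_class_on_sum C_class_on_Im_power_mult) auto
  then show "C_class_on m \<bbbU> (\<lambda>z. \<Sum>k<n. of_real (Im z) ^ k * h k z)"
    by simp
  assume z: "z \<in> \<bbbU>"
  have "(d_dzbar ^^ n) (\<lambda>z. \<Sum>k<l. of_real (Im z) ^ k * h k z) z = 0" if "l \<le> n" for l
    using that
  proof (induction l)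
    case 0
    have "(d_dzbar ^^ n) (\<lambda>w. of_real (Im w) ^ 0 * (\<lambda>_. 0) w) z = 0"
      using z by (cases "n = 0") (auto simp only: d_dzbar_funpow_Im_power_mult(1) holomorphic_on_const, auto)
    then show ?case
      by simp
  next
    case (Suc l)
    then have "(d_dzbar ^^ n) (\<lambda>z. (\<Sum>k<l. of_real (Im z) ^ k * h k z) + 1 * (of_real (Im z) ^ l * h l z)) z = 0"
      using d_dzbar_funpow_Im_power_mult(1)[of "h l" z l n] assms z
      by (subst d_dzbar_funpow_add[OF open_upper_half_plane C C_class_on_Im_power_mult z]) auto
    then show ?case
      by simp
  qed
  from this[of n] show "(d_dzbar ^^ n) (\<lambda>z. \<Sum>k<n. of_real (Im z) ^ k * h k z) z = 0"
    by simp
qed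

text \<open>Cauchy-Riemann: a real-linear \<open>F'\<close> with
  \<open>F' \<i> = \<i> * F' 1\<close> is multiplication by the number \<open>F' 1\<close>.\<close>

lemma holomorphic_on_if_d_dzbar_eq_0:
  assumes "open S" "\<And>z. z \<in> S \<Longrightarrow> F differentiable (at z)" "\<And>z. z \<in> S \<Longrightarrow> d_dzbar F z = 0"
  shows "F holomorphic_on S"
  unfolding holomorphic_on_open[OF \<open>open S\<close>]
proof (intro ballI)
  fix z assume "z \<in> S"
  then obtain F' where F': "(F has_derivative F') (at z)"
    using assms(2) unfolding differentiable_def by blast
  then have lin: "linear F'"
    by (rule has_derivative_linear)
  have "F' 1 + \<i> * F' \<i> = 0"
    using assms(3)[OF \<open>z \<in> S\<close>] partial_x_eq[OF F'] partial_s_eq[OF F'] by (simp add: d_dzbar_def)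
  then have i: "F' \<i> = \<i> * F' 1"
    by (metis add_eq_0_iff complex_i_mult_minus minus_equation_iff)
  have *: "F' v = F' 1 * v" for v
  proof -
    have "F' v = F' (Re v *\<^sub>R 1 + Im v *\<^sub>R \<i>)"
      by (rule arg_cong[of _ _ F']) (simp add: complex_eq_iff)
    also have "\<dots> = Re v *\<^sub>R F' 1 + Im v *\<^sub>R F' \<i>"
      by (simp only: linear_add[OF lin] linear_scale[OF lin])
    also have "\<dots> = F' 1 * v"
      unfolding i by (simp add: complex_eq_iff algebra_simps)
    finally show ?thesis .
  qed
  have "F' = (*) (F' 1)"
    by (rule ext) (rule *)
  then have "(F has_derivative (*) (F' 1)) (at z)"
    using F' by simp
  then show "\<exists>f'. (F has_field_derivative f') (at z)"
    unfolding has_field_derivative_def by blast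
qed

text \<open>Induction on the order: the \<open>n\<close>-th derivative of a function of order
  \<open>n + 1\<close> is holomorphic, and subtracting a suitable multiple of s^n times it lowers
  the order.\<close>

theorem polyanalytic_decomposition:
  assumes "C_class_on n \<bbbU> F" "\<And>z. z \<in> \<bbbU> \<Longrightarrow> (d_dzbar ^^ n) F z = 0"
  obtains h where "\<And>k. k < n \<Longrightarrow> h k holomorphic_on \<bbbU>"
    "\<And>z. z \<in> \<bbbU> \<Longrightarrow> F z = (\<Sum>k<n. of_real (Im z) ^ k * h k z)"
proof -
  have "\<exists>h. (\<forall>k<n. h k holomorphic_on \<bbbU>) \<and> (\<forall>z\<in>\<bbbU>. F z = (\<Sum>k<n. of_real (Im z) ^ k * h k z))"
    using assms
  proof (induction n arbitrary: F)
    case (Suc n)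
    define G where "G = (d_dzbar ^^ n) F"
    \<comment> \<open>The factor that \<open>n\<close> applications of \<open>d_dzbar\<close>
      produce from s^n; dividing by it makes the top derivatives cancel.\<close>
    define c :: complex where "c = fact n * (\<i> / 2) ^ n"
    have "c \<noteq> 0"
      by (simp add: c_def)
    have G1: "C_class_on (Suc 0) \<bbbU> G"
      unfolding G_def using Suc.prems(1) by (intro C_class_on_d_dzbar_funpow) auto
    have G: "G holomorphic_on \<bbbU>"
      by (rule holomorphic_on_if_d_dzbar_eq_0) (use G1 Suc.prems(2) in \<open>auto simp: G_def\<close>)
    define F1 where "F1 = (\<lambda>z. F z + (-1 / c) * (of_real (Im z) ^ n * G z))"
    have CF: "C_class_on n \<bbbU> F"
      using Suc.prems(1) C_class_on_Suc by blast
    have "C_class_on n \<bbbU> F1"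
      unfolding F1_def by (intro C_class_on_add C_class_on_Im_power_mult G CF) auto
    moreover have "(d_dzbar ^^ n) F1 z = 0" if "z \<in> \<bbbU>" for z
    proof -
      have "(d_dzbar ^^ n) F1 z = G z + (-1/c) * (c * G z)"
        unfolding F1_def d_dzbar_funpow_add[OF open_upper_half_plane CF C_class_on_Im_power_mult[OF G] that]
          d_dzbar_funpow_Im_power_mult(2)[OF G that] by (simp add: G_def c_def)
      then show ?thesis
        using \<open>c \<noteq> 0\<close> by simp
    qed
    ultimately obtain h where h: "\<forall>k<n. h k holomorphic_on \<bbbU>"
      "\<forall>z\<in>\<bbbU>. F1 z = (\<Sum>k<n. of_real (Im z) ^ k * h k z)"
      using Suc.IH by blast
    define h' where "h' = h(n := \<lambda>z. G z / c)"
    have "\<forall>k<Suc n. h' k holomorphic_on \<bbbU>"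
      using h(1) G \<open>c \<noteq> 0\<close> by (auto simp: h'_def less_Suc_eq intro!: holomorphic_intros)
    moreover have "F z = (\<Sum>k<Suc n. of_real (Im z) ^ k * h' k z)" if "z \<in> \<bbbU>" for z
    proof -
      have "F z = F1 z + of_real (Im z) ^ n * (G z / c)"
        by (simp add: F1_def)
      also have "F1 z = (\<Sum>k<n. of_real (Im z) ^ k * h' k z)"
        using h(2) that by (auto simp: h'_def intro!: sum.cong)
      finally show ?thesis
        by (simp add: h'_def)
    qed
    ultimately show ?case
      by blast
  qed auto
  then show thesis
    using that by blast
qed

section \<open>Leibniz' rule for the iterated holomorphic derivative\<close>

lemma d_dz_add:
  assumes "F differentiable (at z)" "G differentiable (at z)"
  shows "d_dz (\<lambda>w. F w + c * G w) z = d_dz F z + c * d_dz G z"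
  using partial_add[OF assms, of c] by (simp add: d_dz_def field_simps)

lemma d_dz_sum_Im_power_mult:
  assumes "finite I" "\<And>i. i \<in> I \<Longrightarrow> h i holomorphic_on \<bbbU>" "z \<in> \<bbbU>"
  shows "d_dz (\<lambda>w. \<Sum>i\<in>I. of_real (Im w) ^ k i * h i w) z =
     (\<Sum>i\<in>I. of_nat (k i) / (2 * \<i>) * (of_real (Im z) ^ (k i - 1) * h i z) + of_real (Im z) ^ k i * deriv (h i) z)"
  using assms(1,2)
proof (induction I rule: finite_induct)
  case empty
  show ?case
    using d_dz_Im_power_mult[of "\<lambda>_. 0" z 0] assms(3) by simp
next
  case (insert i I)
  have "(\<lambda>w. of_real (Im w) ^ k l * h l w) differentiable (at z)" if "l \<in> insert i I" for l
    using Im_power_mult_has_derivative[OF insert.prems[OF that] assms(3), of "k l"]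
    unfolding differentiable_def by blast
  then have 1: "(\<lambda>w. of_real (Im w) ^ k i * h i w) differentiable (at z)"
    and 2: "(\<lambda>w. \<Sum>i\<in>I. of_real (Im w) ^ k i * h i w) differentiable (at z)"
    using insert.hyps by (auto intro!: differentiable_sum)
  show ?case
    using insert d_dz_add[OF 1 2, of 1] d_dz_Im_power_mult[of "h i" z "k i"] assms(3) by simp
qed

text \<open>Leibniz' rule with d s / dz = 1/(2\<i>). The product of the \<open>k - i\<close> is a
  falling factorial in natural numbers; for \<open>j > k\<close> it contains the factor 0, which
  neutralises the truncated exponent \<open>k - j\<close>.\<close>

lemma d_dz_funpow_Im_power_mult:
  assumes "h holomorphic_on \<bbbU>" "z \<in> \<bbbU>"
  shows "(d_dz ^^ m) (\<lambda>w. of_real (Im w) ^ k * h w) z =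
    (\<Sum>j\<le>m. of_real (Im z) ^ (k - j) * (of_nat (m choose j) * of_nat (\<Prod>i<j. k - i) / (2 * \<i>) ^ j * (deriv ^^ (m - j)) h z))"
  using assms(2)
proof (induction m arbitrary: z)
  case (Suc m)
  define p where "p j = (\<Prod>i<j. k - i)" for j
  define H where "H = (\<lambda>m j z. of_nat (m choose j) * of_nat (p j) / (2 * \<i>) ^ j * (deriv ^^ (m - j)) h z)"
  have dh: "(deriv ^^ i) h holomorphic_on \<bbbU>" for i
    using assms(1) by (intro holomorphic_higher_deriv) auto
  have H: "H m j holomorphic_on \<bbbU>" for m j
    unfolding H_def by (intro holomorphic_on_mult holomorphic_on_const dh)
  have dH: "deriv (H m j) z = of_nat (m choose j) * of_nat (p j) / (2 * \<i>) ^ j * (deriv ^^ (Suc m - j)) h z" if "j \<le> m" for j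
  proof -
    have "(deriv ^^ (m - j)) h field_differentiable at z"
      using dh Suc.prems holomorphic_on_imp_differentiable_at by blast
    then have "deriv (H m j) z = of_nat (m choose j) * of_nat (p j) / (2 * \<i>) ^ j * deriv ((deriv ^^ (m - j)) h) z"
      unfolding H_def by (rule deriv_cmult)
    also have "deriv ((deriv ^^ (m - j)) h) = (deriv ^^ (Suc m - j)) h"
      using that by (simp add: Suc_diff_le)
    finally show ?thesis .
  qed
  define A where "A j = of_real (Im z) ^ (k - j) * (of_nat (p j) / (2 * \<i>) ^ j * (deriv ^^ (Suc m - j)) h z)" for j
  have "(d_dz ^^ Suc m) (\<lambda>w. of_real (Im w) ^ k * h w) z =
          (d_dz ^^ 1) ((d_dz ^^ m) (\<lambda>w. of_real (Im w) ^ k * h w)) z"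
    by simp
  also have "\<dots> = (d_dz ^^ 1) (\<lambda>w. \<Sum>j\<le>m. of_real (Im w) ^ (k - j) * H m j w) z"
    by (rule d_dz_cong[OF open_upper_half_plane Suc.prems]) (use Suc.IH in \<open>auto simp: H_def p_def\<close>)
  also have "\<dots> = (\<Sum>j\<le>m. of_nat (k - j) / (2 * \<i>) * (of_real (Im z) ^ (k - j - 1) * H m j z)
       + of_real (Im z) ^ (k - j) * deriv (H m j) z)"
    using d_dz_sum_Im_power_mult[of "{..m}" "H m" z "\<lambda>j. k - j"] H Suc.prems by simp
  also have "\<dots> = (\<Sum>j\<le>m. of_nat (m choose j) * A (Suc j) + of_nat (m choose j) * A j)"
  proof (rule sum.cong)
    fix j assume "j \<in> {..m}"
    moreover have "p (Suc j) = p j * (k - j)"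
      by (simp add: p_def)
    ultimately show "of_nat (k - j) / (2 * \<i>) * (of_real (Im z) ^ (k - j - 1) * H m j z)
       + of_real (Im z) ^ (k - j) * deriv (H m j) z = of_nat (m choose j) * A (Suc j) + of_nat (m choose j) * A j"
      using dH[of j] by (simp add: A_def) (simp add: H_def field_simps)
  qed simp
  \<comment> \<open>Pascal's rule: both sums are shifted to a common index.\<close>
  also have "\<dots> = (\<Sum>j\<le>Suc m. of_nat (Suc m choose j) * A j)"
  proof -
    have "(\<Sum>j\<le>Suc m. of_nat (Suc m choose j) * A j) = A 0 + (\<Sum>j\<le>m. of_nat (Suc m choose Suc j) * A (Suc j))"
      by (subst sum.atMost_Suc_shift) simp
    also have "\<dots> = (\<Sum>j\<le>m. of_nat (m choose j) * A (Suc j)) + (A 0 + (\<Sum>j\<le>m. of_nat (m choose Suc j) * A (Suc j)))"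
      by (simp add: sum.distrib algebra_simps)
    also have "A 0 + (\<Sum>j\<le>m. of_nat (m choose Suc j) * A (Suc j)) = (\<Sum>j\<le>Suc m. of_nat (m choose j) * A j)"
      by (subst sum.atMost_Suc_shift) simp
    also have "\<dots> = (\<Sum>j\<le>m. of_nat (m choose j) * A j)"
      by simp
    finally show ?thesis
      by (simp add: sum.distrib)
  qed
  finally show ?case
    by (simp add: A_def p_def mult_ac)
qed auto

subsection \<open>Square-integrable functions\<close>

text \<open>Functions, not classes modulo null sets, so \<open>L2_sq\<close> is only a squared
  seminorm. The measure is a parameter because the half line, the half plane and the real line all
  occur.\<close>

definition L2_fun :: "'a measure \<Rightarrow> ('a \<Rightarrow> complex) set" where
  "L2_fun M = {f \<in> borel_measurable M. integrable M (\<lambda>x. (cmod (f x))\<^sup>2)}"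

definition L2_sq :: "'a measure \<Rightarrow> ('a \<Rightarrow> complex) \<Rightarrow> real" where
  "L2_sq M f = (\<integral>x. (cmod (f x))\<^sup>2 \<partial>M)"

lemma L2_fun_measurable [measurable_dest]: "f \<in> L2_fun M \<Longrightarrow> f \<in> borel_measurable M"
  by (simp add: L2_fun_def)

lemma L2_fun_iff_nn_integral:
  "f \<in> L2_fun M \<longleftrightarrow> f \<in> borel_measurable M \<and> (\<integral>\<^sup>+x. ennreal ((cmod (f x))\<^sup>2) \<partial>M) < \<infinity>"
  unfolding L2_fun_def by (auto simp: integrable_iff_bounded)

lemma nn_integral_L2_sq:
  "f \<in> L2_fun M \<Longrightarrow> (\<integral>\<^sup>+x. ennreal ((cmod (f x))\<^sup>2) \<partial>M) = ennreal (L2_sq M f)"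
  unfolding L2_sq_def L2_fun_def by (auto intro!: nn_integral_eq_integral)

lemma L2_sq_nonneg [simp]: "0 \<le> L2_sq M f"
  by (simp add: L2_sq_def)

lemma cmod_mult_le_sum_squares: "cmod (a * b) \<le> (cmod a)\<^sup>2 + (cmod b)\<^sup>2"
proof -
  have "2 * (cmod a * cmod b) \<le> (cmod a)\<^sup>2 + (cmod b)\<^sup>2"
    using sum_squares_bound[of "cmod a" "cmod b"] by simp
  moreover have "0 \<le> cmod a * cmod b"
    by simp
  ultimately show ?thesis
    unfolding norm_mult by linarith
qed

lemma cmod_add_mult_sq_le: "(cmod (a + c * b))\<^sup>2 \<le> 2 * (cmod a)\<^sup>2 + 2 * (cmod c)\<^sup>2 * (cmod b)\<^sup>2"
proof -
  have "(cmod (a + c * b))\<^sup>2 \<le> (cmod a + cmod c * cmod b)\<^sup>2"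
    by (intro power_mono) (use norm_triangle_ineq[of a "c * b"] in \<open>auto simp: norm_mult\<close>)
  also have "\<dots> \<le> 2 * (cmod a)\<^sup>2 + 2 * (cmod c * cmod b)\<^sup>2"
    using sum_squares_bound[of "cmod a" "cmod c * cmod b"] by (simp add: power2_sum)
  finally show ?thesis
    by (simp add: power_mult_distrib)
qed

lemma L2_fun_integrable_mult:
  assumes "f \<in> L2_fun M" "g \<in> L2_fun M"
  shows "integrable M (\<lambda>x. f x * g x)" "integrable M (\<lambda>x. f x * cnj (g x))"
proof -
  note [measurable] = assms[THEN L2_fun_measurable]
  have i: "integrable M (\<lambda>x. (cmod (f x))\<^sup>2 + (cmod (g x))\<^sup>2)"
    using assms by (simp add: L2_fun_def)
  show "integrable M (\<lambda>x. f x * g x)"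
    by (rule Bochner_Integration.integrable_bound[OF i])
       (use cmod_mult_le_sum_squares in \<open>auto intro!: AE_I2\<close>)
  have [measurable]: "(\<lambda>x. cnj (g x)) \<in> borel_measurable M"
    by (rule borel_measurable_continuous_on[OF _ L2_fun_measurable[OF assms(2)]]) (intro continuous_intros)
  show "integrable M (\<lambda>x. f x * cnj (g x))"
    by (rule Bochner_Integration.integrable_bound[OF i])
       (use cmod_mult_le_sum_squares[of _ "cnj _"] in \<open>auto intro!: AE_I2\<close>)
qed

lemma L2_fun_add:
  assumes "f \<in> L2_fun M" "g \<in> L2_fun M"
  shows "(\<lambda>x. f x + c * g x) \<in> L2_fun M"
proof -
  note [measurable] = assms[THEN L2_fun_measurable]
  have "integrable M (\<lambda>x. 2 * (cmod (f x))\<^sup>2 + 2 * (cmod c)\<^sup>2 * (cmod (g x))\<^sup>2)"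
    using assms by (auto simp: L2_fun_def)
  then have "integrable M (\<lambda>x. (cmod (f x + c * g x))\<^sup>2)"
    by (rule Bochner_Integration.integrable_bound)
       (use cmod_add_mult_sq_le in \<open>auto intro!: AE_I2\<close>)
  then show ?thesis
    by (simp add: L2_fun_def)
qed

lemma L2_fun_zero [simp]: "(\<lambda>_. 0) \<in> L2_fun M"
  by (simp add: L2_fun_def)

lemma L2_fun_cmult: "f \<in> L2_fun M \<Longrightarrow> (\<lambda>x. c * f x) \<in> L2_fun M"
  using L2_fun_add[OF L2_fun_zero, of f M c] by simp

lemma L2_fun_diff: "f \<in> L2_fun M \<Longrightarrow> g \<in> L2_fun M \<Longrightarrow> (\<lambda>x. f x - g x) \<in> L2_fun M"
  using L2_fun_add[of f M g "-1"] by simp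

lemma L2_fun_cong:
  assumes "\<And>x. x \<in> space M \<Longrightarrow> f x = g x"
  shows "f \<in> L2_fun M \<longleftrightarrow> g \<in> L2_fun M"
proof -
  have "integrable M (\<lambda>x. (cmod (f x))\<^sup>2) \<longleftrightarrow> integrable M (\<lambda>x. (cmod (g x))\<^sup>2)"
    using assms by (intro Bochner_Integration.integrable_cong) auto
  moreover have "f \<in> borel_measurable M \<longleftrightarrow> g \<in> borel_measurable M"
    by (rule measurable_cong[OF assms])
  ultimately show ?thesis
    by (auto simp: L2_fun_def)
qed

text \<open>Expanding the square. Cauchy-Schwarz, the parallelogram law, the projection and the
  polarisation of the isometry all come from this identity.\<close>

lemma L2_sq_add:
  assumes "f \<in> L2_fun M" "g \<in> L2_fun M"
  shows "L2_sq M (\<lambda>x. f x + c * g x) =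
     L2_sq M f + (cmod c)\<^sup>2 * L2_sq M g + 2 * Re (cnj c * (\<integral>x. f x * cnj (g x) \<partial>M))"
proof -
  define h where "h x = cnj c * (f x * cnj (g x))" for x
  have pw: "(cmod (f x + c * g x))\<^sup>2 = (cmod (f x))\<^sup>2 + (cmod c)\<^sup>2 * (cmod (g x))\<^sup>2 + 2 * Re (h x)" for x
    unfolding cmod_power2 h_def by (simp add: algebra_simps power2_eq_square)
  have i: "integrable M h"
    unfolding h_def using L2_fun_integrable_mult(2)[OF assms] by simp
  have fi: "integrable M (\<lambda>x. (cmod (f x))\<^sup>2)" "integrable M (\<lambda>x. (cmod (g x))\<^sup>2)"
    using assms by (auto simp: L2_fun_def)
  have "L2_sq M (\<lambda>x. f x + c * g x) =
     L2_sq M f + (cmod c)\<^sup>2 * L2_sq M g + 2 * (\<integral>x. Re (h x) \<partial>M)"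
    unfolding L2_sq_def pw using fi integrable_Re[OF i] by simp
  also have "(\<integral>x. Re (h x) \<partial>M) = Re (cnj c * (\<integral>x. f x * cnj (g x) \<partial>M))"
  proof -
    have "integral\<^sup>L M h = cnj c * (\<integral>x. f x * cnj (g x) \<partial>M)"
      unfolding h_def by (rule integral_mult_right_zero)
    then show ?thesis
      by (metis integral_Re[OF i])
  qed
  finally show ?thesis .
qed

lemma L2_parallelogram:
  assumes "f \<in> L2_fun M" "g \<in> L2_fun M"
  shows "L2_sq M (\<lambda>x. f x - g x) + L2_sq M (\<lambda>x. f x + g x) = 2 * L2_sq M f + 2 * L2_sq M g"
  using L2_sq_add[OF assms, of 1] L2_sq_add[OF assms, of "-1"] by simp

lemma L2_sq_add_le:
  assumes "f \<in> L2_fun M" "g \<in> L2_fun M"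
  shows "L2_sq M (\<lambda>x. f x + g x) \<le> 2 * L2_sq M f + 2 * L2_sq M g"
  using L2_parallelogram[OF assms] L2_sq_nonneg[of M "\<lambda>x. f x - g x"] by linarith

lemma L2_Cauchy_Schwarz:
  assumes "f \<in> L2_fun M" "g \<in> L2_fun M"
  shows "(cmod (\<integral>x. f x * cnj (g x) \<partial>M))\<^sup>2 \<le> L2_sq M f * L2_sq M g"
proof -
  define I where "I = (\<integral>x. f x * cnj (g x) \<partial>M)"
  \<comment> \<open>The squared norm of \<open>f - t I g\<close>: multiplying by \<open>I\<close>
    makes the cross term real for every real \<open>t\<close>.\<close>
  have *: "0 \<le> L2_sq M f + t\<^sup>2 * (cmod I)\<^sup>2 * L2_sq M g - 2 * t * (cmod I)\<^sup>2" for t :: real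
  proof -
    have "Re (cnj (- (of_real t * I)) * I) = - (t * (cmod I)\<^sup>2)"
      unfolding cmod_power2 by (simp add: power2_eq_square algebra_simps)
    moreover have "(cmod (- (of_real t * I)))\<^sup>2 = t\<^sup>2 * (cmod I)\<^sup>2"
      by (simp add: norm_mult power_mult_distrib)
    ultimately have "L2_sq M (\<lambda>x. f x + (- (of_real t * I)) * g x) =
        L2_sq M f + t\<^sup>2 * (cmod I)\<^sup>2 * L2_sq M g - 2 * t * (cmod I)\<^sup>2"
      unfolding L2_sq_add[OF assms] I_def[symmetric] by simp
    then show ?thesis
      using L2_sq_nonneg by metis
  qed
  have pos: "L2_sq M g \<ge> 0" "L2_sq M f \<ge> 0"
    by auto
  show ?thesis
  proof (cases "L2_sq M g = 0")
    case True
    show ?thesis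
    proof (cases "I = 0")
      case False
      \<comment> \<open>With \<open>L2_sq M g = 0\<close> the quadratic is affine in
        \<open>t\<close>; this \<open>t\<close> gives it the value -1.\<close>
      then have "0 \<le> L2_sq M f - 2 * ((L2_sq M f + 1) / (2 * (cmod I)\<^sup>2)) * (cmod I)\<^sup>2"
        using *[of "(L2_sq M f + 1) / (2 * (cmod I)\<^sup>2)"] True by simp
      also have "\<dots> = -1"
        using False by (simp add: field_simps)
      finally show ?thesis
        by simp
    qed (use pos in \<open>simp add: I_def[symmetric]\<close>)
  next
    case False
    with pos have "L2_sq M g > 0"
      by linarith
    \<comment> \<open>The value of \<open>t\<close> is the minimiser of the quadratic when
      \<open>I\<close> is nonzero.\<close>
    then show ?thesis
      using *[of "1 / L2_sq M g"] unfolding I_def[symmetric] by (simp add: field_simps power2_eq_square)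
  qed
qed

text \<open>Riesz-Fischer: a fast subsequence converges almost everywhere, and Fatou's lemma turns
  the pointwise limit into a limit in mean for the whole sequence.\<close>

theorem L2_complete:
  assumes f: "\<And>j::nat. f j \<in> L2_fun M"
    and Cauchy: "\<And>e. e > 0 \<Longrightarrow> \<exists>N. \<forall>i\<ge>N. \<forall>j\<ge>N. L2_sq M (\<lambda>x. f i x - f j x) < e"
  obtains g where "g \<in> L2_fun M" "(\<lambda>j. L2_sq M (\<lambda>x. f j x - g x)) \<longlonglongrightarrow> 0"
proof -
  note [measurable] = f[THEN L2_fun_measurable]
  have "\<exists>r. \<forall>k. (\<forall>i\<ge>r k. \<forall>j\<ge>r k. L2_sq M (\<lambda>x. f i x - f j x) < (1/8)^k) \<and> r k < (r (Suc k) :: nat)"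
  proof (rule dependent_nat_choice)
    show "\<exists>x. \<forall>i\<ge>x. \<forall>j\<ge>x. L2_sq M (\<lambda>xa. f i xa - f j xa) < (1 / 8) ^ 0"
      using Cauchy[of 1] by simp
    show "\<exists>y. (\<forall>i\<ge>y. \<forall>j\<ge>y. L2_sq M (\<lambda>xa. f i xa - f j xa) < (1 / 8) ^ Suc k) \<and> x < y" for x k
    proof -
      obtain N where "\<forall>i\<ge>N. \<forall>j\<ge>N. L2_sq M (\<lambda>xa. f i xa - f j xa) < (1 / 8) ^ Suc k"
        using Cauchy[of "(1/8)^Suc k"] by auto
      then show ?thesis
        by (intro exI[of _ "max N (Suc x)"]) auto
    qed
  qed
  then obtain r :: "nat \<Rightarrow> nat" where r: "\<And>k i j. i \<ge> r k \<Longrightarrow> j \<ge> r k \<Longrightarrow> L2_sq M (\<lambda>x. f i x - f j x) < (1/8)^k"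
    and rS: "\<And>k. r k < r (Suc k)"
    by blast
  have mono: "r m \<le> r k" if "m \<le> k" for m k
    using lift_Suc_mono_le[of r m k] rS that by (simp add: less_imp_le)
  \<comment> \<open>The weight 2^k balances two needs: against (1/8)^k the integrals still sum, like
    (1/4)^k, and a bound on \<open>d k x\<close> forces the increments at \<open>x\<close> to decay
    like (sqrt (1/2))^k.\<close>
  define d where "d k x = 2^k * (cmod (f (r (Suc k)) x - f (r k) x))\<^sup>2" for k x
  have [measurable]: "d k \<in> borel_measurable M" for k
    unfolding d_def by measurable
  have "(\<integral>\<^sup>+x. (\<Sum>k. ennreal (d k x)) \<partial>M) = (\<Sum>k. \<integral>\<^sup>+x. ennreal (d k x) \<partial>M)"
    by (rule nn_integral_suminf) auto
  also have "\<dots> \<le> (\<Sum>k. ennreal ((1/4)^k))"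
  proof (rule suminf_le)
    fix k
    have "(\<integral>\<^sup>+x. ennreal (d k x) \<partial>M) = ennreal (2^k) * (\<integral>\<^sup>+x. ennreal ((cmod (f (r (Suc k)) x - f (r k) x))\<^sup>2) \<partial>M)"
      unfolding d_def by (simp add: ennreal_mult nn_integral_cmult)
    also have "\<dots> = ennreal (2^k) * ennreal (L2_sq M (\<lambda>x. f (r (Suc k)) x - f (r k) x))"
      by (simp add: nn_integral_L2_sq L2_fun_diff f)
    also have "\<dots> \<le> ennreal (2^k) * ennreal ((1/8)^k)"
      using r[of k "r (Suc k)" "r k"] rS[of k] by (intro mult_left_mono ennreal_leI) auto
    also have "\<dots> = ennreal ((1/4)^k)"
      by (subst ennreal_mult[symmetric]) (auto simp flip: power_mult_distrib)
    finally show "(\<integral>\<^sup>+x. ennreal (d k x) \<partial>M) \<le> ennreal ((1/4)^k)" .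
  qed auto
  also have "\<dots> = ennreal (\<Sum>k. (1/4)^k)"
    by (rule suminf_ennreal2) auto
  also have "\<dots> < \<infinity>"
    by simp
  finally have "(\<integral>\<^sup>+x. (\<Sum>k. ennreal (d k x)) \<partial>M) \<noteq> \<infinity>"
    by simp
  then have "AE x in M. (\<Sum>k. ennreal (d k x)) \<noteq> \<infinity>"
    by (intro nn_integral_PInf_AE) auto
  then have conv: "AE x in M. convergent (\<lambda>k. f (r k) x)"
  proof (eventually_elim)
    case (elim x)
    then have "summable (\<lambda>k. d k x)"
      by (intro summable_suminf_not_top) (auto simp: d_def)
    then have "(\<lambda>k. d k x) \<longlonglongrightarrow> 0"
      by (rule summable_LIMSEQ_zero)
    then have "Bseq (\<lambda>k. d k x)"
      by (meson convergentI convergent_imp_Bseq)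
    then obtain K where K: "K > 0" "\<And>k. norm (d k x) \<le> K"
      unfolding Bseq_def by blast
    have bd: "norm (f (r (Suc k)) x - f (r k) x) \<le> sqrt K * (sqrt (1/2))^k" for k
    proof -
      have "(cmod (f (r (Suc k)) x - f (r k) x))\<^sup>2 \<le> K * (1/2)^k"
        using K(2)[of k] by (simp add: d_def field_simps)
      then have "cmod (f (r (Suc k)) x - f (r k) x) \<le> sqrt (K * (1/2)^k)"
        using real_le_rsqrt by blast
      then show ?thesis
        by (simp add: real_sqrt_mult real_sqrt_power)
    qed
    have sm: "summable (\<lambda>k. sqrt K * (sqrt (1/2))^k)"
      by (intro summable_mult summable_geometric) (auto simp: real_sqrt_divide)
    have "summable (\<lambda>k. f (r (Suc k)) x - f (r k) x)"
      by (rule summable_comparison_test'[OF sm bd])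
    then have "convergent (\<lambda>n. \<Sum>k<n. f (r (Suc k)) x - f (r k) x)"
      by (simp add: summable_iff_convergent)
    then have "convergent (\<lambda>n. f (r n) x - f (r 0) x)"
      by (simp add: sum_lessThan_telescope[of "\<lambda>k. f (r k) x"])
    then have "convergent (\<lambda>n. (f (r n) x - f (r 0) x) + f (r 0) x)"
      by (intro convergent_add convergent_const)
    then show ?case
      by simp
  qed
  define g where "g x = lim (\<lambda>k. f (r k) x)" for x
  have [measurable]: "g \<in> borel_measurable M"
    unfolding g_def by measurable
  have lim: "AE x in M. (\<lambda>k. f (r k) x) \<longlonglongrightarrow> g x"
    using conv by eventually_elim (simp add: g_def convergent_LIMSEQ_iff)
  \<comment> \<open>Fatou along the subsequence, for every index \<open>i \<ge> r m\<close>; hence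
    no separate passage from the subsequence to the sequence is left.\<close>
  have bound: "(\<integral>\<^sup>+x. ennreal ((cmod (f i x - g x))\<^sup>2) \<partial>M) \<le> ennreal ((1/8)^m)" if "i \<ge> r m" for i m
  proof -
    have "(\<integral>\<^sup>+x. ennreal ((cmod (f i x - g x))\<^sup>2) \<partial>M) =
        (\<integral>\<^sup>+x. liminf (\<lambda>k. ennreal ((cmod (f i x - f (r k) x))\<^sup>2)) \<partial>M)"
    proof (rule nn_integral_cong_AE)
      show "AE x in M. ennreal ((cmod (f i x - g x))\<^sup>2) = liminf (\<lambda>k. ennreal ((cmod (f i x - f (r k) x))\<^sup>2))"
        using lim
      proof eventually_elim
        case (elim x)
        then have "(\<lambda>k. ennreal ((cmod (f i x - f (r k) x))\<^sup>2)) \<longlonglongrightarrow> ennreal ((cmod (f i x - g x))\<^sup>2)"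
          by (intro tendsto_intros)
        then show ?case
          by (intro lim_imp_Liminf[symmetric]) auto
      qed
    qed
    also have "\<dots> \<le> liminf (\<lambda>k. \<integral>\<^sup>+x. ennreal ((cmod (f i x - f (r k) x))\<^sup>2) \<partial>M)"
      by (rule nn_integral_liminf) auto
    also have "\<dots> \<le> liminf (\<lambda>k. ennreal ((1/8)^m))"
    proof (rule Liminf_mono)
      show "\<forall>\<^sub>F k in sequentially. (\<integral>\<^sup>+x. ennreal ((cmod (f i x - f (r k) x))\<^sup>2) \<partial>M) \<le> ennreal ((1/8)^m)"
        using eventually_ge_at_top[of m]
      proof eventually_elim
        case (elim k)
        then show ?case
          using r[OF that mono[OF elim]] by (simp add: nn_integral_L2_sq L2_fun_diff f)
      qed
    qed
    also have "\<dots> = ennreal ((1/8)^m)"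
      by (simp add: Liminf_const)
    finally show ?thesis .
  qed
  \<comment> \<open>The bound for \<open>m = 0\<close> shows that this difference has finite norm;
    \<open>g\<close> is then a difference of two members of \<open>L2_fun M\<close>.\<close>
  have "(\<lambda>x. f (r 0) x - g x) \<in> L2_fun M"
    unfolding L2_fun_iff_nn_integral using bound[of 0 "r 0"] le_less_trans by fastforce
  from L2_fun_diff[OF f this, of "r 0"] have g: "g \<in> L2_fun M"
    by (simp only: diff_diff_eq2 add_diff_cancel_left')
  moreover have "(\<lambda>j. L2_sq M (\<lambda>x. f j x - g x)) \<longlonglongrightarrow> 0"
  proof (rule LIMSEQ_I)
    fix e :: real assume "e > 0"
    then obtain m where m: "(1/8)^m < e"
      using real_arch_pow_inv[of e "1/8"] by auto
    have "norm (L2_sq M (\<lambda>x. f j x - g x) - 0) < e" if "j \<ge> r m" for j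
      using bound[OF that] m by (simp add: nn_integral_L2_sq L2_fun_diff f g)
    then show "\<exists>no. \<forall>n\<ge>no. norm (L2_sq M (\<lambda>x. f n x - g x) - 0) < e"
      by blast
  qed
  ultimately show thesis
    by (rule that)
qed

text \<open>The triangle inequality for the square roots, obtained from Cauchy-Schwarz, passed to
  the limit.\<close>

lemma L2_sq_limit_le:
  assumes f: "\<And>j::nat. f j \<in> L2_fun M" and g: "g \<in> L2_fun M" "F \<in> L2_fun M"
    and lim: "(\<lambda>j. L2_sq M (\<lambda>x. f j x - g x)) \<longlonglongrightarrow> 0"
    and D: "(\<lambda>j. L2_sq M (\<lambda>x. F x - f j x)) \<longlonglongrightarrow> D"
  shows "L2_sq M (\<lambda>x. F x - g x) \<le> D"
proof -
  have pw: "sqrt (L2_sq M (\<lambda>x. F x - g x)) \<le> sqrt (L2_sq M (\<lambda>x. F x - f j x)) + sqrt (L2_sq M (\<lambda>x. f j x - g x))" for j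
  proof (rule real_le_lsqrt)
    have Fj: "(\<lambda>x. F x - f j x) \<in> L2_fun M" "(\<lambda>x. f j x - g x) \<in> L2_fun M"
      using f g by (auto intro!: L2_fun_diff)
    let ?I = "\<integral>x. (F x - f j x) * cnj (f j x - g x) \<partial>M"
    have "Re ?I \<le> sqrt ((cmod ?I)\<^sup>2)"
      by (simp add: complex_Re_le_cmod)
    also have "\<dots> \<le> sqrt (L2_sq M (\<lambda>x. F x - f j x) * L2_sq M (\<lambda>x. f j x - g x))"
      using L2_Cauchy_Schwarz[OF Fj] by (intro real_sqrt_le_mono) simp
    finally show "L2_sq M (\<lambda>x. F x - g x) \<le> (sqrt (L2_sq M (\<lambda>x. F x - f j x)) + sqrt (L2_sq M (\<lambda>x. f j x - g x)))\<^sup>2"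
      using L2_sq_add[OF Fj, of 1] by (simp add: power2_sum real_sqrt_mult)
  qed auto
  have "(\<lambda>j. sqrt (L2_sq M (\<lambda>x. F x - f j x)) + sqrt (L2_sq M (\<lambda>x. f j x - g x))) \<longlonglongrightarrow> sqrt D + sqrt 0"
    by (intro tendsto_intros lim D)
  from LIMSEQ_le_const[OF this, of "sqrt (L2_sq M (\<lambda>x. F x - g x))"] pw
  show ?thesis
    by auto
qed

text \<open>A minimising sequence for the distance is Cauchy by the parallelogram law, because
  midpoints stay in \<open>V\<close>. Completeness is required in the seminorm: \<open>V\<close> has
  to contain some limit, not every function almost everywhere equal to it.\<close>

theorem L2_projection:
  assumes V: "V \<subseteq> L2_fun M" "(\<lambda>_. 0) \<in> V"
    and add: "\<And>u v c. u \<in> V \<Longrightarrow> v \<in> V \<Longrightarrow> (\<lambda>x. u x + c * v x) \<in> V"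
    and complete: "\<And>v. (\<And>j::nat. v j \<in> V) \<Longrightarrow>
        (\<And>e. e > 0 \<Longrightarrow> \<exists>N. \<forall>i\<ge>N. \<forall>j\<ge>N. L2_sq M (\<lambda>x. v i x - v j x) < e) \<Longrightarrow>
        \<exists>w\<in>V. (\<lambda>j. L2_sq M (\<lambda>x. v j x - w x)) \<longlonglongrightarrow> 0"
    and F: "F \<in> L2_fun M"
  obtains w where "w \<in> V" "\<And>v. v \<in> V \<Longrightarrow> (\<integral>x. (F x - w x) * cnj (v x) \<partial>M) = 0"
proof -
  define D where "D = (INF v\<in>V. L2_sq M (\<lambda>x. F x - v x))"
  have bdd: "bdd_below ((\<lambda>v. L2_sq M (\<lambda>x. F x - v x)) ` V)"
    by (rule bdd_belowI[of _ 0]) auto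
  have D_le: "D \<le> L2_sq M (\<lambda>x. F x - v x)" if "v \<in> V" for v
    unfolding D_def by (rule cINF_lower[OF bdd that])
  have "\<exists>v\<in>V. L2_sq M (\<lambda>x. F x - v x) < D + 1 / Suc j" for j
  proof (rule ccontr)
    assume "\<not> ?thesis"
    then have "D + 1 / Suc j \<le> D"
      unfolding D_def using V(2) by (intro cINF_greatest) (auto simp: not_less D_def)
    then show False
      by simp
  qed
  then obtain v where v: "\<And>j. v j \<in> V" "\<And>j. L2_sq M (\<lambda>x. F x - v j x) < D + 1 / Suc j"
    by metis
  have L2: "v j \<in> L2_fun M" for j
    using v(1) V(1) by auto
  have close: "L2_sq M (\<lambda>x. v i x - v j x) \<le> 2 / Suc i + 2 / Suc j" for i j
  proof -
    \<comment> \<open>The midpoint, built only from the operation that the assumption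
      \<open>add\<close> provides.\<close>
    have m: "(\<lambda>x. 0 + (1/2) * (v i x + 1 * v j x)) \<in> V"
      by (intro add V v)
    have eq: "(\<lambda>x. (F x - v j x) + (F x - v i x)) = (\<lambda>x. 0 + 2 * (F x - (0 + (1/2) * (v i x + 1 * v j x))))"
      by (auto simp: fun_eq_iff algebra_simps)
    have "L2_sq M (\<lambda>x. (F x - v j x) + (F x - v i x)) = 4 * L2_sq M (\<lambda>x. F x - (0 + (1/2) * (v i x + 1 * v j x)))"
      unfolding eq using m V(1) F by (subst L2_sq_add) (auto intro!: L2_fun_diff simp: L2_sq_def)
    then have "4 * D \<le> L2_sq M (\<lambda>x. (F x - v j x) + (F x - v i x))"
      using D_le[OF m] by simp
    moreover have "L2_sq M (\<lambda>x. v i x - v j x) + L2_sq M (\<lambda>x. (F x - v j x) + (F x - v i x)) =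
        2 * L2_sq M (\<lambda>x. F x - v j x) + 2 * L2_sq M (\<lambda>x. F x - v i x)"
      using L2_parallelogram[OF L2_fun_diff[OF F L2[of j]] L2_fun_diff[OF F L2[of i]]] by simp
    ultimately show ?thesis
      using v(2)[of i] v(2)[of j] by argo
  qed
  have "\<exists>w\<in>V. (\<lambda>j. L2_sq M (\<lambda>x. v j x - w x)) \<longlonglongrightarrow> 0"
  proof (rule complete[OF v(1)])
    fix e :: real assume "e > 0"
    then obtain N where N: "1 / Suc N < e / 4"
      using reals_Archimedean[of "e/4"] by (auto simp: inverse_eq_divide)
    have "L2_sq M (\<lambda>x. v i x - v j x) < e" if "i \<ge> N" "j \<ge> N" for i j
    proof -
      have "1 / Suc i \<le> 1 / Suc N" "1 / Suc j \<le> 1 / Suc N"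
        using that by (auto intro!: divide_left_mono)
      then show ?thesis
        using close[of i j] N by argo
    qed
    then show "\<exists>N. \<forall>i\<ge>N. \<forall>j\<ge>N. L2_sq M (\<lambda>x. v i x - v j x) < e"
      by blast
  qed
  then obtain w where w: "w \<in> V" "(\<lambda>j. L2_sq M (\<lambda>x. v j x - w x)) \<longlonglongrightarrow> 0"
    by blast
  have wL: "w \<in> L2_fun M"
    using w V by auto
  have "(\<lambda>j. L2_sq M (\<lambda>x. F x - v j x)) \<longlonglongrightarrow> D"
  proof (rule tendsto_sandwich)
    show "(\<lambda>_. D) \<longlonglongrightarrow> D"
      by simp
    show "(\<lambda>j. D + 1 / Suc j) \<longlonglongrightarrow> D"
      using tendsto_add[OF tendsto_const[of D] LIMSEQ_inverse_real_of_nat] by (simp add: inverse_eq_divide)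
  qed (use v D_le in \<open>auto intro!: always_eventually less_imp_le\<close>)
  from L2_sq_limit_le[OF L2 wL F w(2) this]
  have min: "L2_sq M (\<lambda>x. F x - w x) \<le> D" .
  have "(\<integral>x. (F x - w x) * cnj (u x) \<partial>M) = 0" if u: "u \<in> V" for u
  proof -
    define I where "I = (\<integral>x. (F x - w x) * cnj (u x) \<partial>M)"
    have uL: "u \<in> L2_fun M" and Fw: "(\<lambda>x. F x - w x) \<in> L2_fun M"
      using u V F wL by (auto intro!: L2_fun_diff)
    \<comment> \<open>Moving \<open>w\<close> by \<open>t I u\<close> cannot decrease the distance;
      the term linear in \<open>t\<close> must therefore be dominated by the quadratic one.\<close>
    have ineq: "2 * t * (cmod I)\<^sup>2 \<le> t\<^sup>2 * (cmod I)\<^sup>2 * L2_sq M u" for t :: real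
    proof -
      have "D \<le> L2_sq M (\<lambda>x. F x - (w x + (of_real t * I) * u x))"
        by (intro D_le add w u)
      also have "(\<lambda>x. F x - (w x + (of_real t * I) * u x)) = (\<lambda>x. (F x - w x) + (- (of_real t * I)) * u x)"
        by (simp add: algebra_simps)
      also have "L2_sq M \<dots> = L2_sq M (\<lambda>x. F x - w x) + t\<^sup>2 * (cmod I)\<^sup>2 * L2_sq M u - 2 * t * (cmod I)\<^sup>2"
      proof -
        have "Re (cnj (- (of_real t * I)) * I) = - (t * (cmod I)\<^sup>2)"
          unfolding cmod_power2 by (simp add: power2_eq_square algebra_simps)
        moreover have "(cmod (- (of_real t * I)))\<^sup>2 = t\<^sup>2 * (cmod I)\<^sup>2"
          by (simp add: norm_mult power_mult_distrib)
        ultimately show ?thesis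
          unfolding L2_sq_add[OF Fw uL] I_def[symmetric] by simp
      qed
      finally show ?thesis
        using min by simp
    qed
    \<comment> \<open>The summand 1 keeps the denominator positive even when \<open>u\<close> has
      norm 0, and \<open>t * L2_sq M u \<le> 1\<close> already contradicts the factor 2 unless
      \<open>I = 0\<close>.\<close>
    define t where "t = 1 / (L2_sq M u + 1)"
    have "t > 0" "t * L2_sq M u \<le> 1"
      by (auto simp: t_def add_nonneg_pos)
    have "2 * (cmod I)\<^sup>2 \<le> (t * L2_sq M u) * (cmod I)\<^sup>2"
      using ineq[of t] \<open>t > 0\<close> by (simp add: power2_eq_square mult_ac)
    also have "\<dots> \<le> 1 * (cmod I)\<^sup>2"
      by (intro mult_right_mono \<open>t * L2_sq M u \<le> 1\<close>) auto
    finally show ?thesis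
      unfolding I_def by simp
  qed
  with w(1) show thesis
    by (rule that)
qed

subsection \<open>Plancherel's theorem\<close>

lemma L2_fun_translate:
  fixes r :: real
  assumes "g \<in> L2_fun lborel"
  shows "(\<lambda>t. g (t - r)) \<in> L2_fun lborel" "L2_sq lborel (\<lambda>t. g (t - r)) = L2_sq lborel g"
proof -
  have [measurable]: "g \<in> borel_measurable borel" and i: "integrable lborel (\<lambda>t. (cmod (g t))\<^sup>2)"
    using assms by (auto simp: L2_fun_def)
  show "(\<lambda>t. g (t - r)) \<in> L2_fun lborel"
    using lborel_integrable_real_affine[OF i, of 1 "-r"] by (simp add: L2_fun_def)
  show "L2_sq lborel (\<lambda>t. g (t - r)) = L2_sq lborel g"
    unfolding L2_sq_def using lborel_integral_real_affine[of 1 "\<lambda>t. (cmod (g t))\<^sup>2" "-r"] by simp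
qed

lemma L2_sq_tendsto_0I:
  assumes "\<And>n::nat. f n \<in> borel_measurable M" "integrable M w"
    and "AE x in M. (\<lambda>n. f n x) \<longlonglongrightarrow> 0" "\<And>n. AE x in M. (cmod (f n x))\<^sup>2 \<le> w x"
  shows "(\<lambda>n. L2_sq M (f n)) \<longlonglongrightarrow> 0"
proof -
  have "(\<lambda>n. \<integral>x. (cmod (f n x))\<^sup>2 \<partial>M) \<longlonglongrightarrow> (\<integral>x. 0 \<partial>M)"
  proof (rule integral_dominated_convergence[where w = w])
    show "AE x in M. (\<lambda>n. (cmod (f n x))\<^sup>2) \<longlonglongrightarrow> 0"
      using assms(3)
    proof eventually_elim
      case (elim x)
      then have "(\<lambda>n. (cmod (f n x))\<^sup>2) \<longlonglongrightarrow> (cmod 0)\<^sup>2"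
        by (intro tendsto_intros)
      then show ?case
        by simp
    qed
    show "(\<lambda>x. (cmod (f n x))\<^sup>2) \<in> borel_measurable M" for n
      using assms(1)[of n] by measurable
  qed (use assms in auto)
  then show ?thesis
    by (simp add: L2_sq_def)
qed

text \<open>Truncate in range and domain, approximate almost everywhere by continuous functions,
  and truncate these again.\<close>

lemma L2_dense_continuous:
  assumes g: "g \<in> L2_fun (lborel :: real measure)" and "e > 0"
  obtains h B M where "h \<in> L2_fun lborel" "continuous_on UNIV h" "\<And>t. cmod (h t) \<le> B"
    "\<And>t. \<bar>t\<bar> > M \<Longrightarrow> h t = 0" "L2_sq lborel (\<lambda>t. g t - h t) < e"
proof -
  have [measurable]: "g \<in> borel_measurable borel" and gi: "integrable lborel (\<lambda>t. (cmod (g t))\<^sup>2)"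
    using g by (auto simp: L2_fun_def)
  define gM where "gM n t = (if \<bar>t\<bar> \<le> real n \<and> cmod (g t) \<le> real n then g t else 0)" for n t
  have gM_meas [measurable]: "gM n \<in> borel_measurable borel" for n
    unfolding gM_def by measurable
  have "(\<lambda>n. L2_sq lborel (\<lambda>t. g t - gM n t)) \<longlonglongrightarrow> 0"
  proof (rule L2_sq_tendsto_0I[where w = "\<lambda>t. (cmod (g t))\<^sup>2"])
    have "(\<lambda>n. g t - gM n t) \<longlonglongrightarrow> 0" for t
    proof -
      obtain m where m: "\<bar>t\<bar> + cmod (g t) \<le> real m"
        using real_arch_simple by blast
      have "\<forall>\<^sub>F n in sequentially. g t - gM n t = 0"
        using eventually_ge_at_top[of m]
      proof eventually_elim
        case (elim n)
        then have "\<bar>t\<bar> \<le> real n" "cmod (g t) \<le> real n"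
          using m norm_ge_zero[of "g t"] abs_ge_zero[of t] by linarith+
        then show ?case
          by (simp add: gM_def)
      qed
      then show ?thesis
        by (rule tendsto_eventually)
    qed
    then show "AE t in lborel. (\<lambda>n. g t - gM n t) \<longlonglongrightarrow> 0"
      by simp
  qed (use gi in \<open>auto simp: gM_def\<close>)
  then have "\<forall>\<^sub>F n in sequentially. L2_sq lborel (\<lambda>t. g t - gM n t) < e / 4"
    using \<open>e > 0\<close> by (intro order_tendstoD) auto
  then have "\<forall>\<^sub>F n in sequentially. L2_sq lborel (\<lambda>t. g t - gM n t) < e / 4 \<and> n \<ge> 1"
    using eventually_ge_at_top[of 1] by (auto intro: eventually_conj)
  then obtain m where m: "L2_sq lborel (\<lambda>t. g t - gM m t) < e / 4" "m \<ge> 1"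
    by (auto simp: eventually_sequentially)
  define M where "M = real m"
  have "M \<ge> 1"
    using m(2) by (simp add: M_def)
  \<comment> \<open>The definition of \<open>measurable_on\<close> supplies continuous functions
    that converge to \<open>gM m\<close> outside a negligible set.\<close>
  have "gM m measurable_on UNIV"
    by (intro lebesgue_measurable_imp_measurable_on measurable_completion) auto
  then obtain N k where N: "negligible N" and k: "\<And>n::nat. continuous_on UNIV (k n)"
    "\<And>t. t \<notin> N \<Longrightarrow> (\<lambda>n. k n t) \<longlonglongrightarrow> gM m t"
    unfolding measurable_on_def by auto
  \<comment> \<open>\<open>cl\<close> is the radial retraction onto the disc of radius
    \<open>M\<close>, \<open>cut\<close> a trapezoid equal to 1 on [-M, M] and 0 beyond M + 1. Both
    fix \<open>gM m\<close>, so the limit is unchanged while the approximants become uniformly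
    bounded with common bounded support.\<close>
  define cl where "cl z = (M / max M (cmod z)) *\<^sub>R z" for z :: complex
  define cut where "cut t = max 0 (min 1 (M + 1 - \<bar>t\<bar>))" for t :: real
  define h where "h n t = cut t *\<^sub>R cl (k n t)" for n t
  have cl_bound: "cmod (cl z) \<le> M" for z
  proof -
    have "M * cmod z \<le> M * max M (cmod z)"
      using \<open>M \<ge> 1\<close> by (intro mult_left_mono) auto
    then show ?thesis
      using \<open>M \<ge> 1\<close> by (simp add: cl_def divide_le_eq)
  qed
  have cl_cont: "continuous_on UNIV cl"
    unfolding cl_def using \<open>M \<ge> 1\<close> by (intro continuous_intros) (auto simp: max_def)
  have cl_id: "cl z = z" if "cmod z \<le> M" for z
    using that \<open>M \<ge> 1\<close> by (simp add: cl_def max_def)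
  have cut: "0 \<le> cut t" "cut t \<le> 1" for t
    by (auto simp: cut_def)
  have cut0: "cut t = 0" if "\<bar>t\<bar> > M + 1" for t
    using that by (auto simp: cut_def)
  have h_cont: "continuous_on UNIV (h n)" for n
    unfolding h_def cut_def
    by (intro continuous_intros continuous_on_compose2[OF cl_cont] k) auto
  have h_meas [measurable]: "h n \<in> borel_measurable borel" for n
    using h_cont by (rule borel_measurable_continuous_onI)
  have h_bound: "cmod (h n t) \<le> M" for n t
    using mult_mono[OF cut(2) cl_bound] cut(1)[of t] by (simp add: h_def)
  have h0: "h n t = 0" if "\<bar>t\<bar> > M + 1" for n t
    using cut0[OF that] by (simp add: h_def)
  have wi: "integrable lborel (\<lambda>t. (4 * M\<^sup>2) * indicator {-(M+1)..M+1} t :: real)"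
    by (intro integrable_mult_right integrable_real_indicator) (simp_all add: emeasure_lborel_Icc_eq)
  have gM_bound: "cmod (gM m t) \<le> M" for t
    using \<open>M \<ge> 1\<close> by (auto simp: gM_def M_def)
  have gM0: "gM m t = 0" if "\<bar>t\<bar> > M" for t
    using that by (auto simp: gM_def M_def)
  have dom: "(cmod (gM m t - h n t))\<^sup>2 \<le> (4 * M\<^sup>2) * indicator {-(M+1)..M+1} t" for n t
  proof (cases "\<bar>t\<bar> \<le> M + 1")
    case True
    have "cmod (gM m t - h n t) \<le> 2 * M"
      using norm_triangle_ineq4[of "gM m t" "h n t"] gM_bound[of t] h_bound[of n t] by linarith
    then have "(cmod (gM m t - h n t))\<^sup>2 \<le> (2 * M)\<^sup>2"
      by (intro power_mono) auto
    then show ?thesis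
      using True by (simp add: indicator_def abs_le_iff power_mult_distrib)
  next
    case False
    then show ?thesis
      using gM0[of t] h0[of t n] by simp
  qed
  have "(\<lambda>n. L2_sq lborel (\<lambda>t. gM m t - h n t)) \<longlonglongrightarrow> 0"
  proof (rule L2_sq_tendsto_0I[OF _ wi])
    have "AE t in lebesgue. t \<notin> N"
      using N unfolding negligible_iff_null_sets by (rule AE_not_in)
    then have "AE t in lborel. t \<notin> N"
      by (simp add: AE_completion_iff)
    then show "AE t in lborel. (\<lambda>n. gM m t - h n t) \<longlonglongrightarrow> 0"
    proof eventually_elim
      case (elim t)
      have "(\<lambda>n. cl (k n t)) \<longlonglongrightarrow> cl (gM m t)"
        using cl_cont by (intro isCont_tendsto_compose[OF _ k(2)[OF elim]]) (simp add: continuous_on_eq_continuous_at)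
      then have "(\<lambda>n. gM m t - h n t) \<longlonglongrightarrow> gM m t - cut t *\<^sub>R gM m t"
        unfolding h_def cl_id[OF gM_bound] by (intro tendsto_intros)
      moreover have "cut t *\<^sub>R gM m t = gM m t"
        using gM0[of t] by (cases "\<bar>t\<bar> \<le> M") (auto simp: cut_def)
      ultimately show ?case
        by simp
    qed
  qed (use dom in auto)
  then have "\<forall>\<^sub>F n in sequentially. L2_sq lborel (\<lambda>t. gM m t - h n t) < e / 4"
    using \<open>e > 0\<close> by (intro order_tendstoD) auto
  then obtain n where n: "L2_sq lborel (\<lambda>t. gM m t - h n t) < e / 4"
    by (auto simp: eventually_sequentially)
  have gML: "gM m \<in> L2_fun lborel"
  proof -
    have "integrable lborel (\<lambda>t. (cmod (gM m t))\<^sup>2)"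
      by (rule Bochner_Integration.integrable_bound[OF gi]) (auto simp: gM_def)
    then show ?thesis
      by (simp add: L2_fun_def)
  qed
  have gMh: "(\<lambda>t. gM m t - h n t) \<in> L2_fun lborel"
  proof -
    have "integrable lborel (\<lambda>t. (cmod (gM m t - h n t))\<^sup>2)"
      by (rule Bochner_Integration.integrable_bound[OF wi]) (use dom in \<open>auto intro!: AE_I2\<close>)
    then show ?thesis
      by (simp add: L2_fun_def)
  qed
  have hL: "h n \<in> L2_fun lborel"
    using L2_fun_diff[OF gML gMh] by simp
  have "L2_sq lborel (\<lambda>t. g t - h n t) = L2_sq lborel (\<lambda>t. (g t - gM m t) + (gM m t - h n t))"
    by simp
  also have "\<dots> \<le> 2 * L2_sq lborel (\<lambda>t. g t - gM m t) + 2 * L2_sq lborel (\<lambda>t. gM m t - h n t)"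
    by (rule L2_sq_add_le[OF L2_fun_diff[OF g gML] gMh])
  also have "\<dots> < e"
    using m n by linarith
  finally show thesis
    using that[OF hL h_cont h_bound h0] by blast
qed

text \<open>Clear for continuous functions of bounded support by dominated convergence. The general
  case follows by density, since translation preserves the norm of the error \<open>g - h\<close>;
  with error below e/16 the estimate is 8 (e/16) + 2 (e/4) = e.\<close>

lemma L2_translation_continuous:
  assumes g: "g \<in> L2_fun (lborel :: real measure)" and r: "r \<longlonglongrightarrow> 0"
  shows "(\<lambda>n. L2_sq lborel (\<lambda>t. g (t - r n) - g t)) \<longlonglongrightarrow> 0"
proof (rule LIMSEQ_I)
  fix e :: real assume "e > 0"
  then obtain h B M where h: "h \<in> L2_fun lborel" "continuous_on UNIV h" "\<And>t. cmod (h t) \<le> B"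
    "\<And>t. \<bar>t\<bar> > M \<Longrightarrow> h t = 0" "L2_sq lborel (\<lambda>t. g t - h t) < e / 16"
    using L2_dense_continuous[OF g, of "e/16"] by auto
  have [measurable]: "h \<in> borel_measurable borel"
    using h(1) by (simp add: L2_fun_def)
  have "\<forall>\<^sub>F n in sequentially. norm (r n) < 1"
    using tendsto_norm_zero[OF r] by (intro order_tendstoD) auto
  \<comment> \<open>Shifts smaller than 1 keep the translated supports inside [-(M+1), M+1], where
    one dominating function works; the initial terms are dropped by an offset.\<close>
  then obtain n0 where n0: "\<And>n. n \<ge> n0 \<Longrightarrow> \<bar>r n\<bar> < 1"
    by (auto simp: eventually_sequentially)
  have wi: "integrable lborel (\<lambda>t. (2 * B)\<^sup>2 * indicator {-(M+1)..M+1} t :: real)"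
    by (intro integrable_mult_right integrable_real_indicator) (simp_all add: emeasure_lborel_Icc_eq)
  have "(\<lambda>n. L2_sq lborel (\<lambda>t. h (t - r (n + n0)) - h t)) \<longlonglongrightarrow> 0"
  proof (rule L2_sq_tendsto_0I[OF _ wi])
    have "(\<lambda>n. h (t - r (n + n0)) - h t) \<longlonglongrightarrow> 0" for t
    proof -
      have "(\<lambda>n. t - r (n + n0)) \<longlonglongrightarrow> t - 0"
        by (intro tendsto_intros LIMSEQ_ignore_initial_segment r)
      then have "(\<lambda>n. h (t - r (n + n0))) \<longlonglongrightarrow> h (t - 0)"
        by (rule isCont_tendsto_compose[rotated]) (use h(2) in \<open>simp add: continuous_on_eq_continuous_at\<close>)
      then show ?thesis
        by (simp add: LIM_zero)
    qed
    then show "AE t in lborel. (\<lambda>n. h (t - r (n + n0)) - h t) \<longlonglongrightarrow> 0"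
      by simp
    have "(cmod (h (t - r (n + n0)) - h t))\<^sup>2 \<le> (2 * B)\<^sup>2 * indicator {-(M+1)..M+1} t" for n t
    proof (cases "\<bar>t\<bar> \<le> M + 1")
      case True
      have "cmod (h (t - r (n + n0)) - h t) \<le> 2 * B"
        using norm_triangle_ineq4[of "h (t - r (n + n0))" "h t"] h(3)[of "t - r (n + n0)"] h(3)[of t] by linarith
      then have "(cmod (h (t - r (n + n0)) - h t))\<^sup>2 \<le> (2 * B)\<^sup>2"
        by (intro power_mono) auto
      then show ?thesis
        using True by (simp add: indicator_def abs_le_iff)
    next
      case False
      then have "\<bar>t\<bar> > M" "\<bar>t - r (n + n0)\<bar> > M"
        using n0[of "n + n0"] by auto
      then show ?thesis
        using h(4) by simp
    qed
    then show "AE t in lborel. (cmod (h (t - r (n + n0)) - h t))\<^sup>2 \<le> (2 * B)\<^sup>2 * indicator {-(M+1)..M+1} t" for n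
      by simp
  qed auto
  then have "(\<lambda>n. L2_sq lborel (\<lambda>t. h (t - r n) - h t)) \<longlonglongrightarrow> 0"
    by (rule LIMSEQ_offset)
  then have "\<forall>\<^sub>F n in sequentially. L2_sq lborel (\<lambda>t. h (t - r n) - h t) < e / 4"
    using \<open>e > 0\<close> by (intro order_tendstoD) auto
  then obtain n1 where n1: "\<And>n. n \<ge> n1 \<Longrightarrow> L2_sq lborel (\<lambda>t. h (t - r n) - h t) < e / 4"
    by (auto simp: eventually_sequentially)
  have "norm (L2_sq lborel (\<lambda>t. g (t - r n) - g t) - 0) < e" if "n \<ge> n1" for n
  proof -
    define d where "d t = g t - h t" for t
    have d: "d \<in> L2_fun lborel" "L2_sq lborel d < e / 16"
      unfolding d_def using L2_fun_diff[OF g h(1)] h(5) by auto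
    note d' = L2_fun_translate[OF d(1), of "r n"]
    have hd: "(\<lambda>t. h (t - r n) - h t) \<in> L2_fun lborel"
      using L2_fun_translate(1)[OF h(1)] h(1) by (rule L2_fun_diff)
    have "L2_sq lborel (\<lambda>t. g (t - r n) - g t) =
        L2_sq lborel (\<lambda>t. (d (t - r n) + (- d t)) + (h (t - r n) - h t))"
      by (simp add: d_def)
    also have "\<dots> \<le> 2 * L2_sq lborel (\<lambda>t. d (t - r n) + (- d t)) + 2 * L2_sq lborel (\<lambda>t. h (t - r n) - h t)"
      by (rule L2_sq_add_le[OF _ hd]) (use L2_fun_diff[OF d'(1) d(1)] in simp)
    also have "L2_sq lborel (\<lambda>t. d (t - r n) + (- d t)) \<le> 2 * L2_sq lborel d + 2 * L2_sq lborel d"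
      using L2_sq_add_le[OF d'(1) L2_fun_cmult[OF d(1), of "-1"]] d'(2) by (simp add: L2_sq_def)
    finally show ?thesis
      using d(2) n1[OF that] by simp
  qed
  then show "\<exists>no. \<forall>n\<ge>no. norm (L2_sq lborel (\<lambda>t. g (t - r n) - g t) - 0) < e"
    by blast
qed

text \<open>The difference to the limit is an inner product of \<open>g\<close> with
  \<open>g (t - r n) - g t\<close>, so Cauchy-Schwarz reduces the claim to continuity of
  translation.\<close>

lemma autocorrelation_tendsto:
  assumes g: "g \<in> L2_fun (lborel :: real measure)" and r: "r \<longlonglongrightarrow> 0"
  shows "(\<lambda>n. \<integral>t. g t * cnj (g (t - r n)) \<partial>lborel) \<longlonglongrightarrow> of_real (L2_sq lborel g)"
proof -
  have eq: "(\<integral>t. g t * cnj (g (t - r n)) \<partial>lborel) - of_real (L2_sq lborel g) =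
      (\<integral>t. g t * cnj (g (t - r n) - g t) \<partial>lborel)" for n
  proof -
    have "of_real (L2_sq lborel g) = (\<integral>t. g t * cnj (g t) \<partial>lborel)"
      unfolding L2_sq_def integral_complex_of_real[symmetric] complex_norm_square ..
    then show ?thesis
      using L2_fun_integrable_mult(2)[OF g L2_fun_translate(1)[OF g]] L2_fun_integrable_mult(2)[OF g g]
      by (simp add: algebra_simps flip: Bochner_Integration.integral_diff)
  qed
  have "(\<lambda>n. (\<integral>t. g t * cnj (g (t - r n)) \<partial>lborel) - of_real (L2_sq lborel g)) \<longlonglongrightarrow> 0"
  proof (rule tendsto_norm_zero_cancel, rule tendsto_sandwich[where f = "\<lambda>_. 0"])
    show "(\<lambda>n. sqrt (L2_sq lborel g * L2_sq lborel (\<lambda>t. g (t - r n) - g t))) \<longlonglongrightarrow> 0"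
      using tendsto_real_sqrt[OF tendsto_mult_left[OF L2_translation_continuous[OF g r], of "L2_sq lborel g"]]
      by simp
    show "\<forall>\<^sub>F n in sequentially. norm ((\<integral>t. g t * cnj (g (t - r n)) \<partial>lborel) - of_real (L2_sq lborel g))
        \<le> sqrt (L2_sq lborel g * L2_sq lborel (\<lambda>t. g (t - r n) - g t))"
      unfolding eq using L2_Cauchy_Schwarz[OF g L2_fun_diff[OF L2_fun_translate(1)[OF g] g]]
      by (intro always_eventually allI real_le_rsqrt) simp
  qed auto
  then show ?thesis
    by (rule LIM_zero_cancel)
qed

section \<open>Gaussian averages and Plancherel's theorem\<close>

lemma std_normal_measure [simp]: "sets std_normal_distribution = sets borel" "space std_normal_distribution = UNIV"
  by auto

lemma nn_integral_std_normal:
  assumes [measurable]: "f \<in> borel_measurable borel"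
  shows "(\<integral>\<^sup>+u. f u \<partial>std_normal_distribution) = (\<integral>\<^sup>+u. ennreal (std_normal_density u) * f u \<partial>lborel)"
  by (rule nn_integral_density) auto

lemma integral_std_normal:
  fixes f :: "real \<Rightarrow> complex"
  assumes [measurable]: "f \<in> borel_measurable borel"
  shows "(\<integral>u. f u \<partial>std_normal_distribution) = (\<integral>u. std_normal_density u *\<^sub>R f u \<partial>lborel)"
  by (rule integral_density) auto

text \<open>A bounded kernel times an integrable function is integrable on the product with a
  probability measure. \<open>b\<close> may absorb factors that depend on \<open>u\<close> alone, as
  in its first application.\<close>

lemma Fubini_std_normal:
  fixes b :: "real \<Rightarrow> real \<Rightarrow> complex"
  assumes g: "integrable lborel g" and b [measurable]: "case_prod b \<in> borel_measurable (borel \<Otimes>\<^sub>M borel)"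
    and B: "\<And>t u. cmod (b t u) \<le> B"
  shows "(\<integral>u. (\<integral>t. g t * b t u \<partial>lborel) \<partial>std_normal_distribution) =
     (\<integral>t. g t * (\<integral>u. b t u \<partial>std_normal_distribution) \<partial>lborel)"
proof -
  interpret N: prob_space std_normal_distribution
    by (rule prob_space_normal_density) simp
  interpret pair_sigma_finite lborel std_normal_distribution ..
  have [measurable]: "g \<in> borel_measurable borel"
    using g by auto
  have "integrable (lborel \<Otimes>\<^sub>M std_normal_distribution) (\<lambda>(t, u). g t * b t u)"
  proof (rule Fubini_integrable)
    show "(\<lambda>(t, u). g t * b t u) \<in> borel_measurable (lborel \<Otimes>\<^sub>M std_normal_distribution)"
      by (subst measurable_cong_sets[OF sets_pair_measure_cong[OF sets_lborel std_normal_measure(1)] refl]) measurable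
    have bm: "(\<lambda>u. b t u) \<in> borel_measurable borel" for t
      by measurable
    have bi: "integrable std_normal_distribution (\<lambda>u. b t u)" for t
      by (rule N.integrable_const_bound[of _ B]) (use B bm in auto)
    then show "AE t in lborel. integrable std_normal_distribution (\<lambda>u. case (t, u) of (t, u) \<Rightarrow> g t * b t u)"
      by simp
    show "integrable lborel (\<lambda>t. \<integral>u. norm (case (t, u) of (t, u) \<Rightarrow> g t * b t u) \<partial>std_normal_distribution)"
    proof (rule Bochner_Integration.integrable_bound[OF integrable_mult_left[OF integrable_norm[OF g], of B]])
      show "(\<lambda>t. \<integral>u. norm (case (t, u) of (t, u) \<Rightarrow> g t * b t u) \<partial>std_normal_distribution) \<in> borel_measurable lborel"
        by (rule N.borel_measurable_lebesgue_integral)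
          (subst measurable_cong_sets[OF sets_pair_measure_cong[OF sets_lborel std_normal_measure(1)] refl], measurable)
      have "(\<integral>u. norm (g t * b t u) \<partial>std_normal_distribution) \<le> cmod (g t) * B" for t
      proof -
        have "(\<integral>u. norm (g t * b t u) \<partial>std_normal_distribution) \<le> (\<integral>u. cmod (g t) * B \<partial>std_normal_distribution)"
          using bi B by (intro integral_mono) (auto simp: norm_mult intro!: mult_left_mono)
        then show ?thesis
          by (simp add: N.prob_space[simplified])
      qed
      moreover have "0 \<le> B"
        using B[of 0 0] norm_ge_zero order_trans by blast
      ultimately show "AE t in lborel. norm (\<integral>u. norm (case (t, u) of (t, u) \<Rightarrow> g t * b t u) \<partial>std_normal_distribution) \<le> norm (cmod (g t) * B)"
        by (auto simp: abs_mult)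
    qed
  qed
  from Fubini_integral[OF this] show ?thesis
    by simp
qed

text \<open>The sign and the missing normalisation match exp(\<i>zt) in \<open>Ber\<close>;
  Plancherel then carries the factor 2 pi.\<close>

definition fourier :: "(real \<Rightarrow> complex) \<Rightarrow> real \<Rightarrow> complex" where
  "fourier g x = (\<integral>t. g t * exp (\<i> * of_real (x * t)) \<partial>lborel)"

lemma norm_exp_i_times_of_real [simp]: "cmod (exp (\<i> * of_real x)) = 1"
  by simp

lemma fourier_bound:
  assumes "integrable lborel g"
  shows "cmod (fourier g x) \<le> (\<integral>t. cmod (g t) \<partial>lborel)"
  unfolding fourier_def
  by (rule order_trans[OF integral_norm_bound]) (simp add: norm_mult)

lemma fourier_measurable [measurable]:
  assumes [measurable]: "g \<in> borel_measurable borel"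
  shows "fourier g \<in> borel_measurable borel"
  unfolding fourier_def by (rule sigma_finite_measure.borel_measurable_lebesgue_integral[OF sigma_finite_lborel]) measurable

lemma cnj_fourier: "cnj (fourier g x) = (\<integral>t. cnj (g t) * exp (\<i> * of_real (- (x * t))) \<partial>lborel)"
  unfolding fourier_def Bochner_Integration.integral_cnj[symmetric] by (simp add: exp_cnj)

lemma integral_std_normal_exp:
  "(\<integral>u. exp (\<i> * of_real (y * u)) \<partial>std_normal_distribution) = of_real (exp (- (y\<^sup>2) / 2))"
  using fun_cong[OF char_std_normal_distribution, of y] by (simp add: char_def)

text \<open>The Gaussian is its own Fourier transform up to scaling: averaging |fourier g|^2 over a
  Gaussian of width \<open>R\<close> equals averaging the autocorrelation of \<open>g\<close> over
  one of width 1/R. Expanding both transforms and integrating the Gaussian first makes every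
  integral absolutely convergent.\<close>

lemma fourier_gauss_average:
  assumes g: "integrable lborel g" "g \<in> L2_fun lborel" and R: "R > 0"
  shows "(\<integral>u. fourier g (R * u) * cnj (fourier g (R * u)) \<partial>std_normal_distribution) =
     of_real (sqrt (2 * pi) / R) *
       (\<integral>v. (\<integral>t. g t * cnj (g (t - v / R)) \<partial>lborel) \<partial>std_normal_distribution)"
proof -
  interpret N: prob_space std_normal_distribution
    by (rule prob_space_normal_density) simp
  have [measurable]: "g \<in> borel_measurable borel"
    using g by auto
  have gc: "integrable lborel (\<lambda>t. cnj (g t))"
    using g by simp
  have fb: "cmod (fourier g x) \<le> (\<integral>t. cmod (g t) \<partial>lborel)" for x
    by (rule fourier_bound[OF g(1)])
  have cnj_meas [measurable]: "(\<lambda>x. cnj (f x)) \<in> borel_measurable N" if "f \<in> borel_measurable N" for f and N :: "'a measure"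
    by (rule borel_measurable_continuous_on[OF _ that]) (intro continuous_intros)
  have "(\<integral>u. fourier g (R * u) * cnj (fourier g (R * u)) \<partial>std_normal_distribution) =
      (\<integral>u. (\<integral>t. g t * (exp (\<i> * of_real (R * u * t)) * cnj (fourier g (R * u))) \<partial>lborel) \<partial>std_normal_distribution)"
    by (subst (1) fourier_def) (simp add: mult.assoc flip: integral_mult_left_zero)
  also have "\<dots> = (\<integral>t. g t * (\<integral>u. exp (\<i> * of_real (R * u * t)) * cnj (fourier g (R * u)) \<partial>std_normal_distribution) \<partial>lborel)"
    by (rule Fubini_std_normal[OF g(1)]) (measurable, use fb in \<open>auto simp: norm_mult\<close>)
  also have "\<dots> = (\<integral>t. g t * (\<integral>v. (sqrt (2 * pi) / R) *\<^sub>R cnj (g (t - v / R)) \<partial>std_normal_distribution) \<partial>lborel)"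
  proof (rule Bochner_Integration.integral_cong, simp)
    fix t
    have "(\<integral>u. exp (\<i> * of_real (R * u * t)) * cnj (fourier g (R * u)) \<partial>std_normal_distribution) =
       (\<integral>u. (\<integral>t'. cnj (g t') * exp (\<i> * of_real (R * (t - t') * u)) \<partial>lborel) \<partial>std_normal_distribution)"
      unfolding cnj_fourier integral_mult_right_zero[symmetric]
      by (intro Bochner_Integration.integral_cong refl) (simp add: algebra_simps exp_diff exp_minus divide_inverse)
    also have "\<dots> = (\<integral>t'. cnj (g t') * (\<integral>u. exp (\<i> * of_real (R * (t - t') * u)) \<partial>std_normal_distribution) \<partial>lborel)"
    proof (rule Fubini_std_normal[OF gc, where B = 1])
      have "(\<lambda>p. exp (\<i> * of_real (R * (t - fst p) * snd p))) \<in> borel_measurable (borel \<Otimes>\<^sub>M borel)"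
        by measurable
      then show "(\<lambda>(t', u). exp (\<i> * of_real (R * (t - t') * u))) \<in> borel_measurable (borel \<Otimes>\<^sub>M borel)"
        by (simp add: case_prod_beta')
    qed (simp only: norm_exp_i_times_of_real)
    also have "\<dots> = (\<integral>t'. cnj (g t') * of_real (exp (- ((R * (t - t'))\<^sup>2) / 2)) \<partial>lborel)"
      unfolding integral_std_normal_exp ..
    \<comment> \<open>The substitution t' = t - v/R recovers the standard normal density, up to the
      factor sqrt (2 pi).\<close>
    also have "\<dots> = (1 / R) *\<^sub>R (\<integral>v. cnj (g (t - v / R)) * of_real (exp (- (v\<^sup>2) / 2)) \<partial>lborel)"
      using R by (subst lborel_integral_real_affine[where c = "- 1 / R" and t = t]) auto
    also have "\<dots> = (\<integral>v. (sqrt (2 * pi) / R) *\<^sub>R (std_normal_density v *\<^sub>R cnj (g (t - v / R))) \<partial>lborel)"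
      unfolding integral_scaleR_right[symmetric]
      by (intro Bochner_Integration.integral_cong refl)
        (simp add: std_normal_density_def scaleR_conv_of_real field_simps)
    also have "\<dots> = (\<integral>v. (sqrt (2 * pi) / R) *\<^sub>R cnj (g (t - v / R)) \<partial>std_normal_distribution)"
      by (subst integral_std_normal) (measurable, simp add: mult_ac scaleR_conv_of_real)
    finally show "g t * (\<integral>u. exp (\<i> * of_real (R * u * t)) * cnj (fourier g (R * u)) \<partial>std_normal_distribution) =
        g t * (\<integral>v. (sqrt (2 * pi) / R) *\<^sub>R cnj (g (t - v / R)) \<partial>std_normal_distribution)"
      by simp
  qed
  also have "\<dots> = (\<integral>t. of_real (sqrt (2 * pi) / R) * (\<integral>v. g t * cnj (g (t - v / R)) \<partial>std_normal_distribution) \<partial>lborel)"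
    by (intro Bochner_Integration.integral_cong refl) (simp add: scaleR_conv_of_real mult.left_commute)
  also have "\<dots> = of_real (sqrt (2 * pi) / R) * (\<integral>t. (\<integral>v. g t * cnj (g (t - v / R)) \<partial>std_normal_distribution) \<partial>lborel)"
    by (rule integral_mult_right_zero)
  also have "(\<integral>t. (\<integral>v. g t * cnj (g (t - v / R)) \<partial>std_normal_distribution) \<partial>lborel) =
      (\<integral>v. (\<integral>t. g t * cnj (g (t - v / R)) \<partial>lborel) \<partial>std_normal_distribution)"
  proof -
    interpret P: pair_sigma_finite lborel std_normal_distribution ..
    have m: "(\<lambda>(t, v). g t * cnj (g (t - v / R))) \<in> borel_measurable (lborel \<Otimes>\<^sub>M std_normal_distribution)"
      by (subst measurable_cong_sets[OF sets_pair_measure_cong[OF sets_lborel std_normal_measure(1)] refl]) measurable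
    have "(\<integral>\<^sup>+p. ennreal (norm (case p of (t, v) \<Rightarrow> g t * cnj (g (t - v / R)))) \<partial>(lborel \<Otimes>\<^sub>M std_normal_distribution)) =
      (\<integral>\<^sup>+v. (\<integral>\<^sup>+t. ennreal (norm (g t * cnj (g (t - v / R)))) \<partial>lborel) \<partial>std_normal_distribution)"
      using m by (subst P.nn_integral_snd[symmetric]) (auto intro!: nn_integral_cong)
    also have "\<dots> \<le> (\<integral>\<^sup>+v. ennreal (2 * L2_sq lborel g) \<partial>std_normal_distribution)"
    proof (rule nn_integral_mono)
      fix v
      \<comment> \<open>Bounding a product by the sum of the squares gives a bound independent of
        the shift, which a probability measure can integrate.\<close>
      have "(\<integral>\<^sup>+t. ennreal (norm (g t * cnj (g (t - v / R)))) \<partial>lborel) \<le>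
          (\<integral>\<^sup>+t. ennreal ((cmod (g t))\<^sup>2) + ennreal ((cmod (g (t - v / R)))\<^sup>2) \<partial>lborel)"
        using cmod_mult_le_sum_squares[of _ "cnj _"]
        by (intro nn_integral_mono) (simp flip: ennreal_plus)
      also have "\<dots> = ennreal (L2_sq lborel g) + ennreal (L2_sq lborel (\<lambda>t. g (t - v / R)))"
        using nn_integral_L2_sq[OF g(2)] nn_integral_L2_sq[OF L2_fun_translate(1)[OF g(2), of "v / R"]]
        by (subst nn_integral_add) auto
      finally show "(\<integral>\<^sup>+t. ennreal (norm (g t * cnj (g (t - v / R)))) \<partial>lborel) \<le> ennreal (2 * L2_sq lborel g)"
        unfolding L2_fun_translate(2)[OF g(2)] by (simp flip: ennreal_plus)
    qed
    also have "\<dots> < \<infinity>"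
      using N.emeasure_space_1 by simp
    finally have "integrable (lborel \<Otimes>\<^sub>M std_normal_distribution) (\<lambda>(t, v). g t * cnj (g (t - v / R)))"
      using m by (intro integrableI_bounded)
    from P.Fubini_integral[OF this] show ?thesis
      by simp
  qed
  finally show ?thesis .
qed

text \<open>Let the width of the Gaussian tend to infinity. On the frequency side the factor
  increases to 1 and monotone convergence applies without knowing integrability; on the other side
  the autocorrelation tends to its value at 0. Stated with \<open>nn_integral\<close>, so that
  square integrability of the transform is part of the result.\<close>

theorem Plancherel:
  assumes g: "integrable lborel g" "g \<in> L2_fun lborel"
  shows "(\<integral>\<^sup>+x. ennreal ((cmod (fourier g x))\<^sup>2) \<partial>lborel) = ennreal (2 * pi * L2_sq lborel g)"
proof (rule LIMSEQ_unique)
  interpret N: prob_space std_normal_distribution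
    by (rule prob_space_normal_density) simp
  have [measurable]: "g \<in> borel_measurable borel"
    using g by auto
  define R where "R n = real (Suc n)" for n
  have R: "R n > 0" for n
    by (simp add: R_def)
  define A where "A r = (\<integral>t. g t * cnj (g (t - r)) \<partial>lborel)" for r
  define E where "E n x = (cmod (fourier g x))\<^sup>2 * exp (- ((x / R n)\<^sup>2) / 2)" for n x
  have [measurable]: "E n \<in> borel_measurable borel" for n
    unfolding E_def by measurable
  have R_inf: "(\<lambda>n. x / R n) \<longlonglongrightarrow> 0" for x
    unfolding R_def using tendsto_mult_right_zero[OF LIMSEQ_inverse_real_of_nat, of x] by (simp add: divide_inverse)
  show "(\<lambda>n. \<integral>\<^sup>+x. ennreal (E n x) \<partial>lborel) \<longlonglongrightarrow> (\<integral>\<^sup>+x. ennreal ((cmod (fourier g x))\<^sup>2) \<partial>lborel)"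
  proof (rule nn_integral_LIMSEQ)
    show "incseq (\<lambda>n x. ennreal (E n x))"
    proof (rule incseq_SucI, rule le_funI)
      fix n x
      have "\<bar>x / R (Suc n)\<bar> \<le> \<bar>x / R n\<bar>"
        by (auto simp: R_def intro!: divide_left_mono)
      then have "(x / R (Suc n))\<^sup>2 \<le> (x / R n)\<^sup>2"
        by (simp only: abs_le_square_iff)
      then show "ennreal (E n x) \<le> ennreal (E (Suc n) x)"
        unfolding E_def by (intro ennreal_leI mult_left_mono) auto
    qed
    fix x
    have "(\<lambda>n. E n x) \<longlonglongrightarrow> (cmod (fourier g x))\<^sup>2 * exp (- (0\<^sup>2) / 2)"
      unfolding E_def by (intro tendsto_intros R_inf) auto
    then show "(\<lambda>n. ennreal (E n x)) \<longlonglongrightarrow> ennreal ((cmod (fourier g x))\<^sup>2)"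
      by (intro tendsto_ennrealI) simp
  qed auto
  \<comment> \<open>The substitution x = R u contributes \<open>R n\<close>, the density contributes
    sqrt (2 pi), and the average contributes sqrt (2 pi) / R n: together 2 pi.\<close>
  have *: "(\<integral>\<^sup>+x. ennreal (E n x) \<partial>lborel) = ennreal (2 * pi * Re (\<integral>v. A (v / R n) \<partial>std_normal_distribution))" for n
  proof -
    let ?F = "\<lambda>u. (cmod (fourier g (R n * u)))\<^sup>2"
    have Fm: "?F \<in> borel_measurable borel"
      by measurable
    have "?F u \<le> (\<integral>t. cmod (g t) \<partial>lborel)\<^sup>2" for u
      by (intro power_mono fourier_bound g) auto
    then have Fi: "integrable std_normal_distribution ?F"
      using Fm by (intro N.integrable_const_bound[of _ "(\<integral>t. cmod (g t) \<partial>lborel)\<^sup>2"]) auto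
    have "(\<integral>\<^sup>+x. ennreal (E n x) \<partial>lborel) = ennreal (R n) * (\<integral>\<^sup>+u. ennreal (E n (R n * u)) \<partial>lborel)"
      using nn_integral_real_affine[of "\<lambda>x. ennreal (E n x)" "R n" 0] R[of n] by simp
    also have "(\<integral>\<^sup>+u. ennreal (E n (R n * u)) \<partial>lborel) =
        (\<integral>\<^sup>+u. ennreal (sqrt (2 * pi)) * (ennreal (std_normal_density u) * ennreal (?F u)) \<partial>lborel)"
    proof (rule nn_integral_cong)
      fix u
      have "E n (R n * u) = sqrt (2 * pi) * (std_normal_density u * ?F u)"
        using R[of n] by (simp add: E_def std_normal_density_def field_simps)
      then show "ennreal (E n (R n * u)) = ennreal (sqrt (2 * pi)) * (ennreal (std_normal_density u) * ennreal (?F u))"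
        by (simp add: ennreal_mult)
    qed
    also have "\<dots> = ennreal (sqrt (2 * pi)) * (\<integral>\<^sup>+u. ennreal (?F u) \<partial>std_normal_distribution)"
      by (subst nn_integral_std_normal) (auto intro!: nn_integral_cmult)
    also have "(\<integral>\<^sup>+u. ennreal (?F u) \<partial>std_normal_distribution) = ennreal (\<integral>u. ?F u \<partial>std_normal_distribution)"
      by (rule nn_integral_eq_integral[OF Fi]) auto
    also have "(\<integral>u. ?F u \<partial>std_normal_distribution) = Re (\<integral>u. fourier g (R n * u) * cnj (fourier g (R n * u)) \<partial>std_normal_distribution)"
      unfolding complex_norm_square[symmetric] integral_complex_of_real Re_complex_of_real ..
    also have "\<dots> = sqrt (2 * pi) / R n * Re (\<integral>v. A (v / R n) \<partial>std_normal_distribution)"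
      unfolding fourier_gauss_average[OF g R] A_def by simp
    also have "ennreal (R n) * (ennreal (sqrt (2 * pi)) * ennreal (sqrt (2 * pi) / R n * Re (\<integral>v. A (v / R n) \<partial>std_normal_distribution))) =
        ennreal (R n * sqrt (2 * pi) * (sqrt (2 * pi) / R n * Re (\<integral>v. A (v / R n) \<partial>std_normal_distribution)))"
      using R[of n] by (simp only: mult.assoc ennreal_mult' less_imp_le real_sqrt_ge_zero pi_ge_zero mult_nonneg_nonneg zero_le_numeral)
    also have "R n * sqrt (2 * pi) * (sqrt (2 * pi) / R n * Re (\<integral>v. A (v / R n) \<partial>std_normal_distribution)) =
        2 * pi * Re (\<integral>v. A (v / R n) \<partial>std_normal_distribution)"
      using R[of n] by (simp add: field_simps)
    finally show ?thesis .
  qed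
  have "(\<lambda>n. \<integral>v. A (v / R n) \<partial>std_normal_distribution) \<longlonglongrightarrow> (\<integral>v. of_real (L2_sq lborel g) \<partial>std_normal_distribution)"
  proof (rule integral_dominated_convergence[where w = "\<lambda>_. L2_sq lborel g"])
    have Am: "A \<in> borel_measurable borel"
      unfolding A_def
    proof (rule sigma_finite_measure.borel_measurable_lebesgue_integral[OF sigma_finite_lborel])
      have "(\<lambda>x. cnj (g (snd x - fst x))) \<in> borel_measurable (borel \<Otimes>\<^sub>M borel)"
        by (rule borel_measurable_continuous_on[where f = cnj]) (intro continuous_intros, measurable)
      then show "(\<lambda>(r, t). g t * cnj (g (t - r))) \<in> borel_measurable (borel \<Otimes>\<^sub>M lborel)"
        unfolding case_prod_beta by measurable
    qed
    then show "(\<lambda>v. A (v / R n)) \<in> borel_measurable std_normal_distribution" for n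
      by simp
    show "AE v in std_normal_distribution. (\<lambda>n. A (v / R n)) \<longlonglongrightarrow> of_real (L2_sq lborel g)"
      unfolding A_def by (intro AE_I2 autocorrelation_tendsto[OF g(2)] R_inf)
    \<comment> \<open>Cauchy-Schwarz and translation invariance: a constant dominates, which
      suffices on a probability space.\<close>
    have "cmod (A r) \<le> L2_sq lborel g" for r
    proof -
      have "(cmod (A r))\<^sup>2 \<le> (L2_sq lborel g)\<^sup>2"
        using L2_Cauchy_Schwarz[OF g(2) L2_fun_translate(1)[OF g(2), of r]]
        unfolding L2_fun_translate(2)[OF g(2)] A_def by (simp add: power2_eq_square)
      then show ?thesis
        by (rule power2_le_imp_le) simp
    qed
    then show "AE v in std_normal_distribution. norm (A (v / R n)) \<le> L2_sq lborel g" for n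
      by simp
  qed auto
  then have "(\<lambda>n. Re (\<integral>v. A (v / R n) \<partial>std_normal_distribution)) \<longlonglongrightarrow> L2_sq lborel g"
    using tendsto_Re N.prob_space by fastforce
  then show "(\<lambda>n. \<integral>\<^sup>+x. ennreal (E n x) \<partial>lborel) \<longlonglongrightarrow> ennreal (2 * pi * L2_sq lborel g)"
    unfolding * by (intro tendsto_ennrealI tendsto_intros)
qed

subsection \<open>Laguerre polynomials\<close>

definition laguerre :: "nat \<Rightarrow> real \<Rightarrow> real" where
  "laguerre k x = (\<Sum>m\<le>k. real (k choose m) / fact m * (-1) ^ m * x ^ m)"

text \<open>Up to sign the left side is the \<open>l\<close>-th finite difference of
  \<open>c choose a\<close> in \<open>c\<close>. By Pascal's rule each difference lowers
  \<open>a\<close> by one, and more than \<open>a\<close> of them annihilate. \<open>c\<close> is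
  arbitrary because the induction step shifts it.\<close>

lemma alternating_binomial_sum:
  "(\<Sum>b\<le>l. (-1) ^ b * int (l choose b) * int ((c + b) choose a)) =
     (if l \<le> a then (-1) ^ l * int (c choose (a - l)) else 0)"
proof (induction l arbitrary: c)
  case (Suc l)
  define B where "B b = (-1) ^ b * int ((c + b) choose a)" for b
  have "(\<Sum>b\<le>Suc l. (-1) ^ b * int (Suc l choose b) * int ((c + b) choose a)) =
      (\<Sum>b\<le>Suc l. int (Suc l choose b) * B b)"
    by (simp add: B_def mult_ac)
  also have "\<dots> = B 0 + (\<Sum>b\<le>l. int (Suc l choose Suc b) * B (Suc b))"
    by (subst sum.atMost_Suc_shift) simp
  also have "\<dots> = (\<Sum>b\<le>l. int (l choose b) * B (Suc b)) + (B 0 + (\<Sum>b\<le>l. int (l choose Suc b) * B (Suc b)))"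
    by (simp add: sum.distrib algebra_simps)
  also have "B 0 + (\<Sum>b\<le>l. int (l choose Suc b) * B (Suc b)) = (\<Sum>b\<le>Suc l. int (l choose b) * B b)"
    by (subst sum.atMost_Suc_shift) simp
  also have "\<dots> = (\<Sum>b\<le>l. (-1) ^ b * int (l choose b) * int ((c + b) choose a))"
    by (simp add: B_def mult_ac)
  also have "(\<Sum>b\<le>l. int (l choose b) * B (Suc b)) =
      - (\<Sum>b\<le>l. (-1) ^ b * int (l choose b) * int ((Suc c + b) choose a))"
    by (simp add: B_def mult_ac flip: sum_negf)
  finally have "(\<Sum>b\<le>Suc l. (-1) ^ b * int (Suc l choose b) * int ((c + b) choose a)) =
      - (if l \<le> a then (-1) ^ l * int (Suc c choose (a - l)) else 0) + (if l \<le> a then (-1) ^ l * int (c choose (a - l)) else 0)"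
    unfolding Suc.IH .
  also have "\<dots> = (if Suc l \<le> a then (-1) ^ Suc l * int (c choose (a - Suc l)) else 0)"
  proof (cases "Suc l \<le> a")
    case True
    then have "a - l = Suc (a - Suc l)"
      by simp
    then show ?thesis
      using True by (simp add: algebra_simps)
  qed (cases "l = a"; simp)
  finally show ?case .
qed simp

lemma has_bochner_integral_power_exp:
  "has_bochner_integral lborel (\<lambda>x::real. x ^ m * exp (- x) * indicator {0..} x) (fact m)"
  by (rule has_bochner_integral_I0i_power_exp_m')

text \<open>Termwise integration yields (a + b)! / b! = a! (a + b choose a), hence the alternating
  sum with \<open>c = a\<close>. For \<open>a < l\<close> it vanishes: the Laguerre polynomial is
  orthogonal to all lower powers.\<close>

lemma has_bochner_integral_power_laguerre:
  "has_bochner_integral lborel (\<lambda>x. x ^ a * laguerre l x * exp (- x) * indicator {0..} x)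
     (if l \<le> a then fact a * (-1) ^ l * real (a choose (a - l)) else 0)"
proof -
  have "has_bochner_integral lborel
      (\<lambda>x. \<Sum>b\<le>l. (real (l choose b) / fact b * (-1) ^ b) * (x ^ (a + b) * exp (- x) * indicator {0..} x))
      (\<Sum>b\<le>l. (real (l choose b) / fact b * (-1) ^ b) * fact (a + b))"
    by (intro has_bochner_integral_sum has_bochner_integral_mult_right has_bochner_integral_power_exp)
  also have "(\<lambda>x. \<Sum>b\<le>l. (real (l choose b) / fact b * (-1) ^ b) * (x ^ (a + b) * exp (- x) * indicator {0..} x)) =
      (\<lambda>x. x ^ a * laguerre l x * exp (- x) * indicator {0..} x)"
    unfolding laguerre_def sum_distrib_left sum_distrib_right
    by (intro ext sum.cong refl) (simp add: power_add mult_ac)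
  also have "(\<Sum>b\<le>l. (real (l choose b) / fact b * (-1) ^ b) * fact (a + b)) =
      fact a * of_int (\<Sum>b\<le>l. (-1) ^ b * int (l choose b) * int ((a + b) choose a))"
    unfolding of_int_sum sum_distrib_left
    by (intro sum.cong refl) (simp add: binomial_fact mult_ac)
  also have "\<dots> = (if l \<le> a then fact a * (-1) ^ l * real (a choose (a - l)) else 0)"
    unfolding alternating_binomial_sum by simp
  finally show ?thesis .
qed

text \<open>By symmetry let \<open>k \<le> l\<close>; only the top power of
  \<open>laguerre k\<close> can survive, and only if \<open>k = l\<close>. Its coefficient (-1)^k /
  k! meets the integral k! (-1)^k, which gives 1.\<close>

lemma laguerre_orthonormal:
  "has_bochner_integral lborel (\<lambda>x. laguerre k x * laguerre l x * exp (- x) * indicator {0..} x)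
     (if k = l then 1 else 0)"
proof -
  have *: "has_bochner_integral lborel (\<lambda>x. laguerre k x * laguerre l x * exp (- x) * indicator {0..} x)
     (if k = l then 1 else 0)" if "k \<le> l" for k l
  proof -
    have "has_bochner_integral lborel
      (\<lambda>x. \<Sum>a\<le>k. (real (k choose a) / fact a * (-1) ^ a) * (x ^ a * laguerre l x * exp (- x) * indicator {0..} x))
      (\<Sum>a\<le>k. (real (k choose a) / fact a * (-1) ^ a) * (if l \<le> a then fact a * (-1) ^ l * real (a choose (a - l)) else 0))"
      by (intro has_bochner_integral_sum has_bochner_integral_mult_right has_bochner_integral_power_laguerre)
    also have "(\<lambda>x. \<Sum>a\<le>k. (real (k choose a) / fact a * (-1) ^ a) * (x ^ a * laguerre l x * exp (- x) * indicator {0..} x)) =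
        (\<lambda>x. laguerre k x * laguerre l x * exp (- x) * indicator {0..} x)"
      unfolding laguerre_def[of k] sum_distrib_left sum_distrib_right
      by (intro ext sum.cong refl) (simp add: mult_ac)
    also have "(\<Sum>a\<le>k. (real (k choose a) / fact a * (-1) ^ a) * (if l \<le> a then fact a * (-1) ^ l * real (a choose (a - l)) else 0)) =
        (\<Sum>a\<in>{k}. if k = l then 1 else 0 :: real)"
    proof (rule sum.mono_neutral_cong_right)
      show "\<forall>a\<in>{..k} - {k}. (real (k choose a) / fact a * (-1) ^ a) * (if l \<le> a then fact a * (-1) ^ l * real (a choose (a - l)) else 0) = 0"
        using that by auto
    qed (use that in \<open>auto simp: power_add[symmetric]\<close>)
    finally show ?thesis
      by (cases "k = l") simp_all
  qed
  show ?thesis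
  proof (cases "k \<le> l")
    case False
    then show ?thesis
      using *[of l k] by (auto simp: mult.commute[of "laguerre k x" for x] split: if_splits)
  qed (rule *)
qed

lemma laguerre_measurable [measurable]: "laguerre k \<in> borel_measurable borel"
  unfolding laguerre_def by measurable

text \<open>Parseval for a finite Laguerre sum after x = 2ts. The nonnegative integral is the form
  that Tonelli's theorem needs in the isometry.\<close>

lemma nn_integral_laguerre_sum:
  fixes c :: "nat \<Rightarrow> complex"
  assumes "t > 0"
  shows "(\<integral>\<^sup>+s. ennreal (2 * t * exp (- (2 * s * t)) * (cmod (\<Sum>k<n. c k * of_real (laguerre k (2 * s * t))))\<^sup>2)
      * indicator {0<..} s \<partial>lborel) = ennreal (\<Sum>k<n. (cmod (c k))\<^sup>2)"
proof -
  define q where "q x = (cmod (\<Sum>k<n. c k * of_real (laguerre k x)))\<^sup>2 * exp (- x) * indicator {0..} x" for x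
  have q_eq: "q = (\<lambda>x. \<Sum>k<n. \<Sum>l<n. Re (c k * cnj (c l)) * (laguerre k x * laguerre l x * exp (- x) * indicator {0..} x))"
  proof
    fix x
    let ?S = "\<Sum>k<n. c k * of_real (laguerre k x)"
    have "(cmod ?S)\<^sup>2 = Re (?S * cnj ?S)"
      by (simp only: complex_norm_square[symmetric] Re_complex_of_real)
    also have "\<dots> = (\<Sum>k<n. \<Sum>l<n. Re (c k * cnj (c l)) * (laguerre k x * laguerre l x))"
      unfolding cnj_sum sum_product Re_sum
      by (intro sum.cong refl) (simp add: algebra_simps)
    finally show "q x = (\<Sum>k<n. \<Sum>l<n. Re (c k * cnj (c l)) * (laguerre k x * laguerre l x * exp (- x) * indicator {0..} x))"
      unfolding q_def by (simp add: sum_distrib_left mult_ac)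
  qed
  have q_nonneg: "q x \<ge> 0" for x
    by (simp add: q_def)
  have "has_bochner_integral lborel q (\<Sum>k<n. \<Sum>l<n. Re (c k * cnj (c l)) * (if k = l then 1 else 0))"
    unfolding q_eq by (intro has_bochner_integral_sum has_bochner_integral_mult_right laguerre_orthonormal)
  also have "(\<Sum>k<n. \<Sum>l<n. Re (c k * cnj (c l)) * (if k = l then 1 else 0)) = (\<Sum>k<n. (cmod (c k))\<^sup>2)"
    by (simp add: if_distrib sum.delta' cmod_power2[unfolded power2_eq_square] power2_eq_square cong: if_cong)
  finally have hq: "has_bochner_integral lborel q (\<Sum>k<n. (cmod (c k))\<^sup>2)" .
  have qm [measurable]: "q \<in> borel_measurable borel"
    using hq by (auto simp: has_bochner_integral_iff)
  have "ennreal (\<Sum>k<n. (cmod (c k))\<^sup>2) = (\<integral>\<^sup>+x. ennreal (q x) \<partial>lborel)"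
    using hq q_nonneg nn_integral_eq_integral[of lborel q] by (simp add: has_bochner_integral_iff)
  also have "\<dots> = ennreal (2 * t) * (\<integral>\<^sup>+s. ennreal (q (2 * t * s)) \<partial>lborel)"
    using nn_integral_real_affine[of "\<lambda>x. ennreal (q x)" "2 * t" 0] assms by simp
  also have "\<dots> = (\<integral>\<^sup>+s. ennreal (2 * t * q (2 * t * s)) \<partial>lborel)"
    using assms q_nonneg by (simp add: ennreal_mult nn_integral_cmult)
  also have "\<dots> = (\<integral>\<^sup>+s. ennreal (2 * t * exp (- (2 * s * t)) * (cmod (\<Sum>k<n. c k * of_real (laguerre k (2 * s * t))))\<^sup>2)
      * indicator {0<..} s \<partial>lborel)"
  \<comment> \<open>The indicators of the closed and the open half line differ only at the null
    point s = 0.\<close>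
  proof (rule nn_integral_cong_AE)
    have "AE s in lborel. s \<noteq> (0::real)"
      by (rule AE_lborel_singleton)
    then show "AE s in lborel. ennreal (2 * t * q (2 * t * s)) =
        ennreal (2 * t * exp (- (2 * s * t)) * (cmod (\<Sum>k<n. c k * of_real (laguerre k (2 * s * t))))\<^sup>2) * indicator {0<..} s"
    proof eventually_elim
      case (elim s)
      then show ?case
        using assms by (cases "s > 0") (auto simp: q_def mult_ac zero_le_mult_iff)
    qed
  qed
  finally show ?thesis ..
qed

subsection \<open>The transform as a Laplace integral\<close>

lemma L2_pos_eq_L2_fun: "L2_pos = L2_fun (lebesgue_on {0<..})"
  by (simp add: L2_pos_def L2_fun_def)

lemma borel_measurable_lebesgue_on:
  "f \<in> borel_measurable borel \<Longrightarrow> f \<in> borel_measurable (lebesgue_on S)"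
  by (intro measurable_restrict_space1 measurable_completion) simp

lemma integrable_lebesgue_on_iff:
  fixes f :: "'a::euclidean_space \<Rightarrow> 'b::{banach, second_countable_topology}"
  assumes "f \<in> borel_measurable borel" "S \<in> sets borel"
  shows "integrable (lebesgue_on S) f \<longleftrightarrow> integrable lborel (\<lambda>x. indicator S x *\<^sub>R f x)"
  using assms by (subst integrable_restrict_space) (auto intro!: integrable_completion)

lemma integral_lebesgue_on_eq:
  fixes f :: "'a::euclidean_space \<Rightarrow> 'b::{banach, second_countable_topology}"
  assumes "f \<in> borel_measurable borel" "S \<in> sets borel"
  shows "integral\<^sup>L (lebesgue_on S) f = (\<integral>x. indicator S x *\<^sub>R f x \<partial>lborel)"
  using assms by (subst integral_restrict_space) (auto intro!: integral_completion)

lemma integrable_power_exp_pos: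
  assumes "c > 0"
  shows "integrable (lebesgue_on {0<..}) (\<lambda>t::real. t ^ k * exp (- (c * t)))"
proof -
  have "integrable lborel (\<lambda>x::real. x ^ k * exp (- x) * indicator {0<..} x)"
    using has_bochner_integral_I0i_power_exp_m[of k] by (simp add: has_bochner_integral_iff)
  from lborel_integrable_real_affine[OF this, of c 0]
  have "integrable lborel (\<lambda>t. (c * t) ^ k * exp (- (c * t)) * indicator {0<..} (c * t))"
    using assms by simp
  then have "integrable lborel (\<lambda>t. (1 / c ^ k) * ((c * t) ^ k * exp (- (c * t)) * indicator {0<..} (c * t)))"
    by (rule integrable_mult_right)
  also have "(\<lambda>t. (1 / c ^ k) * ((c * t) ^ k * exp (- (c * t)) * indicator {0<..} (c * t))) =
      (\<lambda>t. indicator {0<..} t *\<^sub>R (t ^ k * exp (- (c * t))))"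
    using assms by (auto simp: fun_eq_iff power_mult_distrib indicator_def zero_less_mult_iff)
  finally show ?thesis
    by (subst integrable_lebesgue_on_iff) auto
qed

text \<open>The \<open>m\<close>-th derivative in z of sqrt t exp(\<i>zt). It serves both as the
  kernel of the integrals and, with -cnj w in place of z, as a function to be transformed.\<close>

definition bergman_kernel :: "nat \<Rightarrow> complex \<Rightarrow> real \<Rightarrow> complex" where
  "bergman_kernel m z t = (\<i> * of_real t) ^ m * of_real (sqrt t) * exp (\<i> * z * of_real t)"

lemma bergman_kernel_measurable [measurable]: "bergman_kernel m z \<in> borel_measurable borel"
  unfolding bergman_kernel_def by measurable

lemma norm_bergman_kernel: "t > 0 \<Longrightarrow> cmod (bergman_kernel m z t) = t ^ m * sqrt t * exp (- (Im z * t))"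
  by (simp add: bergman_kernel_def norm_mult norm_power)

lemma bergman_kernel_L2:
  assumes "Im z > 0"
  shows "bergman_kernel m z \<in> L2_fun (lebesgue_on {0<..})"
proof -
  have "integrable (lebesgue_on {0<..}) (\<lambda>t. (cmod (bergman_kernel m z t))\<^sup>2)"
  proof (subst Bochner_Integration.integrable_cong[OF refl])
    show "integrable (lebesgue_on {0<..}) (\<lambda>t. t ^ (2 * m + 1) * exp (- (2 * Im z * t)))"
      using assms by (intro integrable_power_exp_pos) auto
    fix t :: real assume "t \<in> space (lebesgue_on {0<..})"
    then have "t > 0"
      by simp
    moreover have "(exp (- (Im z * t)))\<^sup>2 = exp (- (2 * Im z * t))"
      by (simp add: power2_eq_square flip: exp_add)
    ultimately show "(cmod (bergman_kernel m z t))\<^sup>2 = t ^ (2 * m + 1) * exp (- (2 * Im z * t))"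
      by (simp add: norm_bergman_kernel power_mult_distrib power_mult mult.commute[of 2 m] power_add)
  qed
  then show ?thesis
    by (simp add: L2_fun_def borel_measurable_lebesgue_on)
qed

definition laplace :: "nat \<Rightarrow> (real \<Rightarrow> complex) \<Rightarrow> complex \<Rightarrow> complex" where
  "laplace m f z = (\<integral>t. bergman_kernel m z t * f t \<partial>lebesgue_on {0<..})"

lemma integrable_laplace:
  "f \<in> L2_pos \<Longrightarrow> Im z > 0 \<Longrightarrow> integrable (lebesgue_on {0<..}) (\<lambda>t. bergman_kernel m z t * f t)"
  unfolding L2_pos_eq_L2_fun by (rule L2_fun_integrable_mult(1)[OF bergman_kernel_L2])

lemma Ber_eq_laplace: "Ber f z = laplace 0 f z"
  unfolding Ber_def laplace_def bergman_kernel_def by (simp add: mult_ac)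

lemma laplace_cong_AE:
  assumes "f \<in> L2_pos" "g \<in> L2_pos" "AE t in lebesgue_on {0<..}. f t = g t"
  shows "laplace m f z = laplace m g z"
  unfolding laplace_def
proof (rule integral_cong_AE)
  have [measurable]: "bergman_kernel m z \<in> borel_measurable (lebesgue_on {0<..})"
    by (rule borel_measurable_lebesgue_on) measurable
  have [measurable]: "f \<in> borel_measurable (lebesgue_on {0<..})" "g \<in> borel_measurable (lebesgue_on {0<..})"
    using assms by (auto simp: L2_pos_def)
  show "(\<lambda>t. bergman_kernel m z t * f t) \<in> borel_measurable (lebesgue_on {0<..})"
    "(\<lambda>t. bergman_kernel m z t * g t) \<in> borel_measurable (lebesgue_on {0<..})"
    by measurable
qed (use assms(3) in auto)

lemma laplace_linear:
  assumes "f \<in> L2_pos" "g \<in> L2_pos" "Im z > 0"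
  shows "laplace m (\<lambda>t. a * f t + b * g t) z = a * laplace m f z + b * laplace m g z"
proof -
  have "laplace m (\<lambda>t. a * f t + b * g t) z =
      (\<integral>t. a * (bergman_kernel m z t * f t) + b * (bergman_kernel m z t * g t) \<partial>lebesgue_on {0<..})"
    unfolding laplace_def by (simp add: algebra_simps)
  also have "\<dots> = a * laplace m f z + b * laplace m g z"
    using integrable_laplace[OF assms(1,3)] integrable_laplace[OF assms(2,3)]
    by (simp add: laplace_def)
  finally show ?thesis .
qed

text \<open>Differentiation under the integral by an explicit remainder bound: for |h| < s/2 the
  Taylor remainder of the exponential costs at most exp(st/2), which half of the decay exp(-st)
  absorbs.\<close>

lemma laplace_has_field_derivative:
  assumes f: "f \<in> L2_pos" and z: "Im z > 0"
  shows "(laplace m f has_field_derivative laplace (Suc m) f z) (at z)"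
proof -
  define s where "s = Im z"
  have "s > 0"
    using z by (simp add: s_def)
  \<comment> \<open>The dominating function is the kernel at half the height; its order is
    \<open>m + 2\<close> because the second-order remainder contributes t^2.\<close>
  define C where "C = (\<integral>t. cmod (bergman_kernel (m + 2) (\<i> * of_real (s / 2)) t * f t) \<partial>lebesgue_on {0<..})"
  have Ci: "integrable (lebesgue_on {0<..}) (\<lambda>t. bergman_kernel (m + 2) (\<i> * of_real (s / 2)) t * f t)"
    using \<open>s > 0\<close> by (intro integrable_laplace f) auto
  have bound: "cmod ((laplace m f (z + h) - laplace m f z) / h - laplace (Suc m) f z) \<le> C * cmod h"
    if h: "h \<noteq> 0" "cmod h < s / 2" for h
  proof -
    have "\<bar>Im h\<bar> \<le> cmod h"
      by (rule abs_Im_le_cmod)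
    then have "Im (z + h) > 0"
      using h(2) \<open>s > 0\<close> by (simp add: s_def)
    note i = integrable_laplace[OF f this, of m] integrable_laplace[OF f z, of m] integrable_laplace[OF f z, of "Suc m"]
    have "laplace m f (z + h) - laplace m f z - h * laplace (Suc m) f z =
       (\<integral>t. bergman_kernel m (z + h) t * f t - bergman_kernel m z t * f t
          - h * (bergman_kernel (Suc m) z t * f t) \<partial>lebesgue_on {0<..})"
      unfolding laplace_def using i by simp
    also have "cmod \<dots> \<le> (\<integral>t. (cmod h)\<^sup>2 * cmod (bergman_kernel (m + 2) (\<i> * of_real (s / 2)) t * f t) \<partial>lebesgue_on {0<..})"
    proof (rule order_trans[OF integral_norm_bound], rule integral_mono)
      show "integrable (lebesgue_on {0<..}) (\<lambda>t. cmod (bergman_kernel m (z + h) t * f t - bergman_kernel m z t * f t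
          - h * (bergman_kernel (Suc m) z t * f t)))"
        using i by (intro integrable_norm Bochner_Integration.integrable_diff integrable_mult_right)
      show "integrable (lebesgue_on {0<..}) (\<lambda>t. (cmod h)\<^sup>2 * cmod (bergman_kernel (m + 2) (\<i> * of_real (s / 2)) t * f t))"
        using Ci by (intro integrable_mult_right integrable_norm)
      fix t :: real assume "t \<in> space (lebesgue_on {0<..})"
      then have t: "t > 0"
        by simp
      define w where "w = \<i> * h * of_real t"
      have "cmod (exp w - (\<Sum>k\<le>1. w ^ k / fact k)) \<le> exp \<bar>Re w\<bar> * cmod w ^ Suc 1 / fact 1"
        by (rule Taylor_exp)
      then have "cmod (exp w - 1 - w) \<le> exp \<bar>Re w\<bar> * (cmod w)\<^sup>2"
        by (simp add: power2_eq_square diff_diff_eq)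
      also have "\<dots> \<le> exp (s / 2 * t) * ((cmod h)\<^sup>2 * t\<^sup>2)"
      proof (intro mult_mono)
        have "\<bar>Re w\<bar> = \<bar>Im h\<bar> * t"
          using t by (simp add: w_def abs_mult)
        also have "\<dots> \<le> s / 2 * t"
          using \<open>\<bar>Im h\<bar> \<le> cmod h\<close> h(2) t by (intro mult_right_mono) auto
        finally show "exp \<bar>Re w\<bar> \<le> exp (s / 2 * t)"
          by simp
        show "(cmod w)\<^sup>2 \<le> (cmod h)\<^sup>2 * t\<^sup>2"
          using t by (simp add: w_def norm_mult power_mult_distrib)
      qed auto
      finally have w: "cmod (exp w - 1 - w) \<le> exp (s / 2 * t) * ((cmod h)\<^sup>2 * t\<^sup>2)" .
      have "bergman_kernel m (z + h) t * f t - bergman_kernel m z t * f t - h * (bergman_kernel (Suc m) z t * f t) =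
          bergman_kernel m z t * f t * (exp w - 1 - w)"
        unfolding bergman_kernel_def w_def by (simp add: exp_add[symmetric] algebra_simps)
      then have "cmod (bergman_kernel m (z + h) t * f t - bergman_kernel m z t * f t - h * (bergman_kernel (Suc m) z t * f t))
          = cmod (bergman_kernel m z t) * cmod (f t) * cmod (exp w - 1 - w)"
        by (simp add: norm_mult)
      also have "\<dots> \<le> cmod (bergman_kernel m z t) * cmod (f t) * (exp (s / 2 * t) * ((cmod h)\<^sup>2 * t\<^sup>2))"
        by (intro mult_left_mono w) auto
      also have "\<dots> = (cmod h)\<^sup>2 * (t ^ (m + 2) * sqrt t * (exp (- (s * t)) * exp (s / 2 * t)) * cmod (f t))"
        using t by (simp add: norm_bergman_kernel s_def power_add power2_eq_square mult_ac)
      also have "exp (- (s * t)) * exp (s / 2 * t) = exp (- (s / 2 * t))"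
        unfolding exp_add[symmetric] by (rule arg_cong[of _ _ exp]) simp
      finally show "cmod (bergman_kernel m (z + h) t * f t - bergman_kernel m z t * f t - h * (bergman_kernel (Suc m) z t * f t))
          \<le> (cmod h)\<^sup>2 * cmod (bergman_kernel (m + 2) (\<i> * of_real (s / 2)) t * f t)"
        using t by (simp add: norm_mult norm_bergman_kernel)
    qed
    also have "\<dots> = (cmod h)\<^sup>2 * C"
      by (simp add: C_def)
    finally have *: "cmod (laplace m f (z + h) - laplace m f z - h * laplace (Suc m) f z) \<le> (cmod h)\<^sup>2 * C" .
    have "(laplace m f (z + h) - laplace m f z) / h - laplace (Suc m) f z =
        (laplace m f (z + h) - laplace m f z - h * laplace (Suc m) f z) / h"
      using h(1) by (simp add: field_simps)
    then show ?thesis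
      using * h(1) by (simp add: norm_divide divide_le_eq power2_eq_square mult_ac)
  qed
  have "((\<lambda>h. (laplace m f (z + h) - laplace m f z) / h - laplace (Suc m) f z) \<longlongrightarrow> 0) (at 0)"
  proof (rule Lim_null_comparison)
    show "\<forall>\<^sub>F h in at 0. cmod ((laplace m f (z + h) - laplace m f z) / h - laplace (Suc m) f z) \<le> C * cmod h"
      unfolding eventually_at using \<open>s > 0\<close> bound by (intro exI[of _ "s / 2"]) auto
    have "((\<lambda>h::complex. C * cmod h) \<longlongrightarrow> C * cmod 0) (at 0)"
      by (intro tendsto_intros)
    then show "((\<lambda>h::complex. C * cmod h) \<longlongrightarrow> 0) (at 0)"
      by simp
  qed
  then show ?thesis
    unfolding DERIV_def by (rule LIM_zero_cancel)
qed

lemma laplace_holomorphic: "f \<in> L2_pos \<Longrightarrow> laplace m f holomorphic_on \<bbbU>"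
  unfolding holomorphic_on_open[OF open_upper_half_plane]
  using laplace_has_field_derivative by (auto simp: upper_half_plane_def)

lemma higher_deriv_laplace:
  assumes "f \<in> L2_pos" "z \<in> \<bbbU>"
  shows "(deriv ^^ j) (laplace 0 f) z = laplace j f z"
  using assms(2)
proof (induction j arbitrary: z)
  case (Suc j)
  have "(deriv ^^ Suc j) (laplace 0 f) z = deriv ((deriv ^^ j) (laplace 0 f)) z"
    by simp
  also have "\<dots> = deriv (laplace j f) z"
  proof (rule deriv_cong_ev)
    have "\<forall>\<^sub>F w in nhds z. w \<in> \<bbbU>"
      using Suc.prems by (intro eventually_nhds_in_open) auto
    then show "\<forall>\<^sub>F w in nhds z. (deriv ^^ j) (laplace 0 f) w = laplace j f w"
      by eventually_elim (rule Suc.IH)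
  qed simp
  also have "\<dots> = laplace (Suc j) f z"
    using laplace_has_field_derivative[OF assms(1)] Suc.prems by (auto intro!: DERIV_imp_deriv simp: upper_half_plane_def)
  finally show ?case .
qed simp

text \<open>The normalised transform with all differentiations carried out. The \<open>k\<close>-th
  inner sum hides a Laguerre polynomial: (2\<i>s)^m times the factor (\<i>t)^m of the kernel is
  (-2st)^m.\<close>

definition bergman_transform :: "nat \<Rightarrow> (nat \<Rightarrow> real \<Rightarrow> complex) \<Rightarrow> complex \<Rightarrow> complex" where
  "bergman_transform n f z = (\<Sum>k<n. \<Sum>m\<le>k.
     of_real (real (k choose m) / fact m) * (2 * \<i>) ^ m / of_real (sqrt pi) * (of_real (Im z) ^ m * laplace m (f k) z))"

lemma prod_diff_eq_fact_div: "j \<le> k \<Longrightarrow> real (\<Prod>i<j. k - i) = fact k / fact (k - j)"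
proof (induction j)
  case (Suc j)
  then have "k - j = Suc (k - Suc j)"
    by simp
  with Suc show ?case
    by (simp add: field_simps)
qed simp

lemma poly_Ber_eq_bergman_transform:
  assumes f: "f \<in> L2_vec n" and z: "z \<in> \<bbbU>"
  shows "poly_Ber n (\<lambda>k t. Ber_normalization k * f k t) z = bergman_transform n f z"
  unfolding poly_Ber_def bergman_transform_def
proof (rule sum.cong)
  fix k assume "k \<in> {..<n}"
  then have fk: "f k \<in> L2_pos"
    using f by (simp add: L2_vec_def)
  let ?N = "Ber_normalization k"
  let ?g = "\<lambda>t. ?N * f k t"
  have g: "?g \<in> L2_pos"
    using fk unfolding L2_pos_eq_L2_fun by (rule L2_fun_cmult)
  have g_eq: "laplace m ?g z = ?N * laplace m (f k) z" for m
    using laplace_linear[OF fk fk, of z m ?N 0] z by (simp add: upper_half_plane_def)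
  have "(d_dz ^^ k) (\<lambda>w. of_real (Im w) ^ k * Ber ?g w) z =
    (\<Sum>j\<le>k. of_real (Im z) ^ (k - j) * (of_nat (k choose j) * of_nat (\<Prod>i<j. k - i) / (2 * \<i>) ^ j * (deriv ^^ (k - j)) (laplace 0 ?g) z))"
    unfolding Ber_eq_laplace[abs_def] by (rule d_dz_funpow_Im_power_mult[OF laplace_holomorphic[OF g] z])
  also have "\<dots> = (\<Sum>m\<le>k. of_real (Im z) ^ m * (of_nat (k choose m) * (fact k / fact m) / (2 * \<i>) ^ (k - m) * laplace m ?g z))"
  proof (rule sum.reindex_bij_witness[of _ "\<lambda>m. k - m" "\<lambda>j. k - j"])
    fix j assume j: "j \<in> {..k}"
    then have "of_nat (\<Prod>i<j. k - i) = (fact k / fact (k - j) :: complex)"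
      using arg_cong[OF prod_diff_eq_fact_div[of j k], of complex_of_real] by simp
    then show "of_real (Im z) ^ (k - j) * (of_nat (k choose (k - j)) * (fact k / fact (k - j)) / (2 * \<i>) ^ (k - (k - j)) * laplace (k - j) ?g z) =
        of_real (Im z) ^ (k - j) * (of_nat (k choose j) * of_nat (\<Prod>i<j. k - i) / (2 * \<i>) ^ j * (deriv ^^ (k - j)) (laplace 0 ?g) z)"
      using j by (simp add: higher_deriv_laplace[OF g z] binomial_symmetric[symmetric])
  qed auto
  finally have "Ber_k k ?g z = 1 / ((2 * \<i>) ^ k * fact k) *
      (\<Sum>m\<le>k. of_real (Im z) ^ m * (of_nat (k choose m) * (fact k / fact m) / (2 * \<i>) ^ (k - m) * laplace m ?g z))"
    unfolding Ber_k_def by simp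
  also have "\<dots> = (\<Sum>m\<le>k. of_real (real (k choose m) / fact m) * (2 * \<i>) ^ m / of_real (sqrt pi) * (of_real (Im z) ^ m * laplace m (f k) z))"
    unfolding sum_distrib_left
  proof (rule sum.cong)
    fix m assume "m \<in> {..k}"
    \<comment> \<open>The power (2\<i>)^(2k) of the normalisation splits in three: one part cancels
      1/(2\<i>)^k from \<open>Ber_k\<close>, one cancels 1/(2\<i>)^(k-m) from Leibniz' rule, and
      (2\<i>)^m remains.\<close>
    then have "2 * k = k + (k - m) + m"
      by auto
    then have pow: "a ^ (2 * k) = a ^ k * a ^ (k - m) * a ^ m" for a :: complex
      by (simp only: power_add)
    define a where "a = 2 * \<i>"
    have "a \<noteq> 0"
      by (simp add: a_def)
    then show "1 / ((2 * \<i>) ^ k * fact k) * (of_real (Im z) ^ m * (of_nat (k choose m) * (fact k / fact m) / (2 * \<i>) ^ (k - m) * laplace m ?g z)) =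
      of_real (real (k choose m) / fact m) * (2 * \<i>) ^ m / of_real (sqrt pi) * (of_real (Im z) ^ m * laplace m (f k) z)"
      unfolding g_eq unfolding Ber_normalization_def pow a_def[symmetric] by simp
  qed simp
  finally show "Ber_k k ?g z = \<dots>" .
qed simp

text \<open>Exchanging the two sums collects the powers of Im z, with coefficients holomorphic in z:
  the form that \<open>polyanalytic_sum\<close> accepts.\<close>

lemma bergman_transform_decomposition:
  "bergman_transform n f z = (\<Sum>m<n. of_real (Im z) ^ m * (\<Sum>k\<in>{m..<n}.
     of_real (real (k choose m) / fact m) * (2 * \<i>) ^ m / of_real (sqrt pi) * laplace m (f k) z))"
proof -
  define c where "c m k = of_real (real (k choose m) / fact m) * (2 * \<i>) ^ m / of_real (sqrt pi)" for m k
  have "bergman_transform n f z = (\<Sum>k<n. \<Sum>m\<in>{m. m < n \<and> m \<le> k}. c m k * (of_real (Im z) ^ m * laplace m (f k) z))"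
    unfolding bergman_transform_def c_def[symmetric] by (intro sum.cong refl) auto
  also have "\<dots> = (\<Sum>k\<in>{..<n}. \<Sum>m\<in>{m\<in>{..<n}. m \<le> k}. c m k * (of_real (Im z) ^ m * laplace m (f k) z))"
    by simp
  also have "\<dots> = (\<Sum>m\<in>{..<n}. \<Sum>k\<in>{k\<in>{..<n}. m \<le> k}. c m k * (of_real (Im z) ^ m * laplace m (f k) z))"
    by (rule sum.swap_restrict) auto
  also have "\<dots> = (\<Sum>m<n. of_real (Im z) ^ m * (\<Sum>k\<in>{m..<n}. c m k * laplace m (f k) z))"
    unfolding sum_distrib_left by (intro sum.cong refl) (auto simp: mult_ac)
  finally show ?thesis
    unfolding c_def .
qed

lemma bergman_transform_polyanalytic:
  assumes "f \<in> L2_vec n"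
  shows "C_class_on m \<bbbU> (bergman_transform n f)"
    and "z \<in> \<bbbU> \<Longrightarrow> (d_dzbar ^^ n) (bergman_transform n f) z = 0"
proof -
  define h where "h m z = (\<Sum>k\<in>{m..<n}. of_real (real (k choose m) / fact m) * (2 * \<i>) ^ m / of_real (sqrt pi) * laplace m (f k) z)" for m z
  have "h m holomorphic_on \<bbbU>" for m
    unfolding h_def using assms
    by (intro holomorphic_on_sum holomorphic_on_mult holomorphic_on_const laplace_holomorphic) (auto simp: L2_vec_def)
  moreover have eq: "bergman_transform n f = (\<lambda>z. \<Sum>m<n. of_real (Im z) ^ m * h m z)"
    unfolding bergman_transform_decomposition[abs_def] h_def ..
  ultimately show "C_class_on m \<bbbU> (bergman_transform n f)"
    "z \<in> \<bbbU> \<Longrightarrow> (d_dzbar ^^ n) (bergman_transform n f) z = 0"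
    using polyanalytic_sum[of n h] by simp_all
qed

lemma bergman_transform_linear:
  assumes "f \<in> L2_vec n" "g \<in> L2_vec n" "z \<in> \<bbbU>"
  shows "bergman_transform n (\<lambda>k t. a * f k t + b * g k t) z = a * bergman_transform n f z + b * bergman_transform n g z"
  unfolding bergman_transform_def sum_distrib_left sum.distrib[symmetric]
proof (intro sum.cong refl)
  fix k m assume "k \<in> {..<n}"
  then have "laplace m (\<lambda>t. a * f k t + b * g k t) z = a * laplace m (f k) z + b * laplace m (g k) z"
    using assms by (intro laplace_linear) (auto simp: L2_vec_def upper_half_plane_def)
  then show "of_real (real (k choose m) / fact m) * (2 * \<i>) ^ m / of_real (sqrt pi) * (of_real (Im z) ^ m * laplace m (\<lambda>t. a * f k t + b * g k t) z) =
     a * (of_real (real (k choose m) / fact m) * (2 * \<i>) ^ m / of_real (sqrt pi) * (of_real (Im z) ^ m * laplace m (f k) z)) +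
     b * (of_real (real (k choose m) / fact m) * (2 * \<i>) ^ m / of_real (sqrt pi) * (of_real (Im z) ^ m * laplace m (g k) z))"
    by (simp only: algebra_simps)
qed

lemma bergman_transform_cong_AE:
  assumes "f \<in> L2_vec n" "g \<in> L2_vec n" "L2_vec_eq n f g"
  shows "bergman_transform n f = bergman_transform n g"
  unfolding bergman_transform_def[abs_def] using assms
  by (intro ext sum.cong refl arg_cong2[of _ _ _ _ "(*)"] laplace_cong_AE) (auto simp: L2_vec_def L2_vec_eq_def)

lemma L2_vec_add: "f \<in> L2_vec n \<Longrightarrow> g \<in> L2_vec n \<Longrightarrow> (\<lambda>k t. f k t + c * g k t) \<in> L2_vec n"
  by (auto simp: L2_vec_def L2_pos_eq_L2_fun intro: L2_fun_add)

subsection \<open>Isometry\<close>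

lemma lborel_complex_eq_distr:
  "(lborel :: complex measure) = distr (lborel \<Otimes>\<^sub>M lborel) borel (\<lambda>(x, s). Complex x s)"
proof (rule lborel_eqI)
  have m: "(\<lambda>(x, s). Complex x s) \<in> (lborel \<Otimes>\<^sub>M lborel) \<rightarrow>\<^sub>M (borel :: complex measure)"
    unfolding lborel_prod case_prod_beta
    by (simp add: Complex_eq borel_measurable_continuous_onI continuous_intros)
  fix l u :: complex
  assume le: "\<And>b. b \<in> Basis \<Longrightarrow> l \<bullet> b \<le> u \<bullet> b"
  have "emeasure (distr (lborel \<Otimes>\<^sub>M lborel) borel (\<lambda>(x, s). Complex x s)) (box l u) =
      emeasure lborel ((\<lambda>(x, s). Complex x s) -` box l u \<inter> space (lborel \<Otimes>\<^sub>M lborel))"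
    using m by (subst emeasure_distr) (auto simp: lborel_prod)
  also have "(\<lambda>(x, s). Complex x s) -` box l u \<inter> space (lborel \<Otimes>\<^sub>M lborel) = box (Re l, Im l) (Re u, Im u)"
    by (auto simp: box_def space_pair_measure Basis_complex_def inner_complex_def Basis_prod_def)
  also have "emeasure lborel \<dots> = ennreal ((Re u - Re l) * (Im u - Im l))"
    using le[of 1] le[of \<i>]
    by (subst emeasure_lborel_box) (auto simp: Basis_prod_def Basis_complex_def inner_complex_def prod.union_disjoint mult.commute)
  also have "\<dots> = ennreal (\<Prod>b\<in>Basis. (u - l) \<bullet> b)"
    by (simp add: Basis_complex_def inner_complex_def)
  finally show "emeasure (distr (lborel \<Otimes>\<^sub>M lborel) borel (\<lambda>(x, s). Complex x s)) (box l u) = ennreal (\<Prod>b\<in>Basis. (u - l) \<bullet> b)" .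
qed simp

lemma nn_integral_complex:
  assumes [measurable]: "h \<in> borel_measurable borel"
  shows "(\<integral>\<^sup>+z. h z \<partial>(lborel :: complex measure)) = (\<integral>\<^sup>+s. (\<integral>\<^sup>+x. h (Complex x s) \<partial>lborel) \<partial>lborel)"
proof -
  have m [measurable]: "(\<lambda>(x, s). Complex x s) \<in> (lborel \<Otimes>\<^sub>M lborel) \<rightarrow>\<^sub>M (borel :: complex measure)"
    unfolding lborel_prod case_prod_beta
    by (simp add: Complex_eq borel_measurable_continuous_onI continuous_intros)
  have "(\<integral>\<^sup>+z. h z \<partial>(lborel :: complex measure)) = (\<integral>\<^sup>+p. h ((\<lambda>(x, s). Complex x s) p) \<partial>(lborel \<Otimes>\<^sub>M lborel))"
    by (subst lborel_complex_eq_distr) (rule nn_integral_distr[OF m], simp)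
  also have "\<dots> = (\<integral>\<^sup>+s. (\<integral>\<^sup>+x. h ((\<lambda>(x, s). Complex x s) (x, s)) \<partial>lborel) \<partial>lborel)"
    by (subst lborel_pair.nn_integral_snd[symmetric]) (auto intro!: measurable_compose[OF m assms])
  finally show ?thesis
    by simp
qed

text \<open>Members of \<open>L2_pos\<close> are only Lebesgue measurable, whereas Tonelli's theorem
  is applied on the product of Borel sigma-algebras.\<close>

lemma L2_pos_borel_representative:
  assumes "f \<in> L2_pos"
  obtains g where "g \<in> borel_measurable borel" "g \<in> L2_pos" "AE t in lebesgue_on {0<..}. f t = g t"
proof -
  have fm: "f \<in> borel_measurable (lebesgue_on {0<..})"
    using assms by (simp add: L2_pos_def)
  define F where "F t = (if t \<in> {0<..} then f t else 0)" for t
  have F: "F \<in> borel_measurable lebesgue"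
    unfolding F_def using fm by (subst borel_measurable_if) auto
  then have "(\<lambda>t. Re (F t)) \<in> borel_measurable lebesgue" "(\<lambda>t. Im (F t)) \<in> borel_measurable lebesgue"
    by (auto intro: borel_measurable_Re borel_measurable_Im)
  then obtain g1 g2 where g: "g1 \<in> borel_measurable borel" "g2 \<in> borel_measurable borel"
    and ae: "AE t in lborel. Re (F t) = g1 t" "AE t in lborel. Im (F t) = g2 t"
    using completion_ex_borel_measurable_real[of _ lborel] by (metis measurable_lborel2)
  define G where "G t = Complex (g1 t) (g2 t)" for t
  have Gm: "G \<in> borel_measurable borel"
    unfolding G_def Complex_eq using g by measurable
  have "AE t in lborel. F t = G t"
    using ae by eventually_elim (simp add: G_def complex_eq_iff)
  then have "AE t in lebesgue. F t = G t"
    by (rule AE_completion)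
  then have AE: "AE t in lebesgue_on {0<..}. f t = G t"
    by (subst AE_restrict_space_iff) (auto simp: F_def elim: eventually_mono)
  have "integrable (lebesgue_on {0<..}) (\<lambda>t. (cmod (G t))\<^sup>2)"
  proof (rule integrable_cong_AE[THEN iffD1])
    show "integrable (lebesgue_on {0<..}) (\<lambda>t. (cmod (f t))\<^sup>2)"
      using assms by (simp add: L2_pos_def)
    show "AE t in lebesgue_on {0<..}. (cmod (f t))\<^sup>2 = (cmod (G t))\<^sup>2"
      using AE by eventually_elim simp
  qed (use fm borel_measurable_lebesgue_on[OF Gm] in measurable)
  then have "G \<in> L2_pos"
    using borel_measurable_lebesgue_on[OF Gm] by (simp add: L2_pos_def)
  with Gm AE show thesis
    using that by blast
qed

text \<open>The function of t whose Fourier integral is the transform on the line Im z = s. The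
  indicator extends it to the whole real line.\<close>

definition fourier_density :: "nat \<Rightarrow> (nat \<Rightarrow> real \<Rightarrow> complex) \<Rightarrow> real \<Rightarrow> real \<Rightarrow> complex" where
  "fourier_density n f s t = of_real (indicator {0<..} t * sqrt t / sqrt pi * exp (- (s * t))) *
     (\<Sum>k<n. f k t * of_real (laguerre k (2 * s * t)))"

lemma fourier_density_measurable [measurable]:
  assumes [measurable]: "\<And>k. k < n \<Longrightarrow> f k \<in> borel_measurable borel"
  shows "(\<lambda>(s, t). fourier_density n f s t) \<in> borel_measurable (borel \<Otimes>\<^sub>M borel)"
proof -
  have [measurable]: "(\<lambda>p. f k (snd p)) \<in> borel_measurable (borel \<Otimes>\<^sub>M borel)" if "k \<in> {..<n}" for k
    using assms that by (auto intro: measurable_compose[OF measurable_snd])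
  show ?thesis
    unfolding fourier_density_def case_prod_beta by measurable
qed

lemma bergman_transform_eq_fourier:
  assumes f: "\<And>k. k < n \<Longrightarrow> f k \<in> L2_pos" and fm: "\<And>k. k < n \<Longrightarrow> f k \<in> borel_measurable borel" and s: "s > 0"
  shows "bergman_transform n f (Complex x s) = fourier (fourier_density n f s) x"
    and "integrable lborel (fourier_density n f s)"
proof -
  have dm: "fourier_density n f s \<in> borel_measurable borel"
    using measurable_Pair2[OF fourier_density_measurable[of n f], of s] fm by simp
  define q where "q z t = (\<Sum>k<n. \<Sum>m\<le>k.
     of_real (real (k choose m) / fact m) * (2 * \<i>) ^ m / of_real (sqrt pi) * (of_real (Im z) ^ m * (bergman_kernel m z t * f k t)))" for z t
  have qi: "integrable (lebesgue_on {0<..}) (q (Complex x s))" for x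
    unfolding q_def using s f
    by (intro Bochner_Integration.integrable_sum integrable_mult_right integrable_laplace) auto
  have q_eq: "q (Complex x s) t = fourier_density n f s t * exp (\<i> * of_real (x * t))" if "t > 0" for x t
  proof -
    have e: "exp (\<i> * Complex x s * of_real t) = of_real (exp (- (s * t))) * exp (\<i> * of_real (x * t))"
      unfolding exp_of_real[symmetric] exp_add[symmetric] by (rule arg_cong[of _ _ exp]) (simp add: complex_eq_iff)
    have "q (Complex x s) t = (\<Sum>k<n. f k t * (\<Sum>m\<le>k. of_real (real (k choose m) / fact m) * ((2 * \<i>) ^ m * of_real s ^ m * (\<i> * of_real t) ^ m))
       * of_real (sqrt t / sqrt pi) * exp (\<i> * Complex x s * of_real t))"
      unfolding q_def bergman_kernel_def sum_distrib_left sum_distrib_right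
      by (intro sum.cong refl) (simp add: field_simps)
    also have "\<dots> = (\<Sum>k<n. f k t * of_real (laguerre k (2 * s * t)) * of_real (sqrt t / sqrt pi) * exp (\<i> * Complex x s * of_real t))"
    proof -
      \<comment> \<open>The two imaginary units multiply to -1, which produces the alternating signs
        of the Laguerre polynomial.\<close>
      have "(2 * \<i>) ^ m * of_real s ^ m * (\<i> * of_real t) ^ m = (of_real ((-1) ^ m * (2 * s * t) ^ m) :: complex)" for m
      proof -
        have "(2 * \<i>) ^ m * of_real s ^ m * (\<i> * of_real t) ^ m = (2 * \<i> * of_real s * (\<i> * of_real t)) ^ m"
          by (simp only: power_mult_distrib)
        also have "2 * \<i> * of_real s * (\<i> * of_real t) = (of_real ((-1) * (2 * s * t)) :: complex)"
          by (simp add: complex_eq_iff)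
        finally show ?thesis
          by (simp only: of_real_power power_mult_distrib of_real_mult)
      qed
      then have "(\<Sum>m\<le>k. of_real (real (k choose m) / fact m) * ((2 * \<i>) ^ m * of_real s ^ m * (\<i> * of_real t) ^ m)) =
          (of_real (laguerre k (2 * s * t)) :: complex)" for k
        unfolding laguerre_def of_real_sum by (simp only: of_real_mult mult.assoc)
      then show ?thesis
        by simp
    qed
    also have "\<dots> = fourier_density n f s t * exp (\<i> * of_real (x * t))"
      unfolding e fourier_density_def sum_distrib_left sum_distrib_right using that
      by (intro sum.cong refl) (simp add: mult_ac)
    finally show ?thesis .
  qed
  have d0: "indicator {0<..} t *\<^sub>R (fourier_density n f s t * exp (\<i> * of_real (x * t))) = fourier_density n f s t * exp (\<i> * of_real (x * t))" for x t
    by (simp add: fourier_density_def indicator_def)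
  have dem: "(\<lambda>t. fourier_density n f s t * exp (\<i> * of_real (x * t))) \<in> borel_measurable borel" for x
    using dm by measurable
  have "integrable (lebesgue_on {0<..}) (\<lambda>t. fourier_density n f s t * exp (\<i> * of_real (0 * t)))"
    using qi[of 0] by (subst Bochner_Integration.integrable_cong[OF refl, of _ _ "q (Complex 0 s)"]) (auto simp: q_eq)
  then have "integrable (lebesgue_on {0<..}) (fourier_density n f s)"
    by simp
  then have "integrable lborel (\<lambda>t. indicator {0<..} t *\<^sub>R fourier_density n f s t)"
    using dm by (subst (asm) integrable_lebesgue_on_iff) auto
  then show "integrable lborel (fourier_density n f s)"
    using d0[of _ 0] by simp
  have "bergman_transform n f (Complex x s) = (\<integral>t. q (Complex x s) t \<partial>lebesgue_on {0<..})"
  proof -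
    have i: "integrable (lebesgue_on {0<..}) (\<lambda>t. bergman_kernel m (Complex x s) t * f k t)" if "k < n" for k m
      using s f that by (intro integrable_laplace) auto
    show ?thesis
      unfolding q_def bergman_transform_def laplace_def using i by (simp add: Bochner_Integration.integral_sum)
  qed
  also have "\<dots> = (\<integral>t. fourier_density n f s t * exp (\<i> * of_real (x * t)) \<partial>lebesgue_on {0<..})"
    by (intro Bochner_Integration.integral_cong refl) (auto simp: q_eq)
  also have "\<dots> = fourier (fourier_density n f s) x"
    unfolding fourier_def by (subst integral_lebesgue_on_eq[OF dem]) (simp, simp only: d0)
  finally show "bergman_transform n f (Complex x s) = fourier (fourier_density n f s) x" .
qed

lemma bergman_transform_continuous: "f \<in> L2_vec n \<Longrightarrow> continuous_on \<bbbU> (bergman_transform n f)"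
  using bergman_transform_polyanalytic(1)[of f n 0] by simp

lemma upper_half_plane_sets [simp, measurable]: "\<bbbU> \<in> sets borel" "\<bbbU> \<in> sets lebesgue"
proof -
  show "\<bbbU> \<in> sets borel"
    by (rule borel_open) simp
  then show "\<bbbU> \<in> sets lebesgue"
    by (simp add: sets_completionI_sets)
qed

text \<open>All integrals are computed as elements of [0, \<infinity>], so membership in L2 and the
  value of the norm come out of the same calculation.\<close>

theorem bergman_transform_isometry:
  assumes f: "f \<in> L2_vec n"
  shows "bergman_transform n f \<in> L2_fun (lebesgue_on \<bbbU>)"
    and "L2_sq (lebesgue_on \<bbbU>) (bergman_transform n f) = (\<Sum>k<n. L2_sq (lebesgue_on {0<..}) (f k))"
proof -
  have "\<exists>g. g \<in> borel_measurable borel \<and> g \<in> L2_pos \<and> (AE t in lebesgue_on {0<..}. f k t = g t)" if "k < n" for k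
  proof -
    have "f k \<in> L2_pos"
      using f that by (simp add: L2_vec_def)
    from L2_pos_borel_representative[OF this] show ?thesis
      by blast
  qed
  then obtain g where g: "\<And>k. k < n \<Longrightarrow> g k \<in> borel_measurable borel" "\<And>k. k < n \<Longrightarrow> g k \<in> L2_pos"
    "\<And>k. k < n \<Longrightarrow> AE t in lebesgue_on {0<..}. f k t = g k t"
    by metis
  have gL: "g \<in> L2_vec n"
    using g by (simp add: L2_vec_def)
  have Tfg: "bergman_transform n f = bergman_transform n g"
    by (rule bergman_transform_cong_AE[OF f gL]) (use g in \<open>simp add: L2_vec_eq_def\<close>)
  have sq_eq: "L2_sq (lebesgue_on {0<..}) (f k) = L2_sq (lebesgue_on {0<..}) (g k)" if "k < n" for k
    unfolding L2_sq_def
  proof (rule integral_cong_AE)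
    show "AE t in lebesgue_on {0<..}. (cmod (f k t))\<^sup>2 = (cmod (g k t))\<^sup>2"
      using g(3)[OF that] by eventually_elim simp
    show "(\<lambda>t. (cmod (f k t))\<^sup>2) \<in> borel_measurable (lebesgue_on {0<..})" "(\<lambda>t. (cmod (g k t))\<^sup>2) \<in> borel_measurable (lebesgue_on {0<..})"
      using f g(2)[OF that] that by (auto simp: L2_vec_def L2_pos_def)
  qed
  define T where "T = bergman_transform n g"
  have Tcont: "continuous_on \<bbbU> T"
    unfolding T_def by (rule bergman_transform_continuous[OF gL])
  then have Tm: "T \<in> borel_measurable (lebesgue_on \<bbbU>)"
    by (rule continuous_imp_measurable_on_sets_lebesgue) simp
  define E where "E z = ennreal ((cmod (indicator \<bbbU> z *\<^sub>R T z))\<^sup>2)" for z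
  have "(\<lambda>z. indicator \<bbbU> z *\<^sub>R T z) \<in> borel_measurable borel"
    by (rule borel_measurable_continuous_on_indicator[OF _ Tcont]) simp
  then have Em [measurable]: "E \<in> borel_measurable borel"
    unfolding E_def by measurable
  define d where "d s t = indicator {0<..} s * ennreal ((cmod (fourier_density n g s t))\<^sup>2)" for s t
  have dm [measurable]: "(\<lambda>(s, t). d s t) \<in> borel_measurable (borel \<Otimes>\<^sub>M borel)"
  proof -
    have "(\<lambda>p. fourier_density n g (fst p) (snd p)) \<in> borel_measurable (borel \<Otimes>\<^sub>M borel)"
      using fourier_density_measurable[of n g] g(1) by (simp add: case_prod_beta')
    then show ?thesis
      unfolding d_def case_prod_beta by measurable
  qed
  have dm1 [measurable]: "d s \<in> borel_measurable borel" for s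
    using measurable_Pair2[OF dm, of s] by simp
  have gk [measurable]: "g k \<in> borel_measurable borel" if "k \<in> {..<n}" for k
    using g that by simp
  \<comment> \<open>Tonelli: for fixed t the integral over s is the Laguerre integral. The factor
    1/(2 pi) arises by writing t/pi as (1/(2 pi)) (2t).\<close>
  have "(\<integral>\<^sup>+s. (\<integral>\<^sup>+t. d s t \<partial>lborel) \<partial>lborel) = (\<integral>\<^sup>+t. (\<integral>\<^sup>+s. d s t \<partial>lborel) \<partial>lborel)"
    using lborel_pair.Fubini'[of d] dm by simp
  also have "\<dots> = (\<integral>\<^sup>+t. ennreal (1 / (2 * pi)) * (\<Sum>k<n. ennreal ((cmod (g k t))\<^sup>2) * indicator {0<..} t) \<partial>lborel)"
  proof (rule nn_integral_cong)
    fix t :: real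
    show "(\<integral>\<^sup>+s. d s t \<partial>lborel) = ennreal (1 / (2 * pi)) * (\<Sum>k<n. ennreal ((cmod (g k t))\<^sup>2) * indicator {0<..} t)"
    proof (cases "t > 0")
      case True
      have "d s t = ennreal (1 / (2 * pi)) * (ennreal (2 * t * exp (- (2 * s * t)) * (cmod (\<Sum>k<n. g k t * of_real (laguerre k (2 * s * t))))\<^sup>2)
      * indicator {0<..} s)" for s
      proof -
        have "(exp (- (s * t)))\<^sup>2 = exp (- (2 * s * t))"
          by (simp add: power2_eq_square flip: exp_add)
        then have "(cmod (fourier_density n g s t))\<^sup>2 =
          1 / (2 * pi) * (2 * t * exp (- (2 * s * t)) * (cmod (\<Sum>k<n. g k t * of_real (laguerre k (2 * s * t))))\<^sup>2)"
          unfolding fourier_density_def norm_mult power_mult_distrib norm_of_real power2_abs power_divide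
          using True by simp
        then show ?thesis
          unfolding d_def using True by (simp add: ennreal_mult[symmetric] indicator_def)
      qed
      moreover have "(\<lambda>s. ennreal (2 * t * exp (- (2 * s * t)) * (cmod (\<Sum>k<n. g k t * of_real (laguerre k (2 * s * t))))\<^sup>2)
         * indicator {0<..} s) \<in> borel_measurable lborel"
        by measurable
      ultimately show ?thesis
        using True by (simp add: nn_integral_cmult nn_integral_laguerre_sum sum_ennreal)
    qed (simp add: d_def fourier_density_def)
  qed
  also have "\<dots> = ennreal (1 / (2 * pi)) * (\<Sum>k<n. \<integral>\<^sup>+t. ennreal ((cmod (g k t))\<^sup>2) * indicator {0<..} t \<partial>lborel)"
  proof -
    have m: "(\<lambda>t. ennreal ((cmod (g k t))\<^sup>2) * indicator {0<..} t) \<in> borel_measurable lborel" if "k \<in> {..<n}" for k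
      using gk[OF that] by measurable
    show ?thesis
      by (simp only: nn_integral_cmult[OF borel_measurable_sum[OF m]] nn_integral_sum[OF m])
  qed
  also have "(\<Sum>k<n. \<integral>\<^sup>+t. ennreal ((cmod (g k t))\<^sup>2) * indicator {0<..} t \<partial>lborel) = (\<Sum>k<n. ennreal (L2_sq (lebesgue_on {0<..}) (g k)))"
  proof (rule sum.cong)
    fix k assume "k \<in> {..<n}"
    then have "g k \<in> L2_fun (lebesgue_on {0<..})"
      using g(2) by (simp add: L2_pos_eq_L2_fun)
    from nn_integral_L2_sq[OF this]
    show "(\<integral>\<^sup>+t. ennreal ((cmod (g k t))\<^sup>2) * indicator {0<..} t \<partial>lborel) = ennreal (L2_sq (lebesgue_on {0<..}) (g k))"
      by (simp add: nn_integral_restrict_space nn_integral_completion)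
  qed simp
  also have "\<dots> = ennreal (\<Sum>k<n. L2_sq (lebesgue_on {0<..}) (f k))"
    by (simp add: sum_ennreal sq_eq)
  finally have dd: "(\<integral>\<^sup>+s. (\<integral>\<^sup>+t. d s t \<partial>lborel) \<partial>lborel) = ennreal (1 / (2 * pi)) * ennreal (\<Sum>k<n. L2_sq (lebesgue_on {0<..}) (f k))" .
  \<comment> \<open>Plancherel needs a square-integrable density on the line; finiteness of the
    double integral provides this for almost every height s.\<close>
  have fin: "AE s in lborel. (\<integral>\<^sup>+t. d s t \<partial>lborel) \<noteq> \<infinity>"
  proof (rule nn_integral_PInf_AE)
    show "(\<lambda>s. \<integral>\<^sup>+t. d s t \<partial>lborel) \<in> borel_measurable lborel"
      using lborel.borel_measurable_nn_integral[of "\<lambda>s t. d s t" borel] dm by simp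
    show "(\<integral>\<^sup>+s. (\<integral>\<^sup>+t. d s t \<partial>lborel) \<partial>lborel) \<noteq> \<infinity>"
      unfolding dd by (simp add: ennreal_mult_eq_top_iff)
  qed
  have "(\<integral>\<^sup>+z. E z \<partial>lborel) = (\<integral>\<^sup>+s. (\<integral>\<^sup>+x. E (Complex x s) \<partial>lborel) \<partial>lborel)"
    by (rule nn_integral_complex) measurable
  also have "\<dots> = (\<integral>\<^sup>+s. ennreal (2 * pi) * (\<integral>\<^sup>+t. d s t \<partial>lborel) \<partial>lborel)"
  proof (rule nn_integral_cong_AE)
    show "AE s in lborel. (\<integral>\<^sup>+x. E (Complex x s) \<partial>lborel) = ennreal (2 * pi) * (\<integral>\<^sup>+t. d s t \<partial>lborel)"
      using fin
    proof eventually_elim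
      case (elim s)
      show ?case
      proof (cases "s > 0")
        case True
        note fou = bergman_transform_eq_fourier[of n g s, OF g(2,1) True]
        have d_eq: "d s t = ennreal ((cmod (fourier_density n g s t))\<^sup>2)" for t
          using True by (simp add: d_def)
        have L: "fourier_density n g s \<in> L2_fun lborel"
          unfolding L2_fun_iff_nn_integral using elim fou(2) by (auto simp: d_eq less_top)
        have "(\<integral>\<^sup>+x. E (Complex x s) \<partial>lborel) = (\<integral>\<^sup>+x. ennreal ((cmod (fourier (fourier_density n g s) x))\<^sup>2) \<partial>lborel)"
          using True by (intro nn_integral_cong) (simp add: E_def T_def fou(1) upper_half_plane_def)
        also have "\<dots> = ennreal (2 * pi * L2_sq lborel (fourier_density n g s))"
          by (rule Plancherel[OF fou(2) L])
        also have "\<dots> = ennreal (2 * pi) * (\<integral>\<^sup>+t. d s t \<partial>lborel)"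
          unfolding d_eq nn_integral_L2_sq[OF L] by (simp add: ennreal_mult)
        finally show ?thesis .
      next
        case False
        then show ?thesis
          by (simp add: E_def d_def upper_half_plane_def)
      qed
    qed
  qed
  also have "\<dots> = ennreal (2 * pi) * (\<integral>\<^sup>+s. (\<integral>\<^sup>+t. d s t \<partial>lborel) \<partial>lborel)"
    using lborel.borel_measurable_nn_integral[of "\<lambda>s t. d s t" borel] dm by (intro nn_integral_cmult) simp
  also have "\<dots> = ennreal (\<Sum>k<n. L2_sq (lebesgue_on {0<..}) (f k))"
    unfolding dd mult.assoc[symmetric] by (simp flip: ennreal_mult)
  finally have "(\<integral>\<^sup>+z. E z \<partial>lborel) = ennreal (\<Sum>k<n. L2_sq (lebesgue_on {0<..}) (f k))" .
  moreover have "(\<integral>\<^sup>+z. ennreal ((cmod (T z))\<^sup>2) \<partial>lebesgue_on \<bbbU>) = (\<integral>\<^sup>+z. E z \<partial>lborel)"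
    by (subst nn_integral_restrict_space)
       (auto simp: nn_integral_completion E_def indicator_def intro!: nn_integral_cong)
  ultimately have nn: "(\<integral>\<^sup>+z. ennreal ((cmod (T z))\<^sup>2) \<partial>lebesgue_on \<bbbU>) = ennreal (\<Sum>k<n. L2_sq (lebesgue_on {0<..}) (f k))"
    by simp
  show TL: "bergman_transform n f \<in> L2_fun (lebesgue_on \<bbbU>)"
    unfolding Tfg T_def[symmetric] L2_fun_iff_nn_integral nn using Tm by simp
  show "L2_sq (lebesgue_on \<bbbU>) (bergman_transform n f) = (\<Sum>k<n. L2_sq (lebesgue_on {0<..}) (f k))"
    using nn_integral_L2_sq[OF TL] nn unfolding Tfg T_def[symmetric] by (simp add: sum_nonneg)
qed

text \<open>Polarisation: comparing the norms of f + c g and of its transform for c = 1 and c = \<i>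
  gives the real and the imaginary part.\<close>

theorem bergman_transform_inner:
  assumes f: "f \<in> L2_vec n" and g: "g \<in> L2_vec n"
  shows "Bergman_inner (bergman_transform n f) (bergman_transform n g) = L2_vec_inner n f g"
proof -
  let ?U = "lebesgue_on \<bbbU>" and ?P = "lebesgue_on {0::real<..}"
  let ?T = "bergman_transform n"
  define I where "I = Bergman_inner (?T f) (?T g)"
  define J where "J = L2_vec_inner n f g"
  have fk: "f k \<in> L2_fun ?P" "g k \<in> L2_fun ?P" if "k < n" for k
    using f g that by (auto simp: L2_vec_def L2_pos_eq_L2_fun)
  have key: "Re (cnj c * I) = Re (cnj c * J)" for c
  proof -
    have h: "(\<lambda>k t. f k t + c * g k t) \<in> L2_vec n"
      by (rule L2_vec_add[OF f g])
    have "L2_sq ?U (\<lambda>z. ?T f z + c * ?T g z) = L2_sq ?U (?T (\<lambda>k t. f k t + c * g k t))"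
      unfolding L2_sq_def using bergman_transform_linear[OF f g, of _ 1 c]
      by (intro Bochner_Integration.integral_cong) auto
    also have "\<dots> = (\<Sum>k<n. L2_sq ?P (\<lambda>t. f k t + c * g k t))"
      by (rule bergman_transform_isometry(2)[OF h])
    also have "\<dots> = (\<Sum>k<n. L2_sq ?P (f k) + (cmod c)\<^sup>2 * L2_sq ?P (g k) + 2 * Re (cnj c * L2_pos_inner (f k) (g k)))"
      unfolding L2_pos_inner_def by (intro sum.cong refl L2_sq_add fk) auto
    also have "\<dots> = (\<Sum>k<n. L2_sq ?P (f k)) + (cmod c)\<^sup>2 * (\<Sum>k<n. L2_sq ?P (g k)) + 2 * Re (cnj c * J)"
      unfolding J_def L2_vec_inner_def by (simp only: sum.distrib sum_distrib_left Re_sum)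
    finally show ?thesis
      unfolding L2_sq_add[OF bergman_transform_isometry(1)[OF f] bergman_transform_isometry(1)[OF g]]
        bergman_transform_isometry(2)[OF f] bergman_transform_isometry(2)[OF g] I_def Bergman_inner_def by simp
  qed
  have "I = J"
    using key[of 1] key[of \<i>] by (simp add: complex_eq_iff)
  then show ?thesis
    by (simp add: I_def J_def)
qed

subsection \<open>Change of variables for holomorphic maps\<close>

text \<open>\<open>has_absolute_integral_change_of_variables\<close> speaks about
  \<open>real ^ 'n\<close>; this map and its inverse carry the plane there and back, preserving
  Lebesgue measure.\<close>

definition vec_of_complex :: "complex \<Rightarrow> real ^ 2" where
  "vec_of_complex z = vector [Re z, Im z]"

definition complex_of_vec :: "real ^ 2 \<Rightarrow> complex" where
  "complex_of_vec v = Complex (v $ 1) (v $ 2)"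

lemma vec_of_complex_nth [simp]: "vec_of_complex z $ 1 = Re z" "vec_of_complex z $ 2 = Im z"
  by (simp_all add: vec_of_complex_def)

lemma vec_of_complex_inverse [simp]: "complex_of_vec (vec_of_complex z) = z"
  by (simp add: complex_of_vec_def)

lemma complex_of_vec_inverse [simp]: "vec_of_complex (complex_of_vec v) = v"
  by (simp add: vec_eq_iff forall_2 complex_of_vec_def)

lemma bounded_linear_complex_of_vec: "bounded_linear complex_of_vec"
  by (rule linear_conv_bounded_linear[THEN iffD1])
     (auto simp: complex_of_vec_def complex_eq_iff intro!: linearI)

lemma bounded_linear_vec_of_complex: "bounded_linear vec_of_complex"
  by (rule linear_conv_bounded_linear[THEN iffD1])
     (auto simp: vec_eq_iff forall_2 intro!: linearI)

lemma borel_measurable_complex_of_vec [measurable]: "complex_of_vec \<in> borel_measurable borel"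
  by (intro borel_measurable_continuous_onI linear_continuous_on bounded_linear_complex_of_vec)

lemma borel_measurable_vec_of_complex [measurable]: "vec_of_complex \<in> borel_measurable borel"
  by (intro borel_measurable_continuous_onI linear_continuous_on bounded_linear_vec_of_complex)

lemma distr_complex_of_vec: "distr lborel borel complex_of_vec = lborel"
proof (rule lborel_eqI[symmetric])
  fix l u :: complex
  assume le: "\<And>b. b \<in> Basis \<Longrightarrow> l \<bullet> b \<le> u \<bullet> b"
  have B: "(Basis :: (real ^ 2) set) = {axis 1 1, axis 2 1}"
    by (auto simp: Basis_vec_def UNIV_2)
  have ne: "axis 1 1 \<noteq> (axis 2 1 :: real ^ 2)"
    by (simp add: axis_eq_axis)
  have "emeasure (distr lborel borel complex_of_vec) (box l u) = emeasure lborel (complex_of_vec -` box l u)"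
    by (subst emeasure_distr) auto
  also have "complex_of_vec -` box l u = box (vec_of_complex l) (vec_of_complex u)"
    by (auto simp: box_def B Basis_complex_def inner_complex_def inner_axis complex_of_vec_def)
  also have "emeasure lborel \<dots> = ennreal (\<Prod>b\<in>Basis. (u - l) \<bullet> b)"
    using le[of 1] le[of \<i>] ne
    by (subst emeasure_lborel_box) (auto simp: B Basis_complex_def inner_complex_def inner_axis)
  finally show "emeasure (distr lborel borel complex_of_vec) (box l u) = ennreal (\<Prod>b\<in>Basis. (u - l) \<bullet> b)" .
qed simp

lemma lborel_complex_of_vec:
  fixes h :: "complex \<Rightarrow> 'b::{banach, second_countable_topology}"
  assumes [measurable]: "h \<in> borel_measurable borel"
  shows "integrable lborel (\<lambda>v. h (complex_of_vec v)) \<longleftrightarrow> integrable lborel h"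
    and "(\<integral>v. h (complex_of_vec v) \<partial>lborel) = (\<integral>z. h z \<partial>lborel)"
proof -
  have "integrable (distr lborel borel complex_of_vec) h \<longleftrightarrow> integrable lborel (\<lambda>v. h (complex_of_vec v))"
    by (rule integrable_distr_eq) auto
  then show "integrable lborel (\<lambda>v. h (complex_of_vec v)) \<longleftrightarrow> integrable lborel h"
    by (simp add: distr_complex_of_vec)
  have "(\<integral>z. h z \<partial>distr lborel borel complex_of_vec) = (\<integral>v. h (complex_of_vec v) \<partial>lborel)"
    by (rule integral_distr) auto
  then show "(\<integral>v. h (complex_of_vec v) \<partial>lborel) = (\<integral>z. h z \<partial>lborel)"
    by (simp add: distr_complex_of_vec)
qed

text \<open>Multiplication by a complex number is a rotation combined with a dilation by its
  modulus.\<close>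

lemma det_matrix_complex_mult:
  "det (matrix (\<lambda>v. vec_of_complex (d * complex_of_vec v))) = (cmod d)\<^sup>2"
proof -
  have "complex_of_vec (axis 1 1) = 1" "complex_of_vec (axis 2 1) = \<i>"
    by (auto simp: complex_of_vec_def complex_eq_iff axis_def)
  then show ?thesis
    by (simp add: det_2 matrix_def cmod_power2[unfolded power2_eq_square] power2_eq_square)
qed

text \<open>Passes between the integral of the change-of-variables theorem and the Bochner integral
  over \<open>lborel\<close>; for Borel integrands the completion changes nothing.\<close>

lemma set_integrable_lebesgue_iff_lborel:
  fixes h :: "'a::euclidean_space \<Rightarrow> 'b::euclidean_space"
  assumes "(\<lambda>x. indicator S x *\<^sub>R h x) \<in> borel_measurable borel"
  shows "h absolutely_integrable_on S \<longleftrightarrow> integrable lborel (\<lambda>x. indicator S x *\<^sub>R h x)"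
    and "h absolutely_integrable_on S \<Longrightarrow> integral S h = (\<integral>x. indicator S x *\<^sub>R h x \<partial>lborel)"
proof -
  show "h absolutely_integrable_on S \<longleftrightarrow> integrable lborel (\<lambda>x. indicator S x *\<^sub>R h x)"
    unfolding set_integrable_def using assms by (intro integrable_completion) simp
  assume "h absolutely_integrable_on S"
  then have "integral S h = (\<integral>x. indicator S x *\<^sub>R h x \<partial>lebesgue)"
    using set_lebesgue_integral_eq_integral(2)[of S h] by (simp add: set_lebesgue_integral_def)
  also have "\<dots> = (\<integral>x. indicator S x *\<^sub>R h x \<partial>lborel)"
    using assms by (intro integral_completion) simp
  finally show "integral S h = (\<integral>x. indicator S x *\<^sub>R h x \<partial>lborel)" .
qed

text \<open>The real Jacobian determinant of a holomorphic map is |\<phi>'|^2. Continuity of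
  \<open>F\<close> and \<open>\<phi>'\<close> makes both integrands Borel once they are cut off by
  the indicators.\<close>

theorem holomorphic_change_of_variables:
  fixes F :: "complex \<Rightarrow> complex"
  assumes S: "open S" "open (\<phi> ` S)" and inj: "inj_on \<phi> S"
    and \<phi>: "\<And>z. z \<in> S \<Longrightarrow> (\<phi> has_field_derivative \<phi>' z) (at z)" and \<phi>': "continuous_on S \<phi>'"
    and F: "continuous_on (\<phi> ` S) F" and Fi: "integrable lborel (\<lambda>z. indicator (\<phi> ` S) z *\<^sub>R F z)"
  shows "integrable lborel (\<lambda>z. indicator S z *\<^sub>R ((cmod (\<phi>' z))\<^sup>2 *\<^sub>R F (\<phi> z)))"
    and "(\<integral>z. indicator S z *\<^sub>R ((cmod (\<phi>' z))\<^sup>2 *\<^sub>R F (\<phi> z)) \<partial>lborel) = (\<integral>z. indicator (\<phi> ` S) z *\<^sub>R F z \<partial>lborel)"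
proof -
  let ?c = complex_of_vec and ?v = vec_of_complex
  define S' where "S' = ?c -` S"
  define g where "g v = ?v (\<phi> (?c v))" for v
  define f where "f v = ?v (F (?c v))" for v
  have S'_open: "open S'"
    unfolding S'_def by (rule continuous_open_vimage[OF \<open>open S\<close>]) (rule linear_continuous_at[OF bounded_linear_complex_of_vec])
  have img: "g ` S' = ?c -` (\<phi> ` S)"
  proof (intro equalityI subsetI)
    fix v assume "v \<in> ?c -` (\<phi> ` S)"
    then obtain z where z: "z \<in> S" "?c v = \<phi> z"
      by auto
    then have "v = g (?v z)"
      by (metis complex_of_vec_inverse g_def vec_of_complex_inverse)
    moreover have "?v z \<in> S'"
      using z by (simp add: S'_def)
    ultimately show "v \<in> g ` S'"
      by blast
  qed (auto simp: g_def S'_def)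
  have injg: "inj_on g S'"
  proof (rule inj_onI)
    fix v w assume vw: "v \<in> S'" "w \<in> S'" "g v = g w"
    then have "\<phi> (?c v) = \<phi> (?c w)"
      unfolding g_def by (metis vec_of_complex_inverse)
    then have "?c v = ?c w"
      using inj vw by (auto simp: S'_def dest: inj_onD)
    then show "v = w"
      by (metis complex_of_vec_inverse)
  qed
  have der: "(g has_derivative (\<lambda>u. ?v (\<phi>' (?c v) * ?c u))) (at v within S')" if "v \<in> S'" for v
  proof -
    have "(\<phi> has_derivative (\<lambda>u. \<phi>' (?c v) * u)) (at (?c v))"
      using \<phi>[of "?c v"] that by (simp add: S'_def has_field_derivative_def)
    from has_derivative_compose[OF bounded_linear_imp_has_derivative[OF bounded_linear_complex_of_vec] this]
    have "((\<lambda>v. \<phi> (?c v)) has_derivative (\<lambda>u. \<phi>' (?c v) * ?c u)) (at v within S')"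
      by simp
    from has_derivative_compose[OF this bounded_linear_imp_has_derivative[OF bounded_linear_vec_of_complex]]
    show ?thesis
      by (simp add: g_def[abs_def])
  qed
  have ind: "indicator (g ` S') v = indicator (\<phi> ` S) (?c v)" "indicator S' v = indicator S (?c v)" for v
    unfolding img by (simp_all add: S'_def indicator_def)
  have Fm [measurable]: "(\<lambda>z. indicator (\<phi> ` S) z *\<^sub>R F z) \<in> borel_measurable borel"
    using S(2) by (intro borel_measurable_continuous_on_indicator F) auto
  have \<phi>_cont: "continuous_on S \<phi>"
    using \<phi> by (intro continuous_at_imp_continuous_on ballI DERIV_isCont) blast
  have Dm [measurable]: "(\<lambda>z. indicator S z *\<^sub>R ((cmod (\<phi>' z))\<^sup>2 *\<^sub>R F (\<phi> z))) \<in> borel_measurable borel"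
    using S(1) by (intro borel_measurable_continuous_on_indicator continuous_intros \<phi>'
        continuous_on_compose2[OF F \<phi>_cont]) auto
  have f1: "(\<lambda>v. indicator (g ` S') v *\<^sub>R f v) = (\<lambda>v. ?v ((\<lambda>z. indicator (\<phi> ` S) z *\<^sub>R F z) (?c v)))"
    unfolding f_def ind by (auto simp: fun_eq_iff indicator_def linear_0[OF bounded_linear.linear[OF bounded_linear_vec_of_complex]])
  have f2: "(\<lambda>v. indicator S' v *\<^sub>R (\<bar>det (matrix (\<lambda>u. ?v (\<phi>' (?c v) * ?c u)))\<bar> *\<^sub>R f (g v))) =
      (\<lambda>v. ?v ((\<lambda>z. indicator S z *\<^sub>R ((cmod (\<phi>' z))\<^sup>2 *\<^sub>R F (\<phi> z))) (?c v)))"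
    unfolding f_def g_def ind by (auto simp: fun_eq_iff det_matrix_complex_mult indicator_def
        linear_0[OF bounded_linear.linear[OF bounded_linear_vec_of_complex]]
        linear_scale[OF bounded_linear.linear[OF bounded_linear_vec_of_complex]])
  have m1: "(\<lambda>v. indicator (g ` S') v *\<^sub>R f v) \<in> borel_measurable borel"
    unfolding f1 by measurable
  have m2: "(\<lambda>v. indicator S' v *\<^sub>R (\<bar>det (matrix (\<lambda>u. ?v (\<phi>' (?c v) * ?c u)))\<bar> *\<^sub>R f (g v))) \<in> borel_measurable borel"
    unfolding f2 by measurable
  have inj_v: "inj ?v"
    by (rule inj_on_inverseI[of _ ?c]) simp
  have Fi': "integrable lborel (\<lambda>v. (\<lambda>z. indicator (\<phi> ` S) z *\<^sub>R F z) (?c v))"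
    using lborel_complex_of_vec(1)[OF Fm] Fi by simp
  have "f absolutely_integrable_on (g ` S')"
    unfolding set_integrable_lebesgue_iff_lborel(1)[OF m1] f1
    by (rule integrable_bounded_linear[OF bounded_linear_vec_of_complex Fi'])
  moreover note cv = has_absolute_integral_change_of_variables[OF _ der injg, of f "integral (g ` S') f"]
  ultimately have ai: "(\<lambda>v. \<bar>det (matrix (\<lambda>u. ?v (\<phi>' (?c v) * ?c u)))\<bar> *\<^sub>R f (g v)) absolutely_integrable_on S'"
    and ie: "integral S' (\<lambda>v. \<bar>det (matrix (\<lambda>u. ?v (\<phi>' (?c v) * ?c u)))\<bar> *\<^sub>R f (g v)) = integral (g ` S') f"
    and fa: "f absolutely_integrable_on (g ` S')"
    using S'_open by auto
  have i1: "integrable lborel (\<lambda>v. ?v ((\<lambda>z. indicator S z *\<^sub>R ((cmod (\<phi>' z))\<^sup>2 *\<^sub>R F (\<phi> z))) (?c v)))"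
    using ai unfolding set_integrable_lebesgue_iff_lborel(1)[OF m2] f2 .
  from integrable_bounded_linear[OF bounded_linear_complex_of_vec this]
  have i2: "integrable lborel (\<lambda>v. (\<lambda>z. indicator S z *\<^sub>R ((cmod (\<phi>' z))\<^sup>2 *\<^sub>R F (\<phi> z))) (?c v))"
    by simp
  then show "integrable lborel (\<lambda>z. indicator S z *\<^sub>R ((cmod (\<phi>' z))\<^sup>2 *\<^sub>R F (\<phi> z)))"
    using lborel_complex_of_vec(1)[OF Dm] by simp
  have "(\<integral>v. ?v ((\<lambda>z. indicator S z *\<^sub>R ((cmod (\<phi>' z))\<^sup>2 *\<^sub>R F (\<phi> z))) (?c v)) \<partial>lborel) =
      (\<integral>v. ?v ((\<lambda>z. indicator (\<phi> ` S) z *\<^sub>R F z) (?c v)) \<partial>lborel)"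
    using ie unfolding set_integrable_lebesgue_iff_lborel(2)[OF m2 ai] set_integrable_lebesgue_iff_lborel(2)[OF m1 fa] f1 f2 .
  then have "?v (\<integral>v. (\<lambda>z. indicator S z *\<^sub>R ((cmod (\<phi>' z))\<^sup>2 *\<^sub>R F (\<phi> z))) (?c v) \<partial>lborel) =
      ?v (\<integral>v. (\<lambda>z. indicator (\<phi> ` S) z *\<^sub>R F z) (?c v) \<partial>lborel)"
    unfolding integral_bounded_linear[OF bounded_linear_vec_of_complex i2]
      integral_bounded_linear[OF bounded_linear_vec_of_complex Fi'] .
  then have "(\<integral>v. (\<lambda>z. indicator S z *\<^sub>R ((cmod (\<phi>' z))\<^sup>2 *\<^sub>R F (\<phi> z))) (?c v) \<partial>lborel) =
      (\<integral>v. (\<lambda>z. indicator (\<phi> ` S) z *\<^sub>R F z) (?c v) \<partial>lborel)"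
    by (rule injD[OF inj_v])
  then show "(\<integral>z. indicator S z *\<^sub>R ((cmod (\<phi>' z))\<^sup>2 *\<^sub>R F (\<phi> z)) \<partial>lborel) = (\<integral>z. indicator (\<phi> ` S) z *\<^sub>R F z \<partial>lborel)"
    unfolding lborel_complex_of_vec(2)[OF Dm] lborel_complex_of_vec(2)[OF Fm] .
qed

lemma disc_rotation:
  fixes F :: "complex \<Rightarrow> complex"
  assumes u: "cmod u = 1" and F: "continuous_on (ball 0 1) F" and Fi: "integrable lborel (\<lambda>z. indicator (ball 0 1) z *\<^sub>R F z)"
  shows "integrable lborel (\<lambda>z. indicator (ball 0 1) z *\<^sub>R F (u * z))"
    and "(\<integral>z. indicator (ball 0 1) z *\<^sub>R F (u * z) \<partial>lborel) = (\<integral>z. indicator (ball 0 1) z *\<^sub>R F z \<partial>lborel)"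
proof -
  have u0: "u \<noteq> 0"
    using u by auto
  have img: "(\<lambda>z. u * z) ` ball 0 1 = ball 0 1"
  proof (intro equalityI subsetI)
    fix z assume "z \<in> ball (0::complex) 1"
    then have "z / u \<in> ball 0 1" "z = u * (z / u)"
      using u u0 by (auto simp: norm_divide)
    then show "z \<in> (\<lambda>z. u * z) ` ball 0 1"
      by blast
  qed (use u in \<open>auto simp: norm_mult\<close>)
  have inj: "inj_on (\<lambda>z. u * z) (ball 0 1)"
    using u0 by (auto simp: inj_on_def)
  have d: "((\<lambda>z. u * z) has_field_derivative u) (at z)" for z
    by (auto intro!: derivative_eq_intros)
  note cv = holomorphic_change_of_variables[of "ball 0 1" "\<lambda>z. u * z" "\<lambda>_. u" F, unfolded img,
      OF open_ball open_ball inj d continuous_on_const F Fi]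
  show "integrable lborel (\<lambda>z. indicator (ball 0 1) z *\<^sub>R F (u * z))"
    using cv(1) by (simp only: u power_one scaleR_one)
  show "(\<integral>z. indicator (ball 0 1) z *\<^sub>R F (u * z) \<partial>lborel) = (\<integral>z. indicator (ball 0 1) z *\<^sub>R F z \<partial>lborel)"
    using cv(2) by (simp only: u power_one scaleR_one)
qed

subsection \<open>Orthogonal complement of the range\<close>

text \<open>Membership in L2 is included, since a non-integrable product would also have integral 0,
  by default.\<close>

definition bergman_orth :: "(complex \<Rightarrow> complex) \<Rightarrow> (complex \<Rightarrow> complex) \<Rightarrow> bool" where
  "bergman_orth G v \<longleftrightarrow> v \<in> L2_fun (lebesgue_on \<bbbU>) \<and> Bergman_inner G v = 0"

lemma bergman_orth_cong:
  assumes "bergman_orth G u" "\<And>z. z \<in> \<bbbU> \<Longrightarrow> u z = v z"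
  shows "bergman_orth G v"
proof -
  have "v \<in> L2_fun (lebesgue_on \<bbbU>) \<longleftrightarrow> u \<in> L2_fun (lebesgue_on \<bbbU>)"
    by (rule L2_fun_cong) (use assms(2) in auto)
  moreover have "Bergman_inner G v = Bergman_inner G u"
    unfolding Bergman_inner_def by (rule Bochner_Integration.integral_cong) (use assms(2) in auto)
  ultimately show ?thesis
    using assms(1) by (simp add: bergman_orth_def)
qed

lemma bergman_orth_add:
  assumes "G \<in> L2_fun (lebesgue_on \<bbbU>)" "bergman_orth G u" "bergman_orth G v"
  shows "bergman_orth G (\<lambda>z. u z + c * v z)"
proof -
  have uv: "u \<in> L2_fun (lebesgue_on \<bbbU>)" "v \<in> L2_fun (lebesgue_on \<bbbU>)"
    using assms by (auto simp: bergman_orth_def)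
  have "Bergman_inner G (\<lambda>z. u z + c * v z) =
      (\<integral>z. G z * cnj (u z) + cnj c * (G z * cnj (v z)) \<partial>lebesgue_on \<bbbU>)"
    unfolding Bergman_inner_def by (simp add: algebra_simps)
  also have "\<dots> = Bergman_inner G u + cnj c * Bergman_inner G v"
    unfolding Bergman_inner_def
    using L2_fun_integrable_mult(2)[OF assms(1) uv(1)] L2_fun_integrable_mult(2)[OF assms(1) uv(2)] by simp
  finally show ?thesis
    using assms L2_fun_add[OF uv] by (simp add: bergman_orth_def)
qed

lemma bergman_orth_zero: "bergman_orth G (\<lambda>_. 0)"
  by (simp add: bergman_orth_def Bergman_inner_def)

lemma bergman_orth_cmult:
  "G \<in> L2_fun (lebesgue_on \<bbbU>) \<Longrightarrow> bergman_orth G v \<Longrightarrow> bergman_orth G (\<lambda>z. c * v z)"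
  using bergman_orth_add[OF _ bergman_orth_zero, of G v c] by simp

lemma bergman_orth_sum:
  assumes "G \<in> L2_fun (lebesgue_on \<bbbU>)" "\<And>i. i \<in> I \<Longrightarrow> bergman_orth G (v i)"
  shows "bergman_orth G (\<lambda>z. \<Sum>i\<in>I. c i * v i z)"
  using assms(2)
proof (induction I rule: infinite_finite_induct)
  case (insert i I)
  then have "bergman_orth G (\<lambda>z. (\<Sum>i\<in>I. c i * v i z) + c i * v i z)"
    by (intro bergman_orth_add[OF assms(1)]) auto
  then show ?case
    using insert by (simp add: add.commute)
qed (auto simp: bergman_orth_zero)

text \<open>The transform of \<open>f\<close> placed in slot \<open>j\<close> is a combination of
  s^m \<open>laplace m f\<close> for \<open>m \<le> j\<close> with nonzero top coefficient. This
  triangular system is solved by strong induction on \<open>j\<close>.\<close>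

lemma bergman_orth_laplace:
  assumes G: "G \<in> L2_fun (lebesgue_on \<bbbU>)"
    and orth: "\<And>f. f \<in> L2_vec n \<Longrightarrow> Bergman_inner G (bergman_transform n f) = 0"
    and f: "f \<in> L2_pos" and j: "j < n"
  shows "bergman_orth G (\<lambda>z. of_real (Im z) ^ j * laplace j f z)"
  using j
proof (induction j rule: less_induct)
  case (less j)
  define c :: "nat \<Rightarrow> complex" where "c m = of_real (real (j choose m) / fact m) * (2 * \<i>) ^ m / of_real (sqrt pi)" for m
  define d where "d = (\<lambda>k t. if k = j then f t else 0)"
  have "d k \<in> L2_pos" for k
    using f by (cases "k = j") (simp_all add: d_def L2_pos_eq_L2_fun)
  then have d: "d \<in> L2_vec n"
    by (simp add: L2_vec_def)
  have "bergman_transform n d z = (\<Sum>m\<le>j. c m * (of_real (Im z) ^ m * laplace m f z))" for z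
  proof -
    have "bergman_transform n d z = (\<Sum>k\<in>{j}. \<Sum>m\<le>k.
     of_real (real (k choose m) / fact m) * (2 * \<i>) ^ m / of_real (sqrt pi) * (of_real (Im z) ^ m * laplace m (d k) z))"
      unfolding bergman_transform_def
    proof (rule sum.mono_neutral_right)
      show "\<forall>k\<in>{..<n} - {j}. (\<Sum>m\<le>k. of_real (real (k choose m) / fact m) * (2 * \<i>) ^ m / of_real (sqrt pi) * (of_real (Im z) ^ m * laplace m (d k) z)) = 0"
        by (auto simp: d_def laplace_def)
    qed (use less.prems in auto)
    then show ?thesis
      by (simp add: c_def d_def)
  qed
  then have T: "bergman_transform n d = (\<lambda>z. \<Sum>m\<le>j. c m * (of_real (Im z) ^ m * laplace m f z))"
    by auto
  have "bergman_orth G (bergman_transform n d)"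
    using bergman_transform_isometry(1)[OF d] orth[OF d] by (simp add: bergman_orth_def)
  moreover have "bergman_orth G (\<lambda>z. \<Sum>m<j. c m * (of_real (Im z) ^ m * laplace m f z))"
    by (rule bergman_orth_sum[OF G]) (use less in auto)
  ultimately have "bergman_orth G (\<lambda>z. (1 / c j) * (bergman_transform n d z + (-1) * (\<Sum>m<j. c m * (of_real (Im z) ^ m * laplace m f z))))"
    by (intro bergman_orth_cmult[OF G] bergman_orth_add[OF G])
  moreover have "c j \<noteq> 0"
    by (simp add: c_def)
  ultimately show ?case
    by (rule_tac bergman_orth_cong) (auto simp: T lessThan_Suc_atMost[symmetric])
qed

section \<open>Explicit elements of the range: poles in the lower half plane\<close>

lemma integral_exp_pos:
  assumes "Im \<zeta> > 0"
  shows "(\<integral>t. of_real t * exp (\<i> * \<zeta> * of_real t) \<partial>lebesgue_on {0<..}) = - 1 / \<zeta>\<^sup>2"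
proof -
  let ?f = "\<lambda>t::real. of_real t * exp (\<i> * \<zeta> * of_real t)"
  \<comment> \<open>The antiderivative found by integration by parts; it vanishes at infinity and
    equals 1/\<zeta>^2 at 0.\<close>
  define F where "F t = exp (\<i> * \<zeta> * of_real t) * (of_real t / (\<i> * \<zeta>) + 1 / \<zeta>\<^sup>2)" for t :: real
  have "\<zeta> \<noteq> 0"
    using assms by auto
  have fm: "?f \<in> borel_measurable borel"
    by (intro borel_measurable_continuous_onI continuous_intros)
  have ei: "einterval 0 \<infinity> = {0::real<..}"
    by (auto simp: einterval_def zero_ereal_def)
  have "integrable (lebesgue_on {0<..}) (\<lambda>t::real. t ^ 1 * exp (- (Im \<zeta> * t)))"
    by (rule integrable_power_exp_pos[OF assms])
  then have "integrable (lebesgue_on {0<..}) ?f"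
  proof (rule Bochner_Integration.integrable_bound)
    show "?f \<in> borel_measurable (lebesgue_on {0<..})"
      by (rule borel_measurable_lebesgue_on[OF fm])
  qed (auto simp: norm_mult)
  then have fi: "set_integrable lborel (einterval 0 \<infinity>) ?f"
    unfolding set_integrable_def ei by (subst (asm) integrable_lebesgue_on_iff[OF fm]) auto
  have "(LBINT t=0..\<infinity>. ?f t) = 0 - F 0"
  proof (rule interval_integral_FTC_integrable[where F = F])
    fix t :: real
    show "(F has_vector_derivative ?f t) (at t)"
    proof -
      have "((\<lambda>x. exp (\<i> * \<zeta> * x) * (x / (\<i> * \<zeta>) + 1 / \<zeta>\<^sup>2)) has_field_derivative
         exp (\<i> * \<zeta> * x) * (\<i> * \<zeta>) * (x / (\<i> * \<zeta>) + 1 / \<zeta>\<^sup>2) + exp (\<i> * \<zeta> * x) * (1 / (\<i> * \<zeta>))) (at x)" for x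
        using \<open>\<zeta> \<noteq> 0\<close> by (auto intro!: derivative_eq_intros)
      from has_vector_derivative_real_field[OF this]
      have "(F has_vector_derivative exp (\<i> * \<zeta> * of_real t) * (\<i> * \<zeta>) * (of_real t / (\<i> * \<zeta>) + 1 / \<zeta>\<^sup>2) + exp (\<i> * \<zeta> * of_real t) * (1 / (\<i> * \<zeta>))) (at t)"
        unfolding F_def .
      also have "exp (\<i> * \<zeta> * of_real t) * (\<i> * \<zeta>) * (of_real t / (\<i> * \<zeta>) + 1 / \<zeta>\<^sup>2) + exp (\<i> * \<zeta> * of_real t) * (1 / (\<i> * \<zeta>)) = ?f t"
        using \<open>\<zeta> \<noteq> 0\<close> by (simp add: field_simps power2_eq_square)
      finally show ?thesis .
    qed
    show "isCont ?f t"
      by (intro continuous_intros)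
  next
    show "set_integrable lborel (einterval 0 \<infinity>) ?f"
      by (rule fi)
    have "isCont F 0"
      unfolding F_def using \<open>\<zeta> \<noteq> 0\<close> by (intro continuous_intros) auto
    then have "(F \<longlongrightarrow> F 0) (at_right 0)"
      by (simp add: isCont_def filterlim_at_split)
    then show "((F \<circ> real_of_ereal) \<longlongrightarrow> F 0) (at_right 0)"
      unfolding zero_ereal_def by (simp add: ereal_tendsto_simps)
    have "(F \<longlongrightarrow> 0) at_top"
    proof (rule tendsto_norm_zero_cancel)
      have "((\<lambda>t. exp (- (Im \<zeta> * t)) * (\<bar>t\<bar> / cmod \<zeta> + 1 / (cmod \<zeta>)\<^sup>2)) \<longlongrightarrow> 0) at_top"
      proof -
        have "((\<lambda>t. exp (- (a * t)) * \<bar>t\<bar>) \<longlongrightarrow> 0) at_top" "((\<lambda>t. exp (- (a * t))) \<longlongrightarrow> 0) at_top" if "a > 0" for a :: real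
          using that by real_asymp+
        from this[OF assms]
        have "((\<lambda>t. exp (- (Im \<zeta> * t)) * \<bar>t\<bar> * (1 / cmod \<zeta>) + exp (- (Im \<zeta> * t)) * (1 / (cmod \<zeta>)\<^sup>2)) \<longlongrightarrow>
            0 * (1 / cmod \<zeta>) + 0 * (1 / (cmod \<zeta>)\<^sup>2)) at_top"
          by (intro tendsto_intros)
        then show ?thesis
          by (simp add: algebra_simps)
      qed
      moreover have "cmod (F t) \<le> exp (- (Im \<zeta> * t)) * (\<bar>t\<bar> / cmod \<zeta> + 1 / (cmod \<zeta>)\<^sup>2)" for t
        unfolding F_def norm_mult
        by (intro mult_mono order_trans[OF norm_triangle_ineq]) (auto simp: norm_mult norm_divide norm_power)
      ultimately show "((\<lambda>t. cmod (F t)) \<longlongrightarrow> 0) at_top"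
        by (rule_tac tendsto_sandwich[where f = "\<lambda>_. 0"]) auto
    qed
    then show "((F \<circ> real_of_ereal) \<longlongrightarrow> 0) (at_left \<infinity>)"
      by (simp add: ereal_tendsto_simps)
  qed auto
  moreover have "(LBINT t=0..\<infinity>. ?f t) = (\<integral>t. ?f t \<partial>lebesgue_on {0<..})"
    unfolding interval_lebesgue_integral_def set_lebesgue_integral_def ei
    by (subst integral_lebesgue_on_eq[OF fm]) auto
  ultimately show ?thesis
    by (simp add: F_def)
qed

text \<open>For \<open>N = 0\<close> the two square roots combine to t and the integral is explicit.
  Higher \<open>N\<close> follow by differentiating in z, as \<open>laplace (Suc N)\<close> is the
  derivative of \<open>laplace N\<close>.\<close>

lemma laplace_bergman_kernel:
  assumes w: "w \<in> \<bbbU>" and z: "z \<in> \<bbbU>"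
  shows "laplace N (bergman_kernel 0 (- cnj w)) z = (-1) ^ Suc N * fact (Suc N) / (z - cnj w) ^ (N + 2)"
  using z
proof (induction N arbitrary: z)
  case 0
  have "laplace 0 (bergman_kernel 0 (- cnj w)) z =
      (\<integral>t. of_real t * exp (\<i> * (z - cnj w) * of_real t) \<partial>lebesgue_on {0<..})"
    unfolding laplace_def bergman_kernel_def
  proof (intro Bochner_Integration.integral_cong refl)
    fix t :: real assume "t \<in> space (lebesgue_on {0<..})"
    then have t: "t > 0"
      by simp
    have "of_real (sqrt t) * of_real (sqrt t) = (of_real t :: complex)"
      using t by (simp flip: of_real_mult)
    moreover have "exp (\<i> * z * of_real t) * exp (\<i> * - cnj w * of_real t) = exp (\<i> * (z - cnj w) * of_real t)"
      unfolding exp_add[symmetric] by (simp add: algebra_simps)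
    ultimately show "(\<i> * of_real t) ^ 0 * of_real (sqrt t) * exp (\<i> * z * of_real t) *
        ((\<i> * of_real t) ^ 0 * of_real (sqrt t) * exp (\<i> * - cnj w * of_real t)) =
        of_real t * exp (\<i> * (z - cnj w) * of_real t)"
      by (metis (no_types, lifting) mult.commute mult.left_commute mult_1 power_0)
  qed
  also have "\<dots> = - 1 / (z - cnj w)\<^sup>2"
    using w 0 by (intro integral_exp_pos) (auto simp: upper_half_plane_def)
  finally show ?case
    by (simp add: numeral_2_eq_2)
next
  case (Suc N)
  let ?f = "bergman_kernel 0 (- cnj w)"
  have f: "?f \<in> L2_pos"
    unfolding L2_pos_eq_L2_fun using w by (intro bergman_kernel_L2) (auto simp: upper_half_plane_def)
  have ne: "z - cnj w \<noteq> 0"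
    using w Suc.prems by (auto simp: upper_half_plane_def complex_eq_iff)
  have "(laplace N ?f has_field_derivative laplace (Suc N) ?f z) (at z)"
    using laplace_has_field_derivative[OF f] Suc.prems by (simp add: upper_half_plane_def)
  moreover have "(laplace N ?f has_field_derivative (-1) ^ Suc (Suc N) * fact (Suc (Suc N)) / (z - cnj w) ^ (Suc N + 2)) (at z)"
  proof (rule has_field_derivative_transform_within_open[of _ _ _ \<bbbU>])
    show "((\<lambda>z. (-1) ^ Suc N * fact (Suc N) / (z - cnj w) ^ (N + 2)) has_field_derivative
        (-1) ^ Suc (Suc N) * fact (Suc (Suc N)) / (z - cnj w) ^ (Suc N + 2)) (at z)"
    proof -
      define A :: complex where "A = (-1) ^ Suc N * fact (Suc N)"
      have "((\<lambda>z. z - cnj w) has_field_derivative 1) (at z)"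
        by (auto intro!: derivative_eq_intros)
      from DERIV_divide[OF DERIV_const DERIV_power[OF this, of "N + 2"], of A] ne
      have "((\<lambda>z. A / (z - cnj w) ^ (N + 2)) has_field_derivative
        - (A * (of_nat (N + 2) * (z - cnj w) ^ (N + 1))) / ((z - cnj w) ^ (N + 2) * (z - cnj w) ^ (N + 2))) (at z)"
        by simp
      also have "- (A * (of_nat (N + 2) * (z - cnj w) ^ (N + 1))) / ((z - cnj w) ^ (N + 2) * (z - cnj w) ^ (N + 2)) =
          (- A * of_nat (N + 2)) / (z - cnj w) ^ (Suc N + 2)"
      proof -
        have "- (A * (c * a ^ (N + 1))) / (a ^ (N + 2) * a ^ (N + 2)) = (- A * c) / a ^ (Suc N + 2)" if "a \<noteq> 0" for a c :: complex
          using that by (simp add: field_simps)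
        then show ?thesis
          using ne by blast
      qed
      also have "- A * of_nat (N + 2) = (-1) ^ Suc (Suc N) * fact (Suc (Suc N))"
        by (simp add: A_def algebra_simps)
      finally show ?thesis
        unfolding A_def .
    qed
  qed (use Suc in auto)
  ultimately show ?case
    by (rule DERIV_unique)
qed

lemma bergman_orth_pole:
  assumes G: "G \<in> L2_fun (lebesgue_on \<bbbU>)"
    and orth: "\<And>f. f \<in> L2_vec n \<Longrightarrow> Bergman_inner G (bergman_transform n f) = 0"
    and j: "j < n" and m: "m \<ge> j + 2" and w: "w \<in> \<bbbU>"
  shows "bergman_orth G (\<lambda>z. of_real (Im z) ^ j / (z - cnj w) ^ m)"
proof -
  \<comment> \<open>Extra powers of t in the transformed function raise the pole: order
    \<open>p\<close> moves from the function to the kernel, giving a pole of order j + p + 2 =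
    m.\<close>
  define p where "p = m - j - 2"
  have m_eq: "j + p + 2 = m"
    using m by (simp add: p_def)
  define c :: complex where "c = (-1) ^ Suc (j + p) * fact (Suc (j + p))"
  have "c \<noteq> 0"
    by (simp add: c_def del: fact_Suc)
  have "bergman_kernel p (- cnj w) \<in> L2_pos"
    unfolding L2_pos_eq_L2_fun using w by (intro bergman_kernel_L2) (auto simp: upper_half_plane_def)
  from bergman_orth_laplace[OF G orth this j]
  have "bergman_orth G (\<lambda>z. (1 / c) * (of_real (Im z) ^ j * laplace j (bergman_kernel p (- cnj w)) z))"
    by (rule bergman_orth_cmult[OF G])
  then show ?thesis
  proof (rule bergman_orth_cong)
    fix z assume z: "z \<in> \<bbbU>"
    have "laplace j (bergman_kernel p (- cnj w)) z = laplace (j + p) (bergman_kernel 0 (- cnj w)) z"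
      unfolding laplace_def bergman_kernel_def by (simp add: power_add mult_ac)
    also have "\<dots> = c / (z - cnj w) ^ m"
      unfolding laplace_bergman_kernel[OF w z] c_def m_eq ..
    finally show "(1 / c) * (of_real (Im z) ^ j * laplace j (bergman_kernel p (- cnj w)) z) = of_real (Im z) ^ j / (z - cnj w) ^ m"
      using \<open>c \<noteq> 0\<close> by simp
  qed
qed

text \<open>Transported to the unit disc by a Cayley map centred at \<open>w\<close>, these functions become
  polynomials in the squared modulus.\<close>

lemma bergman_orth_radial:
  assumes G: "G \<in> L2_fun (lebesgue_on \<bbbU>)"
    and orth: "\<And>f. f \<in> L2_vec n \<Longrightarrow> Bergman_inner G (bergman_transform n f) = 0"
    and j: "j < n" and w: "w \<in> \<bbbU>"
  shows "bergman_orth G (\<lambda>z. of_real (Im z) ^ j * (cnj z - w) ^ (n - 1 - j) / (z - cnj w) ^ (n + 1 + j))"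
proof -
  define N where "N = n - 1 - j"
  have nN: "n + 1 + j = N + (2 * j + 2)"
    using j by (simp add: N_def)
  \<comment> \<open>From cnj z - w = (z - cnj w) - 2\<i> (Im z + Im w), expanded by the binomial
    theorem twice. The term for (l, r) has the power j + r \<le> n - 1 of Im z and a pole of order
    2j + 2 + l \<ge> (j + r) + 2, just what \<open>bergman_orth_pole\<close> admits.\<close>
  define C :: "nat \<times> nat \<Rightarrow> complex" where
    "C = (\<lambda>(l, r). of_nat (N choose l) * (- 2 * \<i>) ^ l * of_nat (l choose r) * of_real (Im w) ^ (l - r))"
  have "bergman_orth G (\<lambda>z. \<Sum>p\<in>Sigma {..N} (\<lambda>l. {..l}). C p * (of_real (Im z) ^ (j + snd p) / (z - cnj w) ^ (2 * j + 2 + fst p)))"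
    by (intro bergman_orth_sum[OF G] bergman_orth_pole[OF G orth _ _ w]) (use j in \<open>auto simp: N_def\<close>)
  then show ?thesis
  proof (rule bergman_orth_cong)
    fix z assume z: "z \<in> \<bbbU>"
    define a where "a = z - cnj w"
    have ne: "a \<noteq> 0"
      using w z by (auto simp: a_def upper_half_plane_def complex_eq_iff)
    have "(\<Sum>p\<in>Sigma {..N} (\<lambda>l. {..l}). C p * (of_real (Im z) ^ (j + snd p) / a ^ (2 * j + 2 + fst p))) =
       (\<Sum>l\<le>N. \<Sum>r\<le>l. C (l, r) * (of_real (Im z) ^ (j + r) / a ^ (2 * j + 2 + l)))"
      by (subst sum.Sigma) (auto simp: case_prod_beta)
    also have "\<dots> = (\<Sum>l\<le>N. of_nat (N choose l) * (- 2 * \<i>) ^ l * (of_real (Im z) + of_real (Im w)) ^ l * (of_real (Im z) ^ j / a ^ (2 * j + 2 + l)))"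
      unfolding binomial_ring sum_distrib_left sum_distrib_right
      by (intro sum.cong refl) (simp add: C_def power_add)
    also have "\<dots> = (\<Sum>l\<le>N. of_nat (N choose l) * (- 2 * \<i> * (of_real (Im z) + of_real (Im w))) ^ l * a ^ (N - l)) * (of_real (Im z) ^ j / a ^ (n + 1 + j))"
      unfolding sum_distrib_right
    proof (intro sum.cong refl)
      fix l assume "l \<in> {..N}"
      then have "n + 1 + j = (N - l) + (2 * j + 2 + l)"
        using nN by simp
      then have "a ^ (n + 1 + j) = a ^ (N - l) * a ^ (2 * j + 2 + l)"
        by (simp only: power_add)
      then show "of_nat (N choose l) * (- 2 * \<i>) ^ l * (of_real (Im z) + of_real (Im w)) ^ l * (of_real (Im z) ^ j / a ^ (2 * j + 2 + l)) =
        of_nat (N choose l) * (- 2 * \<i> * (of_real (Im z) + of_real (Im w))) ^ l * a ^ (N - l) * (of_real (Im z) ^ j / a ^ (n + 1 + j))"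
        using ne unfolding power_mult_distrib by simp
    qed
    also have "(\<Sum>l\<le>N. of_nat (N choose l) * (- 2 * \<i> * (of_real (Im z) + of_real (Im w))) ^ l * a ^ (N - l)) =
        (- 2 * \<i> * (of_real (Im z) + of_real (Im w)) + a) ^ N"
      by (rule binomial_ring[symmetric])
    also have "- 2 * \<i> * (of_real (Im z) + of_real (Im w)) + a = cnj z - w"
      by (simp add: a_def complex_eq_iff)
    finally show "(\<Sum>p\<in>Sigma {..N} (\<lambda>l. {..l}). C p * (of_real (Im z) ^ (j + snd p) / (z - cnj w) ^ (2 * j + 2 + fst p))) =
        of_real (Im z) ^ j * (cnj z - w) ^ (n - 1 - j) / (z - cnj w) ^ (n + 1 + j)"
      by (simp add: a_def N_def mult.commute)
  qed
qed

subsection \<open>The unit disc\<close>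

text \<open>In contrast to \<open>integral_lebesgue_on_eq\<close>, the function is controlled on
  \<open>S\<close> only; the indicator makes it Borel on the whole plane.\<close>

lemma integral_lebesgue_on_continuous:
  fixes f :: "complex \<Rightarrow> complex"
  assumes "open S" "continuous_on S f"
  shows "integrable (lebesgue_on S) f \<longleftrightarrow> integrable lborel (\<lambda>x. indicator S x *\<^sub>R f x)"
    and "integral\<^sup>L (lebesgue_on S) f = (\<integral>x. indicator S x *\<^sub>R f x \<partial>lborel)"
proof -
  have m: "(\<lambda>x. indicator S x *\<^sub>R f x) \<in> borel_measurable lborel"
    using assms by (simp add: borel_measurable_continuous_on_indicator)
  have S: "S \<inter> space lebesgue \<in> sets lebesgue"
    using assms(1) by simp
  show "integrable (lebesgue_on S) f \<longleftrightarrow> integrable lborel (\<lambda>x. indicator S x *\<^sub>R f x)"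
    unfolding integrable_restrict_space[OF S] by (rule integrable_completion[OF m])
  show "integral\<^sup>L (lebesgue_on S) f = (\<integral>x. indicator S x *\<^sub>R f x \<partial>lborel)"
    unfolding integral_restrict_space[OF S] by (rule integral_completion[OF m])
qed

definition circ :: "real \<Rightarrow> complex" where
  "circ t = exp (2 * of_real pi * \<i> * of_real t)"

lemma norm_circ [simp]: "cmod (circ t) = 1"
  by (simp add: circ_def)

text \<open>On the unit circle cnj u = 1/u, so the mean is Cauchy's integral for the
  \<open>l\<close>-th derivative of u \<mapsto> g(\<zeta> u) at 0. Only one Taylor coefficient
  survives, and the result depends on |\<zeta>| alone.\<close>

lemma circle_mean:
  assumes g: "g holomorphic_on ball 0 1" and \<zeta>: "\<zeta> \<in> ball 0 1"
  shows "((\<lambda>t. cnj (circ t * \<zeta>) ^ l * g (circ t * \<zeta>)) has_integral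
     of_real ((cmod \<zeta>)\<^sup>2) ^ l * ((deriv ^^ l) g 0 / fact l)) {0..1}"
proof -
  \<comment> \<open>Since |\<zeta>| < 1, u \<mapsto> g(\<zeta> u) is holomorphic on an open set
    containing the closed disc, as Cauchy's formula on the unit circle requires.\<close>
  define S where "S = (\<lambda>u. \<zeta> * u) -` ball 0 1"
  have S: "open S"
    unfolding S_def by (intro continuous_open_vimage continuous_intros) auto
  have sub: "cball 0 1 \<subseteq> S"
  proof
    fix u :: complex assume "u \<in> cball 0 1"
    then have "cmod \<zeta> * cmod u \<le> cmod \<zeta> * 1"
      by (intro mult_left_mono) auto
    then show "u \<in> S"
      using \<zeta> by (simp add: S_def norm_mult)
  qed
  have hol: "(\<lambda>u. g (\<zeta> * u)) holomorphic_on S"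
    using holomorphic_on_compose_gen[OF _ g, of "\<lambda>u. \<zeta> * u" S]
    by (auto simp: o_def S_def intro!: holomorphic_intros)
  have "((\<lambda>u. g (\<zeta> * u) / (u - 0) ^ Suc l) has_contour_integral
      (2 * pi * \<i>) / fact l * (deriv ^^ l) (\<lambda>u. g (\<zeta> * u)) 0) (circlepath 0 1)"
  proof (rule Cauchy_has_contour_integral_higher_derivative_circlepath)
    show "continuous_on (cball 0 1) (\<lambda>u. g (\<zeta> * u))"
      using holomorphic_on_imp_continuous_on[OF hol] sub by (rule continuous_on_subset)
    show "(\<lambda>u. g (\<zeta> * u)) holomorphic_on ball 0 1"
      using hol sub ball_subset_cball by (meson holomorphic_on_subset subset_trans)
  qed auto
  also have "(deriv ^^ l) (\<lambda>u. g (\<zeta> * u)) 0 = \<zeta> ^ l * (deriv ^^ l) g 0"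
    using higher_deriv_compose_linear[OF g S open_ball, of 0 \<zeta> l] sub by (auto simp: S_def)
  finally have "((\<lambda>t. g (\<zeta> * circ t) / circ t ^ Suc l * (2 * pi * \<i> * circ t)) has_integral
      (2 * pi * \<i>) / fact l * (\<zeta> ^ l * (deriv ^^ l) g 0)) {0..1}"
    unfolding has_contour_integral_def
  proof (rule has_integral_eq[rotated])
    fix t :: real assume "t \<in> {0..1}"
    then have "vector_derivative (circlepath 0 1) (at t within {0..1}) = 2 * pi * \<i> * circ t"
      by (simp add: vector_derivative_circlepath01 circ_def)
    moreover have "circlepath 0 1 t = circ t"
      by (simp add: circlepath circ_def)
    ultimately show "g (\<zeta> * circlepath 0 1 t) / (circlepath 0 1 t - 0) ^ Suc l * vector_derivative (circlepath 0 1) (at t within {0..1}) =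
        g (\<zeta> * circ t) / circ t ^ Suc l * (2 * pi * \<i> * circ t)"
      by simp
  qed
  from has_integral_mult_right[OF this, of "cnj \<zeta> ^ l / (2 * pi * \<i>)"]
  have "((\<lambda>t. cnj \<zeta> ^ l / (2 * pi * \<i>) * (g (\<zeta> * circ t) / circ t ^ Suc l * (2 * pi * \<i> * circ t))) has_integral
      cnj \<zeta> ^ l / (2 * pi * \<i>) * ((2 * pi * \<i>) / fact l * (\<zeta> ^ l * (deriv ^^ l) g 0))) {0..1}" .
  also have "cnj \<zeta> ^ l / (2 * pi * \<i>) * ((2 * pi * \<i>) / fact l * (\<zeta> ^ l * (deriv ^^ l) g 0)) =
      of_real ((cmod \<zeta>)\<^sup>2) ^ l * ((deriv ^^ l) g 0 / fact l)"
  proof -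
    have "a / c * (c / b * (d * e)) = d * a * (e / b)" if "c \<noteq> 0" for a b c d e :: complex
      using that by simp
    from this[of "2 * pi * \<i>"] show ?thesis
      unfolding complex_norm_square power_mult_distrib by simp
  qed
  finally show ?thesis
  proof (rule has_integral_eq[rotated])
    fix t :: real
    have c: "circ t * cnj (circ t) = 1"
      using complex_norm_square[of "circ t"] by simp
    then have nz: "circ t \<noteq> 0"
      by auto
    have "cnj (circ t) = 1 / circ t"
      using c nz by (simp add: field_simps)
    then show "cnj \<zeta> ^ l / (2 * pi * \<i>) * (g (\<zeta> * circ t) / circ t ^ Suc l * (2 * pi * \<i> * circ t)) =
        cnj (circ t * \<zeta>) ^ l * g (circ t * \<zeta>)"
      using nz by (simp add: power_mult_distrib power_divide mult.commute)
  qed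
qed

text \<open>Maps the unit disc onto \<bbbU> and 0 to w; the inverse is z \<mapsto> (z - w) / (z -
  cnj w).\<close>

definition cayley :: "complex \<Rightarrow> complex \<Rightarrow> complex" where
  "cayley w \<zeta> = (w - cnj w * \<zeta>) / (1 - \<zeta>)"

text \<open>Each |1 - \<zeta>|^2 is split into (1 - \<zeta>)(1 - cnj \<zeta>), since the holomorphic
  and the antiholomorphic factor have to cancel separately later.\<close>

lemma cayley_facts:
  assumes \<zeta>: "\<zeta> \<in> ball 0 1"
  shows "1 - \<zeta> \<noteq> 0" "1 - cnj \<zeta> \<noteq> 0"
    and "cayley w \<zeta> - cnj w = 2 * \<i> * of_real (Im w) / (1 - \<zeta>)"
    and "cnj (cayley w \<zeta>) - w = - (2 * \<i> * of_real (Im w)) / (1 - cnj \<zeta>)"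
    and "of_real (Im (cayley w \<zeta>)) = of_real (Im w) * of_real (1 - (cmod \<zeta>)\<^sup>2) / ((1 - \<zeta>) * (1 - cnj \<zeta>))"
    and "of_real ((cmod ((w - cnj w) / (1 - \<zeta>)\<^sup>2))\<^sup>2) = 4 * of_real ((Im w)\<^sup>2) / ((1 - \<zeta>)\<^sup>2 * (1 - cnj \<zeta>)\<^sup>2)"
proof -
  show a: "1 - \<zeta> \<noteq> 0"
    using \<zeta> by auto
  then have "cnj (1 - \<zeta>) \<noteq> 0"
    by (simp only: complex_cnj_zero_iff not_False_eq_True)
  then show b: "1 - cnj \<zeta> \<noteq> 0"
    by simp
  have ww: "w - cnj w = 2 * \<i> * of_real (Im w)"
    by (simp add: complex_eq_iff)
  have "cayley w \<zeta> - cnj w = (w - cnj w) / (1 - \<zeta>)"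
    using a by (simp add: cayley_def field_simps)
  then show c: "cayley w \<zeta> - cnj w = 2 * \<i> * of_real (Im w) / (1 - \<zeta>)"
    by (simp only: ww)
  then have "cnj (cayley w \<zeta> - cnj w) = cnj (2 * \<i> * of_real (Im w) / (1 - \<zeta>))"
    by (rule arg_cong)
  then show d: "cnj (cayley w \<zeta>) - w = - (2 * \<i> * of_real (Im w)) / (1 - cnj \<zeta>)"
    by simp
  define \<kappa> where "\<kappa> = 2 * \<i> * complex_of_real (Im w)"
  have "2 * \<i> * of_real (Im (cayley w \<zeta>)) = cayley w \<zeta> - cnj (cayley w \<zeta>)"
    by (simp add: complex_eq_iff)
  also have "\<dots> = (cayley w \<zeta> - cnj w) - (cnj (cayley w \<zeta>) - w) - (w - cnj w)"
    by simp
  also have "\<dots> = \<kappa> / (1 - \<zeta>) + \<kappa> / (1 - cnj \<zeta>) - \<kappa>"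
    unfolding c d ww \<kappa>_def[symmetric] by simp
  also have "\<dots> = \<kappa> * (1 - \<zeta> * cnj \<zeta>) / ((1 - \<zeta>) * (1 - cnj \<zeta>))"
  proof -
    have "\<kappa> / x + \<kappa> / y - \<kappa> = \<kappa> * (x + y - x * y) / (x * y)" if "x \<noteq> 0" "y \<noteq> 0" for x y
      using that by (simp add: field_simps)
    from this[OF a b] show ?thesis
      by (simp add: algebra_simps)
  qed
  also have "1 - \<zeta> * cnj \<zeta> = of_real (1 - (cmod \<zeta>)\<^sup>2)"
    unfolding of_real_diff complex_norm_square by simp
  finally have "2 * \<i> * of_real (Im (cayley w \<zeta>)) = 2 * \<i> * (of_real (Im w) * of_real (1 - (cmod \<zeta>)\<^sup>2) / ((1 - \<zeta>) * (1 - cnj \<zeta>)))"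
    by (simp add: \<kappa>_def)
  then show "of_real (Im (cayley w \<zeta>)) = of_real (Im w) * of_real (1 - (cmod \<zeta>)\<^sup>2) / ((1 - \<zeta>) * (1 - cnj \<zeta>))"
    by (metis (no_types) complex_i_not_zero mult_cancel_left mult_eq_0_iff zero_neq_numeral)
  have "of_real ((cmod ((w - cnj w) / (1 - \<zeta>)\<^sup>2))\<^sup>2) = (\<kappa> / (1 - \<zeta>)\<^sup>2) * cnj (\<kappa> / (1 - \<zeta>)\<^sup>2)"
    unfolding complex_norm_square ww \<kappa>_def ..
  also have "\<dots> = (\<kappa> * cnj \<kappa>) / ((1 - \<zeta>)\<^sup>2 * (1 - cnj \<zeta>)\<^sup>2)"
    by simp
  also have "\<kappa> * cnj \<kappa> = 4 * of_real ((Im w)\<^sup>2)"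
    by (simp add: \<kappa>_def complex_eq_iff power2_eq_square)
  finally show "of_real ((cmod ((w - cnj w) / (1 - \<zeta>)\<^sup>2))\<^sup>2) = 4 * of_real ((Im w)\<^sup>2) / ((1 - \<zeta>)\<^sup>2 * (1 - cnj \<zeta>)\<^sup>2)" .
qed

lemma cayley_in_upper_half_plane:
  assumes w: "w \<in> \<bbbU>" and \<zeta>: "\<zeta> \<in> ball 0 1"
  shows "cayley w \<zeta> \<in> \<bbbU>"
proof -
  note f = cayley_facts[OF \<zeta>]
  have "(1 - \<zeta>) * (1 - cnj \<zeta>) = of_real ((cmod (1 - \<zeta>))\<^sup>2)"
    unfolding complex_norm_square by simp
  then have "complex_of_real (Im (cayley w \<zeta>)) = of_real (Im w * (1 - (cmod \<zeta>)\<^sup>2) / (cmod (1 - \<zeta>))\<^sup>2)"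
    using f(5)[of w] by simp
  then have eq: "Im (cayley w \<zeta>) = Im w * (1 - (cmod \<zeta>)\<^sup>2) / (cmod (1 - \<zeta>))\<^sup>2"
    by (simp only: of_real_eq_iff)
  have "(cmod \<zeta>)\<^sup>2 < 1"
    using \<zeta> by (simp add: power_less_one_iff abs_square_less_1)
  then have "Im w * (1 - (cmod \<zeta>)\<^sup>2) / (cmod (1 - \<zeta>))\<^sup>2 > 0"
    using w f(1) by (intro divide_pos_pos mult_pos_pos) (auto simp: upper_half_plane_def)
  then show ?thesis
    using eq by (simp add: upper_half_plane_def)
qed

lemma cayley_image:
  assumes w: "w \<in> \<bbbU>"
  shows "cayley w ` ball 0 1 = \<bbbU>"
proof (intro equalityI subsetI)
  fix z assume z: "z \<in> \<bbbU>"
  have ne: "z - cnj w \<noteq> 0" "w - cnj w \<noteq> 0"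
    using w z by (auto simp: upper_half_plane_def complex_eq_iff)
  define \<zeta> where "\<zeta> = (z - w) / (z - cnj w)"
  \<comment> \<open>A point of \<bbbU> is nearer to w than to the mirror image cnj w.\<close>
  have "(Im z - Im w)\<^sup>2 < (Im z + Im w)\<^sup>2"
    using w z by (simp add: upper_half_plane_def power2_eq_square algebra_simps)
  then have "(cmod (z - w))\<^sup>2 < (cmod (z - cnj w))\<^sup>2"
    by (simp add: cmod_power2)
  then have "cmod (z - w) < cmod (z - cnj w)"
    by (rule power2_less_imp_less) simp
  then have "\<zeta> \<in> ball 0 1"
    using ne by (simp add: \<zeta>_def norm_divide divide_less_eq)
  moreover have "cayley w \<zeta> = z"
  proof -
    have "1 - \<zeta> = (w - cnj w) / (z - cnj w)" "w - cnj w * \<zeta> = z * (w - cnj w) / (z - cnj w)"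
      using ne by (simp_all add: \<zeta>_def field_simps)
    then show ?thesis
      unfolding cayley_def using ne by simp
  qed
  ultimately show "z \<in> cayley w ` ball 0 1"
    by blast
qed (use cayley_in_upper_half_plane[OF w] in auto)

lemma cayley_inj:
  assumes w: "w \<in> \<bbbU>"
  shows "inj_on (cayley w) (ball 0 1)"
proof (rule inj_onI)
  fix x y assume xy: "x \<in> ball 0 1" "y \<in> ball 0 1" "cayley w x = cayley w y"
  define \<kappa> where "\<kappa> = 2 * \<i> * complex_of_real (Im w)"
  have "\<kappa> \<noteq> 0"
    using w by (simp add: \<kappa>_def upper_half_plane_def)
  moreover have "\<kappa> / (1 - x) = \<kappa> / (1 - y)"
    unfolding \<kappa>_def cayley_facts(3)[OF xy(1), of w, symmetric] cayley_facts(3)[OF xy(2), of w, symmetric] xy(3) ..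
  ultimately show "x = y"
    using frac_eq_eq[OF cayley_facts(1)[OF xy(1)] cayley_facts(1)[OF xy(2)], of \<kappa> \<kappa>] by auto
qed

lemma cayley_has_field_derivative:
  assumes "\<zeta> \<in> ball 0 1"
  shows "(cayley w has_field_derivative (w - cnj w) / (1 - \<zeta>)\<^sup>2) (at \<zeta>)"
proof -
  have "1 - \<zeta> \<noteq> 0"
    by (rule cayley_facts(1)[OF assms])
  then show ?thesis
    unfolding cayley_def
    by (auto intro!: derivative_eq_intros simp: field_simps power2_eq_square)
qed

text \<open>Where a continuous function is nonzero is an open set, and a nonempty open set is not
  negligible.\<close>

lemma zero_if_integral_cmod_sq_zero:
  fixes P :: "complex \<Rightarrow> complex"
  assumes S: "open S" and P: "continuous_on S P"
    and i: "integrable lborel (\<lambda>z. indicator S z *\<^sub>R (cmod (P z))\<^sup>2)"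
    and z: "(\<integral>z. indicator S z *\<^sub>R (cmod (P z))\<^sup>2 \<partial>lborel) = 0" and x: "x \<in> S"
  shows "P x = 0"
proof (rule ccontr)
  assume ne: "P x \<noteq> 0"
  define A where "A = {z \<in> S. P z \<noteq> 0}"
  have "open A"
  proof -
    have "A = S \<inter> P -` (- {0})"
      by (auto simp: A_def)
    then show ?thesis
      using continuous_open_preimage[OF P S, of "- {0}"] by auto
  qed
  have "AE z in lborel. indicator S z *\<^sub>R (cmod (P z))\<^sup>2 = 0"
    using integral_nonneg_eq_0_iff_AE[OF i] z by auto
  then have "AE z in lborel. z \<notin> A"
    by eventually_elim (auto simp: A_def indicator_def)
  then have "A \<in> null_sets lborel"
    using \<open>open A\<close> by (subst (asm) AE_iff_null_sets[symmetric]) auto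
  then have "negligible A"
    by (simp add: negligible_iff_null_sets null_sets_completionI)
  moreover have "A \<noteq> {}"
    using ne x by (auto simp: A_def)
  ultimately show False
    using open_not_negligible[OF \<open>open A\<close>] by blast
qed

text \<open>Expand the power of 1 - cnj \<zeta> and average each monomial by
  \<open>circle_mean\<close>. The radial factor X^k is constant on circles, and X^k |\<zeta>|^(2l)
  with l \<le> n - 1 - k has degree at most n - 1 in X.\<close>

lemma disc_polyanalytic_mean:
  assumes g: "\<And>k. k < n \<Longrightarrow> g k holomorphic_on ball 0 1" and n: "n \<ge> 1"
  obtains p :: "complex poly" where "degree p < n"
    "\<And>\<zeta>. \<zeta> \<in> ball 0 1 \<Longrightarrow>
       ((\<lambda>t. \<Sum>k<n. of_real (1 - (cmod (circ t * \<zeta>))\<^sup>2) ^ k * (1 - cnj (circ t * \<zeta>)) ^ (n - 1 - k) * g k (circ t * \<zeta>))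
          has_integral poly p (of_real (1 - (cmod \<zeta>)\<^sup>2))) {0..1}"
proof -
  define c where "c k l = of_nat (n - 1 - k choose l) * (-1) ^ l * ((deriv ^^ l) (g k) 0 / fact l)" for k l
  \<comment> \<open>\<open>[:1, -1:]\<close> stands for |\<zeta>|^2 = 1 - X as a polynomial in
    X.\<close>
  define p where "p = (\<Sum>k<n. monom 1 k * (\<Sum>l\<le>n - 1 - k. smult (c k l) ([:1, -1:] ^ l)))"
  have "degree p \<le> n - 1"
    unfolding p_def
  proof (rule degree_sum_le)
    fix k assume k: "k \<in> {..<n}"
    have "degree (\<Sum>l\<le>n - 1 - k. smult (c k l) ([:1, -1:] ^ l)) \<le> n - 1 - k"
    proof (rule degree_sum_le)
      fix l assume "l \<in> {..n - 1 - k}"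
      moreover have "degree (smult (c k l) ([:1, -1:] ^ l)) \<le> degree ([:1, -1:] :: complex poly) * l"
        by (rule order_trans[OF degree_smult_le degree_power_le])
      ultimately show "degree (smult (c k l) ([:1, -1:] ^ l)) \<le> n - 1 - k"
        by simp
    qed simp
    moreover have "degree (monom (1::complex) k) = k"
      by (simp add: degree_monom_eq)
    ultimately show "degree (monom 1 k * (\<Sum>l\<le>n - 1 - k. smult (c k l) ([:1, -1:] ^ l))) \<le> n - 1"
      using degree_mult_le[of "monom 1 k" "\<Sum>l\<le>n - 1 - k. smult (c k l) ([:1, -1:] ^ l)"] k by simp
  qed simp
  then have "degree p < n"
    using n by simp
  moreover have "((\<lambda>t. \<Sum>k<n. of_real (1 - (cmod (circ t * \<zeta>))\<^sup>2) ^ k * (1 - cnj (circ t * \<zeta>)) ^ (n - 1 - k) * g k (circ t * \<zeta>))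
          has_integral poly p (of_real (1 - (cmod \<zeta>)\<^sup>2))) {0..1}" if \<zeta>: "\<zeta> \<in> ball 0 1" for \<zeta>
  proof -
    define X where "X = complex_of_real (1 - (cmod \<zeta>)\<^sup>2)"
    have pX: "poly p X = (\<Sum>k<n. \<Sum>l\<le>n - 1 - k. X ^ k * (of_nat (n - 1 - k choose l) * (-1) ^ l)
         * (of_real ((cmod \<zeta>)\<^sup>2) ^ l * ((deriv ^^ l) (g k) 0 / fact l)))"
      unfolding p_def poly_sum poly_mult poly_monom poly_smult poly_power sum_distrib_left
      by (intro sum.cong refl) (simp add: c_def X_def)
    have "((\<lambda>t. \<Sum>k<n. \<Sum>l\<le>n - 1 - k. X ^ k * (of_nat (n - 1 - k choose l) * (-1) ^ l) * (cnj (circ t * \<zeta>) ^ l * g k (circ t * \<zeta>)))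
        has_integral poly p X) {0..1}"
      unfolding pX using g \<zeta> by (intro has_integral_sum has_integral_mult_right circle_mean) auto
    then show ?thesis
      unfolding X_def[symmetric]
    proof (rule has_integral_eq[rotated])
      fix t :: real
      define y where "y = circ t * \<zeta>"
      have X: "of_real (1 - (cmod y)\<^sup>2) = X"
        by (simp add: y_def X_def norm_mult)
      have "(1 - cnj y) ^ (n - 1 - k) = (\<Sum>l\<le>n - 1 - k. of_nat (n - 1 - k choose l) * (-1) ^ l * cnj y ^ l)" for k
      proof -
        have "(1 - cnj y) ^ (n - 1 - k) = (- cnj y + 1) ^ (n - 1 - k)"
          by simp
        also have "\<dots> = (\<Sum>l\<le>n - 1 - k. of_nat (n - 1 - k choose l) * (- cnj y) ^ l * 1 ^ (n - 1 - k - l))"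
          by (rule binomial_ring)
        also have "\<dots> = (\<Sum>l\<le>n - 1 - k. of_nat (n - 1 - k choose l) * (-1) ^ l * cnj y ^ l)"
          by (intro sum.cong refl) (simp add: power_minus[of "cnj y"])
        finally show ?thesis .
      qed
      then show "(\<Sum>k<n. \<Sum>l\<le>n - 1 - k. X ^ k * (of_nat (n - 1 - k choose l) * (-1) ^ l) * (cnj (circ t * \<zeta>) ^ l * g k (circ t * \<zeta>))) =
        (\<Sum>k<n. of_real (1 - (cmod (circ t * \<zeta>))\<^sup>2) ^ k * (1 - cnj (circ t * \<zeta>)) ^ (n - 1 - k) * g k (circ t * \<zeta>))"
        unfolding y_def[symmetric] X by (simp add: sum_distrib_left sum_distrib_right mult_ac)
    qed
  qed
  ultimately show thesis
    by (rule that)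
qed

subsection \<open>Surjectivity\<close>

theorem polyanalytic_orth_imp_zero:
  assumes n: "n \<ge> 1" and h: "\<And>k. k < n \<Longrightarrow> h k holomorphic_on \<bbbU>"
    and G_eq: "\<And>z. z \<in> \<bbbU> \<Longrightarrow> G z = (\<Sum>k<n. of_real (Im z) ^ k * h k z)"
    and G: "G \<in> L2_fun (lebesgue_on \<bbbU>)"
    and orth: "\<And>f. f \<in> L2_vec n \<Longrightarrow> Bergman_inner G (bergman_transform n f) = 0"
    and w: "w \<in> \<bbbU>"
  shows "G w = 0"
proof -
  let ?D = "ball (0::complex) 1"
  define \<phi> where "\<phi> = cayley w"
  define \<phi>' where "\<phi>' \<zeta> = (w - cnj w) / (1 - \<zeta>)\<^sup>2" for \<zeta>
  define s0 where "s0 = complex_of_real (Im w)"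
  define X where "X \<zeta> = complex_of_real (1 - (cmod \<zeta>)\<^sup>2)" for \<zeta> :: complex
  \<comment> \<open>The added quotient has modulus |1 - \<zeta>|^(-2), which is |\<phi>'| up to a
    constant, so L2 norms are preserved up to a constant. Its n - 1 antiholomorphic factors clear
    the denominators (1 - cnj \<zeta>)^k coming from (Im z)^k with k < n.\<close>
  define Gh where "Gh \<zeta> = G (\<phi> \<zeta>) * (1 - cnj \<zeta>) ^ (n - 1) / (1 - \<zeta>) ^ (n + 1)" for \<zeta>
  have s0: "s0 \<noteq> 0"
    using w by (simp add: s0_def upper_half_plane_def)
  note cf = cayley_facts(1,2) cayley_facts(3-6)[of _ w, folded \<phi>_def \<phi>'_def s0_def]
  have \<phi>_deriv: "(\<phi> has_field_derivative \<phi>' \<zeta>) (at \<zeta>)" if "\<zeta> \<in> ?D" for \<zeta>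
    unfolding \<phi>_def \<phi>'_def by (rule cayley_has_field_derivative[OF that])
  have \<phi>_hol: "\<phi> holomorphic_on ?D"
    unfolding holomorphic_on_open[OF open_ball] using \<phi>_deriv by blast
  have \<phi>_img: "\<phi> ` ?D = \<bbbU>"
    unfolding \<phi>_def by (rule cayley_image[OF w])
  have \<phi>_in: "\<phi> \<zeta> \<in> \<bbbU>" if "\<zeta> \<in> ?D" for \<zeta>
    using \<phi>_img that by blast
  have \<phi>_cont: "continuous_on ?D \<phi>"
    by (rule holomorphic_on_imp_continuous_on[OF \<phi>_hol])
  have G_cont: "continuous_on \<bbbU> G"
  proof -
    have "continuous_on \<bbbU> (\<lambda>z. \<Sum>k<n. of_real (Im z) ^ k * h k z)"
      using polyanalytic_sum(1)[of n h 0] h by simp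
    then show ?thesis
      by (subst continuous_on_cong[OF refl G_eq]) auto
  qed
  have ne: "1 - \<zeta> \<noteq> 0" if "\<zeta> \<in> ?D" for \<zeta>
    by (rule cf(1)[OF that])
  have Gh_cont: "continuous_on ?D Gh"
    unfolding Gh_def
    by (intro continuous_intros continuous_on_compose2[OF G_cont \<phi>_cont]) (use ne \<phi>_in in auto)
  have X_cont: "continuous_on A X" for A
    unfolding X_def by (intro continuous_intros)
  define g where "g k \<zeta> = s0 ^ k * h k (\<phi> \<zeta>) / (1 - \<zeta>) ^ (n + 1 + k)" for k \<zeta>
  have g_hol: "g k holomorphic_on ?D" if "k < n" for k
  proof -
    have "(\<lambda>\<zeta>. h k (\<phi> \<zeta>)) holomorphic_on ?D"
      using holomorphic_on_compose_gen[OF \<phi>_hol h[OF that]] \<phi>_img by (simp add: o_def)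
    then show ?thesis
      unfolding g_def by (intro holomorphic_intros) (use ne in auto)
  qed
  have Gh_eq: "Gh \<zeta> = (\<Sum>k<n. X \<zeta> ^ k * (1 - cnj \<zeta>) ^ (n - 1 - k) * g k \<zeta>)" if \<zeta>: "\<zeta> \<in> ?D" for \<zeta>
  proof -
    define a b where "a = 1 - \<zeta>" and "b = 1 - cnj \<zeta>"
    have ab: "a \<noteq> 0" "b \<noteq> 0"
      using cf(1,2)[OF \<zeta>] by (auto simp: a_def b_def)
    have Im: "of_real (Im (\<phi> \<zeta>)) = s0 * X \<zeta> / (a * b)"
      unfolding cf(5)[OF \<zeta>] X_def a_def b_def ..
    have "Gh \<zeta> = (\<Sum>k<n. (s0 * X \<zeta> / (a * b)) ^ k * h k (\<phi> \<zeta>)) * b ^ (n - 1) / a ^ (n + 1)"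
      unfolding Gh_def G_eq[OF \<phi>_in[OF \<zeta>]] Im a_def b_def ..
    also have "\<dots> = (\<Sum>k<n. X \<zeta> ^ k * b ^ (n - 1 - k) * (s0 ^ k * h k (\<phi> \<zeta>) / a ^ (n + 1 + k)))"
      unfolding sum_distrib_right sum_divide_distrib
    proof (intro sum.cong refl)
      fix k assume "k \<in> {..<n}"
      then have "n - 1 = (n - 1 - k) + k"
        by simp
      then have "b ^ (n - 1) = b ^ (n - 1 - k) * b ^ k"
        by (metis power_add)
      then show "(s0 * X \<zeta> / (a * b)) ^ k * h k (\<phi> \<zeta>) * b ^ (n - 1) / a ^ (n + 1) =
          X \<zeta> ^ k * b ^ (n - 1 - k) * (s0 ^ k * h k (\<phi> \<zeta>) / a ^ (n + 1 + k))"
        using ab by (simp add: power_divide power_mult_distrib power_add mult_ac)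
    qed
    finally show ?thesis
      unfolding g_def a_def b_def .
  qed
  obtain p where p: "degree p < n" "\<And>\<zeta>. \<zeta> \<in> ?D \<Longrightarrow>
       ((\<lambda>t. \<Sum>k<n. X (circ t * \<zeta>) ^ k * (1 - cnj (circ t * \<zeta>)) ^ (n - 1 - k) * g k (circ t * \<zeta>))
          has_integral poly p (X \<zeta>)) {0..1}"
    using disc_polyanalytic_mean[of n g, folded X_def, OF g_hol n] by blast
  have circ_D: "circ t * \<zeta> \<in> ?D" if "\<zeta> \<in> ?D" for t \<zeta>
    using that by (simp add: norm_mult)
  have mean: "((\<lambda>t. Gh (circ t * \<zeta>)) has_integral poly p (X \<zeta>)) {0..1}" if \<zeta>: "\<zeta> \<in> ?D" for \<zeta>
    unfolding Gh_eq[OF circ_D[OF \<zeta>]] by (rule p(2)[OF \<zeta>])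
  have radial: "integrable lborel (\<lambda>\<zeta>. indicator ?D \<zeta> *\<^sub>R (Gh \<zeta> * X \<zeta> ^ j))"
    "(\<integral>\<zeta>. indicator ?D \<zeta> *\<^sub>R (Gh \<zeta> * X \<zeta> ^ j) \<partial>lborel) = 0" if j: "j < n" for j
  proof -
    \<comment> \<open>The exponents are tuned so that cnj E times the Jacobian |\<phi>'|^2 pulls
      back to X^j times the quotient in \<open>Gh\<close>.\<close>
    define E where "E z = of_real (Im z) ^ j * (cnj z - w) ^ (n - 1 - j) / (z - cnj w) ^ (n + 1 + j)" for z
    define H where "H z = G z * cnj (E z)" for z
    have E: "bergman_orth G E"
      unfolding E_def using bergman_orth_radial[OF G orth j w] by simp
    have E_cont: "continuous_on \<bbbU> E"
    proof -
      have "z - cnj w \<noteq> 0" if "z \<in> \<bbbU>" for z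
        using w that by (auto simp: upper_half_plane_def complex_eq_iff)
      then show ?thesis
        unfolding E_def by (intro continuous_intros) auto
    qed
    have H_cont: "continuous_on \<bbbU> H"
      unfolding H_def by (intro continuous_intros G_cont E_cont)
    have Hi: "integrable lborel (\<lambda>z. indicator \<bbbU> z *\<^sub>R H z)"
      using L2_fun_integrable_mult(2)[OF G, of E] E integral_lebesgue_on_continuous(1)[OF _ H_cont]
      by (simp add: bergman_orth_def H_def[abs_def])
    have H0: "(\<integral>z. indicator \<bbbU> z *\<^sub>R H z \<partial>lborel) = 0"
      using E integral_lebesgue_on_continuous(2)[OF _ H_cont]
      by (simp add: bergman_orth_def H_def[abs_def] Bergman_inner_def)
    have \<phi>'_cont: "continuous_on ?D \<phi>'"
      unfolding \<phi>'_def by (intro continuous_intros) (use ne in auto)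
    note cv = holomorphic_change_of_variables[of ?D \<phi> \<phi>' H, unfolded \<phi>_img,
        OF open_ball open_upper_half_plane cayley_inj[OF w, folded \<phi>_def] \<phi>_deriv \<phi>'_cont H_cont Hi]
    define \<kappa> where "\<kappa> = 2 * \<i> * s0"
    \<comment> \<open>Collects the constants of the pull-back: those of cnj E, and 4 s0^2 from the
      Jacobian.\<close>
    define K where "K = s0 ^ j * \<kappa> ^ (n - 1 - j) / (- \<kappa>) ^ (n + 1 + j) * (4 * s0\<^sup>2)"
    have "K \<noteq> 0"
      using s0 by (simp add: K_def \<kappa>_def)
    have pw: "(cmod (\<phi>' \<zeta>))\<^sup>2 *\<^sub>R H (\<phi> \<zeta>) = K * (Gh \<zeta> * X \<zeta> ^ j)" if \<zeta>: "\<zeta> \<in> ?D" for \<zeta>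
    proof -
      define a b where "a = 1 - \<zeta>" and "b = 1 - cnj \<zeta>"
      have ab: "a \<noteq> 0" "b \<noteq> 0"
        using cf(1,2)[OF \<zeta>] by (auto simp: a_def b_def)
      have Im: "of_real (Im (\<phi> \<zeta>)) = s0 * X \<zeta> / (a * b)"
        unfolding cf(5)[OF \<zeta>] X_def a_def b_def ..
      have 1: "\<phi> \<zeta> - cnj w = \<kappa> / a"
        unfolding cf(3)[OF \<zeta>] \<kappa>_def a_def ..
      have 2: "cnj (\<phi> \<zeta>) - w = - \<kappa> / b"
        unfolding cf(4)[OF \<zeta>] \<kappa>_def b_def by simp
      have 3: "of_real ((cmod (\<phi>' \<zeta>))\<^sup>2) = 4 * s0\<^sup>2 / (a\<^sup>2 * b\<^sup>2)"
        unfolding cf(6)[OF \<zeta>] a_def b_def s0_def by simp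
      have cE: "cnj (E (\<phi> \<zeta>)) = (s0 * X \<zeta> / (a * b)) ^ j * (\<kappa> / a) ^ (n - 1 - j) / (- \<kappa> / b) ^ (n + 1 + j)"
        unfolding E_def 1[symmetric] 2[symmetric] Im[symmetric] by simp
      have "(cmod (\<phi>' \<zeta>))\<^sup>2 *\<^sub>R H (\<phi> \<zeta>) = 4 * s0\<^sup>2 / (a\<^sup>2 * b\<^sup>2) * (G (\<phi> \<zeta>) *
          ((s0 * X \<zeta> / (a * b)) ^ j * (\<kappa> / a) ^ (n - 1 - j) / (- \<kappa> / b) ^ (n + 1 + j)))"
        unfolding scaleR_conv_of_real 3 H_def cE ..
      also have "\<dots> = K * (G (\<phi> \<zeta>) * (b ^ (n + 1 + j) / (b\<^sup>2 * b ^ j)) / (a\<^sup>2 * a ^ j * a ^ (n - 1 - j)) * X \<zeta> ^ j)"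
        unfolding K_def power_divide power_mult_distrib by (simp add: mult_ac)
      also have "a\<^sup>2 * a ^ j * a ^ (n - 1 - j) = a ^ (n + 1)"
      proof -
        have "2 + j + (n - 1 - j) = n + 1"
          using j by simp
        then show ?thesis
          by (simp only: power_add[symmetric])
      qed
      also have "b ^ (n + 1 + j) / (b\<^sup>2 * b ^ j) = b ^ (n - 1)"
      proof -
        have "n + 1 + j = (n - 1) + (2 + j)"
          using n by simp
        then have "b ^ (n + 1 + j) = b ^ (n - 1) * (b\<^sup>2 * b ^ j)"
          by (simp only: power_add)
        then show ?thesis
          using ab by simp
      qed
      finally show ?thesis
        unfolding Gh_def a_def b_def .
    qed
    have eq: "indicator ?D \<zeta> *\<^sub>R (Gh \<zeta> * X \<zeta> ^ j) = (1 / K) * (indicator ?D \<zeta> *\<^sub>R ((cmod (\<phi>' \<zeta>))\<^sup>2 *\<^sub>R H (\<phi> \<zeta>)))" for \<zeta>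
    proof (cases "\<zeta> \<in> ?D")
      case True
      show ?thesis
        unfolding pw[OF True] using \<open>K \<noteq> 0\<close> by simp
    qed simp
    show "integrable lborel (\<lambda>\<zeta>. indicator ?D \<zeta> *\<^sub>R (Gh \<zeta> * X \<zeta> ^ j))"
      unfolding eq by (intro integrable_mult_right cv(1))
    show "(\<integral>\<zeta>. indicator ?D \<zeta> *\<^sub>R (Gh \<zeta> * X \<zeta> ^ j) \<partial>lborel) = 0"
      unfolding eq integral_mult_right_zero using cv(2) H0 by (simp only: mult_zero_right)
  qed
  \<comment> \<open>The conjugate of the rotational mean. It is a polynomial in X of degree below n,
    so \<open>Gh\<close> is orthogonal to the mean, and it is itself invariant under
    rotation.\<close>
  define b where "b \<zeta> = cnj (poly p (X \<zeta>))" for \<zeta>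
  have b_cont: "continuous_on A b" for A
    unfolding b_def by (intro continuous_intros X_cont)
  have b_circ: "b (circ t * \<zeta>) = b \<zeta>" for t \<zeta>
    by (simp add: b_def X_def norm_mult)
  define F where "F \<zeta> = Gh \<zeta> * b \<zeta>" for \<zeta>
  have F_cont: "continuous_on ?D F"
    unfolding F_def by (intro continuous_intros Gh_cont b_cont)
  have F_eq: "indicator ?D \<zeta> *\<^sub>R F \<zeta> = (\<Sum>j\<le>degree p. cnj (coeff p j) * (indicator ?D \<zeta> *\<^sub>R (Gh \<zeta> * X \<zeta> ^ j)))" for \<zeta>
  proof -
    have "b \<zeta> = (\<Sum>j\<le>degree p. cnj (coeff p j) * X \<zeta> ^ j)"
      unfolding b_def poly_altdef by (simp add: X_def)
    then show ?thesis
      by (simp add: F_def sum_distrib_left scaleR_sum_right mult_ac)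
  qed
  have Fi: "integrable lborel (\<lambda>\<zeta>. indicator ?D \<zeta> *\<^sub>R F \<zeta>)"
    unfolding F_eq using p(1) by (intro Bochner_Integration.integrable_sum integrable_mult_right radial) auto
  have F0: "(\<integral>\<zeta>. indicator ?D \<zeta> *\<^sub>R F \<zeta> \<partial>lborel) = 0"
  proof -
    have "(\<integral>\<zeta>. indicator ?D \<zeta> *\<^sub>R F \<zeta> \<partial>lborel) =
        (\<Sum>j\<le>degree p. \<integral>\<zeta>. cnj (coeff p j) * (indicator ?D \<zeta> *\<^sub>R (Gh \<zeta> * X \<zeta> ^ j)) \<partial>lborel)"
      unfolding F_eq using p(1) by (intro Bochner_Integration.integral_sum integrable_mult_right radial) auto
    also have "\<dots> = 0"
      unfolding integral_mult_right_zero using radial(2) p(1) by (intro sum.neutral) auto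
    finally show ?thesis .
  qed
  \<comment> \<open>Fubini over angle and disc: integrating over the disc first gives 0 by rotation
    invariance, integrating over the angle first gives the integral of the squared modulus of the
    mean.\<close>
  define f where "f t \<zeta> = indicator {0..1} t *\<^sub>R (indicator ?D \<zeta> *\<^sub>R F (circ t * \<zeta>))" for t :: real and \<zeta>
  have fi: "integrable (lborel \<Otimes>\<^sub>M lborel) (case_prod f)"
  proof (rule lborel_pair.Fubini_integrable)
    define FD where "FD \<zeta> = indicator ?D \<zeta> *\<^sub>R F \<zeta>" for \<zeta>
    have FD: "FD \<in> borel_measurable borel"
      unfolding FD_def by (rule borel_measurable_continuous_on_indicator[OF _ F_cont]) simp
    have "continuous_on UNIV (\<lambda>q. circ (fst q) * snd q)"
      unfolding circ_def by (intro continuous_intros)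
    then have "(\<lambda>q. circ (fst q) * snd q) \<in> borel_measurable borel"
      by (rule borel_measurable_continuous_onI)
    from measurable_compose[OF this FD]
    have m: "(\<lambda>q. FD (circ (fst q) * snd q)) \<in> borel_measurable borel" .
    have "(\<lambda>q. indicator {0..1} (fst q) *\<^sub>R FD (circ (fst q) * snd q)) \<in> borel_measurable (borel \<Otimes>\<^sub>M borel)"
      using m unfolding borel_prod[symmetric] by measurable
    also have "(\<lambda>q. indicator {0..1} (fst q) *\<^sub>R FD (circ (fst q) * snd q)) = case_prod f"
      by (auto simp: fun_eq_iff f_def FD_def indicator_def norm_mult)
    finally show "case_prod f \<in> borel_measurable (lborel \<Otimes>\<^sub>M lborel)"
      by (simp cong: measurable_cong_sets sets_pair_measure_cong)
    show "AE t in lborel. integrable lborel (\<lambda>\<zeta>. case (t, \<zeta>) of (t, \<zeta>) \<Rightarrow> f t \<zeta>)"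
      unfolding f_def prod.case
      by (intro AE_I2 integrable_scaleR_right disc_rotation(1)[OF norm_circ F_cont Fi])
    define C where "C = (\<integral>\<zeta>. norm (indicator ?D \<zeta> *\<^sub>R F \<zeta>) \<partial>lborel)"
    \<comment> \<open>Rotations preserve the integral of the norm as well, so the inner integral is
      constant in t on [0, 1].\<close>
    have "(\<integral>\<zeta>. norm (f t \<zeta>) \<partial>lborel) = indicator {0..1} t * C" for t
    proof -
      have nF: "continuous_on ?D (\<lambda>\<zeta>. complex_of_real (cmod (F \<zeta>)))"
        by (intro continuous_intros F_cont)
      have eq: "indicator ?D \<zeta> *\<^sub>R complex_of_real (cmod (F x)) = complex_of_real (norm (indicator ?D \<zeta> *\<^sub>R F x))" for \<zeta> x
        by (simp add: indicator_def)
      have nFi: "integrable lborel (\<lambda>\<zeta>. indicator ?D \<zeta> *\<^sub>R complex_of_real (cmod (F \<zeta>)))"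
        unfolding eq using integrable_norm[OF Fi] by (rule integrable_of_real)
      have "complex_of_real (\<integral>\<zeta>. norm (indicator ?D \<zeta> *\<^sub>R F (circ t * \<zeta>)) \<partial>lborel) = complex_of_real C"
        using disc_rotation(2)[OF norm_circ nF nFi, of t] unfolding eq integral_complex_of_real C_def .
      then have C: "(\<integral>\<zeta>. norm (indicator ?D \<zeta> *\<^sub>R F (circ t * \<zeta>)) \<partial>lborel) = C"
        by (simp only: of_real_eq_iff)
      have "(\<integral>\<zeta>. norm (f t \<zeta>) \<partial>lborel) =
          (\<integral>\<zeta>. indicator {0..1} t * norm (indicator ?D \<zeta> *\<^sub>R F (circ t * \<zeta>)) \<partial>lborel)"
        unfolding f_def by (intro Bochner_Integration.integral_cong refl) (simp add: indicator_def)
      then show ?thesis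
        unfolding integral_mult_right_zero C .
    qed
    then show "integrable lborel (\<lambda>t. \<integral>\<zeta>. norm (case (t, \<zeta>) of (t, \<zeta>) \<Rightarrow> f t \<zeta>) \<partial>lborel)"
      by (simp add: emeasure_lborel_Icc_eq)
  qed
  have inner: "(\<integral>t. f t \<zeta> \<partial>lborel) = of_real (indicator ?D \<zeta> *\<^sub>R (cmod (poly p (X \<zeta>)))\<^sup>2)" for \<zeta>
  proof (cases "\<zeta> \<in> ?D")
    case True
    have "continuous_on {0..1} (\<lambda>t. Gh (circ t * \<zeta>))"
      unfolding circ_def
      by (intro continuous_on_compose2[OF Gh_cont] continuous_intros) (use circ_D[OF True] in \<open>auto simp: circ_def\<close>)
    then have si: "set_integrable lborel {0..1} (\<lambda>t. Gh (circ t * \<zeta>))"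
      by (rule borel_integrable_atLeastAtMost')
    have "(\<integral>t. f t \<zeta> \<partial>lborel) = (\<integral>t. (indicator {0..1} t *\<^sub>R Gh (circ t * \<zeta>)) * b \<zeta> \<partial>lborel)"
      using True by (simp add: f_def F_def b_circ)
    also have "\<dots> = (\<integral>t. indicator {0..1} t *\<^sub>R Gh (circ t * \<zeta>) \<partial>lborel) * b \<zeta>"
      by (rule integral_mult_left_zero)
    also have "(\<integral>t. indicator {0..1} t *\<^sub>R Gh (circ t * \<zeta>) \<partial>lborel) = poly p (X \<zeta>)"
      using set_borel_integral_eq_integral(2)[OF si] integral_unique[OF mean[OF True]]
      by (simp add: set_lebesgue_integral_def)
    also have "poly p (X \<zeta>) * b \<zeta> = of_real ((cmod (poly p (X \<zeta>)))\<^sup>2)"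
      unfolding b_def complex_norm_square ..
    finally show ?thesis
      using True by simp
  qed (simp add: f_def)
  have "(\<integral>\<zeta>. (\<integral>t. f t \<zeta> \<partial>lborel) \<partial>lborel) = (\<integral>t. (\<integral>\<zeta>. f t \<zeta> \<partial>lborel) \<partial>lborel)"
    by (rule lborel_pair.Fubini_integral[OF fi])
  also have "\<dots> = 0"
    unfolding f_def integral_scaleR_right disc_rotation(2)[OF norm_circ F_cont Fi] F0 by simp
  finally have z: "(\<integral>\<zeta>. indicator ?D \<zeta> *\<^sub>R (cmod (poly p (X \<zeta>)))\<^sup>2 \<partial>lborel) = 0"
    unfolding inner integral_complex_of_real by simp
  have "integrable lborel (\<lambda>\<zeta>. complex_of_real (indicator ?D \<zeta> *\<^sub>R (cmod (poly p (X \<zeta>)))\<^sup>2))"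
    using lborel_pair.integrable_snd[OF fi] unfolding inner .
  then have i: "integrable lborel (\<lambda>\<zeta>. indicator ?D \<zeta> *\<^sub>R (cmod (poly p (X \<zeta>)))\<^sup>2)"
    by (simp only: complex_of_real_integrable_eq)
  have "poly p (X 0) = 0"
    by (rule zero_if_integral_cmod_sq_zero[OF open_ball _ i z]) (intro continuous_intros X_cont, simp)
  \<comment> \<open>At the centre every rotation fixes the point, so the mean is the value
    \<open>Gh 0\<close>, which is \<open>G w\<close>.\<close>
  moreover have "((\<lambda>t::real. Gh 0) has_integral poly p (X 0)) {0..1}"
    using mean[of 0] by simp
  then have "Gh 0 = poly p (X 0)"
    using has_integral_unique[OF has_integral_const_real[of "Gh 0" 0 1]] by simp
  ultimately show ?thesis
    by (simp add: Gh_def \<phi>_def cayley_def)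
qed

text \<open>The isometry transfers completeness from the components on the half line to the range,
  so \<open>L2_projection\<close> applies; the remainder \<open>G\<close> is again polyanalytic and
  is killed by \<open>polyanalytic_orth_imp_zero\<close>.\<close>

theorem bergman_transform_surjective:
  assumes n: "n \<ge> 1" and F: "F \<in> polyanalytic_Bergman n"
  shows "\<exists>f\<in>L2_vec n. \<forall>z\<in>\<bbbU>. bergman_transform n f z = F z"
proof -
  let ?M = "lebesgue_on \<bbbU>" and ?P = "lebesgue_on {0::real<..}"
  let ?T = "bergman_transform n"
  have FC: "C_class_on n \<bbbU> F" and Fz: "\<And>z. z \<in> \<bbbU> \<Longrightarrow> (d_dzbar ^^ n) F z = 0"
    and Fi: "integrable ?M (\<lambda>z. (cmod (F z))\<^sup>2)"
    using F by (auto simp: polyanalytic_Bergman_def)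
  have "F \<in> borel_measurable ?M"
    by (rule continuous_imp_measurable_on_sets_lebesgue[OF C_class_on_imp_continuous_on[OF FC]]) simp
  with Fi have FL: "F \<in> L2_fun ?M"
    by (simp add: L2_fun_def)
  \<comment> \<open>Agreement on \<bbbU> only: linear combinations of transforms are identified as
    transforms at points of \<bbbU>.\<close>
  define V where "V = {v. \<exists>f\<in>L2_vec n. \<forall>z\<in>\<bbbU>. v z = ?T f z}"
  have T_sq: "L2_sq ?M (\<lambda>z. u z - v z) = (\<Sum>k<n. L2_sq ?P (\<lambda>t. f k t - g k t))"
    if "f \<in> L2_vec n" "g \<in> L2_vec n" "\<And>z. z \<in> \<bbbU> \<Longrightarrow> u z = ?T f z" "\<And>z. z \<in> \<bbbU> \<Longrightarrow> v z = ?T g z" for u v f g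
  proof -
    have d: "(\<lambda>k t. f k t + (-1) * g k t) \<in> L2_vec n"
      by (rule L2_vec_add[OF that(1,2)])
    have "L2_sq ?M (\<lambda>z. u z - v z) = L2_sq ?M (?T (\<lambda>k t. f k t + (-1) * g k t))"
      unfolding L2_sq_def using that(3,4) bergman_transform_linear[OF that(1,2), of _ 1 "-1"]
      by (intro Bochner_Integration.integral_cong) auto
    also have "\<dots> = (\<Sum>k<n. L2_sq ?P (\<lambda>t. f k t + (-1) * g k t))"
      by (rule bergman_transform_isometry(2)[OF d])
    finally show ?thesis
      by simp
  qed
  obtain v where v: "v \<in> V" "\<And>u. u \<in> V \<Longrightarrow> (\<integral>z. (F z - v z) * cnj (u z) \<partial>?M) = 0"
  proof (rule L2_projection[of V ?M F])
    show "V \<subseteq> L2_fun ?M"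
    proof
      fix v assume "v \<in> V"
      then obtain f where f: "f \<in> L2_vec n" "\<And>z. z \<in> \<bbbU> \<Longrightarrow> v z = ?T f z"
        by (auto simp: V_def)
      have "v \<in> L2_fun ?M \<longleftrightarrow> ?T f \<in> L2_fun ?M"
        by (rule L2_fun_cong) (use f(2) in auto)
      then show "v \<in> L2_fun ?M"
        using bergman_transform_isometry(1)[OF f(1)] by simp
    qed
    show "(\<lambda>_. 0) \<in> V"
    proof -
      have z: "(\<lambda>k t. 0) \<in> L2_vec n"
        by (simp add: L2_vec_def L2_pos_eq_L2_fun)
      moreover have "?T (\<lambda>k t. 0) z = 0" for z
        by (simp add: bergman_transform_def laplace_def)
      ultimately show ?thesis
        unfolding V_def by (intro CollectI bexI[of _ "\<lambda>k t. 0"]) auto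
    qed
    show "(\<lambda>z. u z + c * v z) \<in> V" if uv: "u \<in> V" "v \<in> V" for u v c
    proof -
      obtain f where f: "f \<in> L2_vec n" "\<And>z. z \<in> \<bbbU> \<Longrightarrow> u z = ?T f z"
        using uv by (auto simp: V_def)
      obtain g where g: "g \<in> L2_vec n" "\<And>z. z \<in> \<bbbU> \<Longrightarrow> v z = ?T g z"
        using uv by (auto simp: V_def)
      have "\<forall>z\<in>\<bbbU>. u z + c * v z = ?T (\<lambda>k t. f k t + c * g k t) z"
        using f g bergman_transform_linear[OF f(1) g(1), of _ 1 c] by simp
      then show ?thesis
        unfolding V_def using L2_vec_add[OF f(1) g(1), of c] by blast
    qed
    show "\<exists>w\<in>V. (\<lambda>j. L2_sq ?M (\<lambda>x. v j x - w x)) \<longlonglongrightarrow> 0"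
      if vV: "\<And>j::nat. v j \<in> V" and Cauchy: "\<And>e. e > 0 \<Longrightarrow> \<exists>N. \<forall>i\<ge>N. \<forall>j\<ge>N. L2_sq ?M (\<lambda>x. v i x - v j x) < e" for v
    proof -
      have "\<exists>f. f \<in> L2_vec n \<and> (\<forall>z\<in>\<bbbU>. v j z = ?T f z)" for j
        using vV[of j] by (auto simp: V_def)
      then obtain f where f: "\<And>j. f j \<in> L2_vec n" "\<And>j z. z \<in> \<bbbU> \<Longrightarrow> v j z = ?T (f j) z"
        by metis
      have fL: "f j k \<in> L2_fun ?P" if "k < n" for j k
        using f(1)[of j] that by (simp add: L2_vec_def L2_pos_eq_L2_fun)
      have "\<exists>g. g \<in> L2_fun ?P \<and> (\<lambda>j. L2_sq ?P (\<lambda>t. f j k t - g t)) \<longlonglongrightarrow> 0" if k: "k < n" for k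
      proof -
        \<comment> \<open>One component is dominated by the sum over all of them, hence each
          component sequence is Cauchy.\<close>
        have le: "L2_sq ?P (\<lambda>t. f i k t - f j k t) \<le> L2_sq ?M (\<lambda>x. v i x - v j x)" for i j
        proof -
          have "L2_sq ?P (\<lambda>t. f i k t - f j k t) \<le> (\<Sum>k<n. L2_sq ?P (\<lambda>t. f i k t - f j k t))"
            using k by (intro member_le_sum[of k "{..<n}" "\<lambda>k. L2_sq ?P (\<lambda>t. f i k t - f j k t)"]) auto
          also have "\<dots> = L2_sq ?M (\<lambda>x. v i x - v j x)"
            by (rule T_sq[OF f(1) f(1), symmetric]) (use f(2) in auto)
          finally show ?thesis .
        qed
        obtain g where "g \<in> L2_fun ?P" "(\<lambda>j. L2_sq ?P (\<lambda>t. f j k t - g t)) \<longlonglongrightarrow> 0"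
        proof (rule L2_complete[of "\<lambda>j. f j k" ?P])
          show "f j k \<in> L2_fun ?P" for j
            by (rule fL[OF k])
          show "\<exists>N. \<forall>i\<ge>N. \<forall>j\<ge>N. L2_sq ?P (\<lambda>x. f i k x - f j k x) < e" if "e > 0" for e
            using Cauchy[OF that] le le_less_trans by meson
        qed
        then show ?thesis
          by blast
      qed
      then obtain g where g: "\<And>k. k < n \<Longrightarrow> g k \<in> L2_fun ?P"
        "\<And>k. k < n \<Longrightarrow> (\<lambda>j. L2_sq ?P (\<lambda>t. f j k t - g k t)) \<longlonglongrightarrow> 0"
        by metis
      have gL: "g \<in> L2_vec n"
        using g(1) by (simp add: L2_vec_def L2_pos_eq_L2_fun)
      have "L2_sq ?M (\<lambda>x. v j x - ?T g x) = (\<Sum>k<n. L2_sq ?P (\<lambda>t. f j k t - g k t))" for j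
        by (rule T_sq[OF f(1) gL f(2)]) auto
      moreover have "(\<lambda>j. \<Sum>k<n. L2_sq ?P (\<lambda>t. f j k t - g k t)) \<longlonglongrightarrow> (\<Sum>k<n. 0)"
        using g(2) by (intro tendsto_sum) auto
      ultimately have "(\<lambda>j. L2_sq ?M (\<lambda>x. v j x - ?T g x)) \<longlonglongrightarrow> 0"
        by simp
      moreover have "?T g \<in> V"
        using gL by (auto simp: V_def)
      ultimately show ?thesis
        by blast
    qed
  qed (use FL that in auto)
  obtain f where f: "f \<in> L2_vec n" "\<And>z. z \<in> \<bbbU> \<Longrightarrow> v z = ?T f z"
    using v(1) by (auto simp: V_def)
  define G where "G z = F z + (-1) * ?T f z" for z
  have GL: "G \<in> L2_fun ?M"
    unfolding G_def by (rule L2_fun_add[OF FL bergman_transform_isometry(1)[OF f(1)]])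
  have TC: "C_class_on n \<bbbU> (?T f)" and Tz: "\<And>z. z \<in> \<bbbU> \<Longrightarrow> (d_dzbar ^^ n) (?T f) z = 0"
    using bergman_transform_polyanalytic[OF f(1)] by auto
  have GC: "C_class_on n \<bbbU> G"
    unfolding G_def by (intro C_class_on_add FC TC) simp
  have Gz: "(d_dzbar ^^ n) G z = 0" if "z \<in> \<bbbU>" for z
    unfolding G_def d_dzbar_funpow_add[OF open_upper_half_plane FC TC that] using Fz[OF that] Tz[OF that] by simp
  obtain h where h: "\<And>k. k < n \<Longrightarrow> h k holomorphic_on \<bbbU>"
    "\<And>z. z \<in> \<bbbU> \<Longrightarrow> G z = (\<Sum>k<n. of_real (Im z) ^ k * h k z)"
    using polyanalytic_decomposition[OF GC Gz] by blast
  have "Bergman_inner G (?T g) = 0" if "g \<in> L2_vec n" for g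
  proof -
    have "?T g \<in> V"
      using that by (auto simp: V_def)
    from v(2)[OF this] have "(\<integral>z. (F z - v z) * cnj (?T g z) \<partial>?M) = 0" .
    moreover have "Bergman_inner G (?T g) = (\<integral>z. (F z - v z) * cnj (?T g z) \<partial>?M)"
      unfolding Bergman_inner_def G_def using f(2) by (intro Bochner_Integration.integral_cong) auto
    ultimately show ?thesis
      by simp
  qed
  then have "G z = 0" if "z \<in> \<bbbU>" for z
    using polyanalytic_orth_imp_zero[OF n h GL _ that] by blast
  then have "\<forall>z\<in>\<bbbU>. ?T f z = F z"
    by (simp add: G_def)
  then show ?thesis
    using f(1) by blast
qed

theorem theorem2:
  fixes n :: nat
  assumes "n \<ge> 1"
  shows "unitary_L2_Bergman n (\<lambda>f. poly_Ber n (\<lambda>k t. Ber_normalization k * f k t))"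
  unfolding unitary_L2_Bergman_def
proof (intro conjI ballI allI impI)
  note eq = poly_Ber_eq_bergman_transform
  show "poly_Ber n (\<lambda>k t. Ber_normalization k * f k t) \<in> polyanalytic_Bergman n" if f: "f \<in> L2_vec n" for f
  proof -
    let ?T = "poly_Ber n (\<lambda>k t. Ber_normalization k * f k t)"
    have "C_class_on n \<bbbU> ?T"
      by (rule C_class_on_cong[OF open_upper_half_plane _ bergman_transform_polyanalytic(1)[OF f]])
         (simp add: eq[OF f])
    moreover have "(d_dzbar ^^ n) ?T z = 0" if "z \<in> \<bbbU>" for z
      using d_dzbar_cong[OF open_upper_half_plane that eq[OF f], where m = n] bergman_transform_polyanalytic(2)[OF f that] by simp
    moreover have "?T \<in> L2_fun (lebesgue_on \<bbbU>) \<longleftrightarrow> bergman_transform n f \<in> L2_fun (lebesgue_on \<bbbU>)"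
      by (rule L2_fun_cong) (simp add: eq[OF f])
    then have "integrable (lebesgue_on \<bbbU>) (\<lambda>z. (cmod (?T z))\<^sup>2)"
      using bergman_transform_isometry(1)[OF f] by (simp add: L2_fun_def)
    ultimately show ?thesis
      by (simp add: polyanalytic_Bergman_def)
  qed
  show "poly_Ber n (\<lambda>k t. Ber_normalization k * f k t) z = poly_Ber n (\<lambda>k t. Ber_normalization k * g k t) z"
    if "f \<in> L2_vec n" "g \<in> L2_vec n" "L2_vec_eq n f g" "z \<in> \<bbbU>" for f g z
    using that bergman_transform_cong_AE[OF that(1-3)] by (simp add: eq)
  show "poly_Ber n (\<lambda>k t. Ber_normalization k * (a * f k t + b * g k t)) z =
      a * poly_Ber n (\<lambda>k t. Ber_normalization k * f k t) z + b * poly_Ber n (\<lambda>k t. Ber_normalization k * g k t) z"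
    if f: "f \<in> L2_vec n" and g: "g \<in> L2_vec n" and z: "z \<in> \<bbbU>" for f g a b z
  proof -
    have "f k \<in> L2_pos" "g k \<in> L2_pos" if "k < n" for k
      using f g that by (auto simp: L2_vec_def)
    then have h: "(\<lambda>k t. a * f k t + b * g k t) \<in> L2_vec n"
      unfolding L2_vec_def L2_pos_eq_L2_fun by (auto intro!: L2_fun_add L2_fun_cmult)
    show ?thesis
      unfolding eq[OF f z] eq[OF g z] eq[OF h z] by (rule bergman_transform_linear[OF f g z])
  qed
  show "Bergman_inner (poly_Ber n (\<lambda>k t. Ber_normalization k * f k t)) (poly_Ber n (\<lambda>k t. Ber_normalization k * g k t)) =
      L2_vec_inner n f g" if f: "f \<in> L2_vec n" and g: "g \<in> L2_vec n" for f g
  proof -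
    have "Bergman_inner (poly_Ber n (\<lambda>k t. Ber_normalization k * f k t)) (poly_Ber n (\<lambda>k t. Ber_normalization k * g k t)) =
        Bergman_inner (bergman_transform n f) (bergman_transform n g)"
      unfolding Bergman_inner_def by (rule Bochner_Integration.integral_cong) (simp_all add: eq[OF f] eq[OF g])
    then show ?thesis
      using bergman_transform_inner[OF f g] by simp
  qed
  show "\<exists>f\<in>L2_vec n. \<forall>z\<in>\<bbbU>. poly_Ber n (\<lambda>k t. Ber_normalization k * f k t) z = F z"
    if "F \<in> polyanalytic_Bergman n" for F
    using bergman_transform_surjective[OF assms that] by (auto simp: eq)
qed

end
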